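(* Let $R$ be a commutative ring with non-zero identity, $E$ an $R$-module, $I$ an ideal of $R$, and let $N,K,L$ be submodules of $E$. Then the following hold: (i) If $R$ is Noetherian, $E$ is finitely generated, $N\subseteq K\subseteq L$, $N$ is a Ratliff-Rush reduction of $K$ with respect to $I$ and $K$ is a Ratliff-Rush reduction of $L$ with respect to $I$, then $N$ is a Ratliff-Rush reduction of $L$ with respect to $I$. (ii) If $N\subseteq K$, then $\widetilde{I_N}\subseteq\widetilde{I_K}$. (iii) If $N\subseteq K$, $N$ is a Ratliff-Rush reduction of $K$ with respect to $I$ and $J$ is an ideal of $R$, then $JN$ is a Ratliff-Rush reduction of $JK$ with respect to $I$. (iv) If $N_1\subseteq N_2\subseteq N_3$ are submodules of $E$ such that $N_1$ is a Ratliff-Rush reduction of $N_3$ with respect to $I$, then $N_2$ is a Ratliff-Rush reduction of $N_3$ with respect to $I$. (v) If $N_1,N_2,M_1,M_2$ are submodules of $E$ such that $N_1$ is a Ratliff-Rush reduction of $N_2$ with respect to $I$ and $M_1$ is a Ratliff-Rush reduction of $M_2$ with respect to $I$, then $N_1+M_1$ is a Ratliff-Rush reduction of $N_2+M_2$ with respect to $I$. (vi) If $c\in R$ is an $E$-regular element and $N\subseteq K$ are such that $cN$ is a Ratliff-Rush reduction of $cK$ with respect to $I$, then $N$ is a Ratliff-Rush reduction of $K$ with respect to $I$. (vii) If $S$ is a multiplicatively closed subset of $R$ such that $0\notin S$, and $N$ is a Ratliff-Rush reduction of $K$ with respect to $I$, then $S^{-1}N$ is a Ratliff-Rush reduction of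 $S^{-1}K$ with respect to $S^{-1}I$. (viii) Let $(R,\mathfrak{m})$ be a Noetherian local ring, let $E$ be finitely generated, and let $K\subseteq L$. Then $K$ is a Ratliff-Rush reduction of $L$ with respect to $I$ if and only if $KR^*$ is a Ratliff-Rush reduction of $LR^*$ with respect to $IR^*$.
   Context: For an ideal $I$ of a commutative ring $R$, an $R$-module $E$ and a submodule $N$ of $E$, write $\widetilde{I_N}=\{e\in E: I^n e\subseteq I^{n+1}N\text{ for some }n\in\mathbb{N}\}$. If $N_1\subseteq N_2$ are submodules of $E$, then $N_1$ is called a Ratliff-Rush reduction of $N_2$ with respect to $I$ if $N_2\subseteq\widetilde{I_{N_1}}$; in other words, if for every $x\in N_2$ there exists $n\in\mathbb{N}$ such that $I^nx\subseteq I^{n+1}N_1$. (The relation "$N_1$ is a Ratliff-Rush reduction of $N_2$" includes the requirement $N_1\subseteq N_2$.) For a Noetherian local ring $(R,\mathfrak{m})$, $R^*$ denotes the $\mathfrak{m}$-adic completion of $R$, and for a submodule $K$ of $E$, $KR^*$ denotes the $R^*$-submodule of $E\otimes_RR^*$ generated by the image of $K$ (which is isomorphic to $K\otimes_R R^*$). An element $c\in R$ is $E$-regular if it is a non-zero-divisor on $E$. *)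

theory Defs
  imports "HOL-Algebra.Algebra"
begin

section \<open>Submodules and Ratliff-Rush reductions\<close>

definition submod_gen :: "('a, 'r) ring_scheme \<Rightarrow> ('a, 'e, 'm) module_scheme \<Rightarrow> 'e set \<Rightarrow> 'e set"
  where "submod_gen R E P = \<Inter>{H. submodule H R E \<and> P \<subseteq> H}"

definition fin_gen_module :: "('a, 'r) ring_scheme \<Rightarrow> ('a, 'e, 'm) module_scheme \<Rightarrow> bool"
  where "fin_gen_module R E \<longleftrightarrow>
    (\<exists>P. finite P \<and> P \<subseteq> carrier E \<and> submod_gen R E P = carrier E)"

definition ideal_smult ::
  "('a, 'r) ring_scheme \<Rightarrow> ('a, 'e, 'm) module_scheme \<Rightarrow> 'a set \<Rightarrow> 'e set \<Rightarrow> 'e set"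
  where "ideal_smult R E I N = submod_gen R E {a \<odot>\<^bsub>E\<^esub> x | a x. a \<in> I \<and> x \<in> N}"

text \<open>Powers of ideals are powers in the multiplicative monoid of all ideals; the zeroth power is
  the unit ideal.\<close>

definition ideal_pow :: "('a, 'r) ring_scheme \<Rightarrow> 'a set \<Rightarrow> nat \<Rightarrow> 'a set"
  where "ideal_pow R I n = I [^]\<^bsub>ideals_set R\<^esub> n"

definition ratliff_rush ::
  "('a, 'r) ring_scheme \<Rightarrow> ('a, 'e, 'm) module_scheme \<Rightarrow> 'a set \<Rightarrow> 'e set \<Rightarrow> 'e set"
  where "ratliff_rush R E I N =
    {e \<in> carrier E. \<exists>n. {a \<odot>\<^bsub>E\<^esub> e | a. a \<in> ideal_pow R I n}
                          \<subseteq> ideal_smult R E (ideal_pow R I (n + 1)) N}"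

definition ratliff_rush_reduction ::
  "('a, 'r) ring_scheme \<Rightarrow> ('a, 'e, 'm) module_scheme \<Rightarrow> 'a set \<Rightarrow> 'e set \<Rightarrow> 'e set \<Rightarrow> bool"
  where "ratliff_rush_reduction R E I N\<^sub>1 N\<^sub>2 \<longleftrightarrow>
    submodule N\<^sub>1 R E \<and> submodule N\<^sub>2 R E \<and> N\<^sub>1 \<subseteq> N\<^sub>2 \<and> N\<^sub>2 \<subseteq> ratliff_rush R E I N\<^sub>1"

definition module_regular :: "('a, 'r) ring_scheme \<Rightarrow> ('a, 'e, 'm) module_scheme \<Rightarrow> 'a \<Rightarrow> bool"
  where "module_regular R E c \<longleftrightarrow>
    c \<in> carrier R \<and> (\<forall>x \<in> carrier E. c \<odot>\<^bsub>E\<^esub> x = \<zero>\<^bsub>E\<^esub> \<longrightarrow> x = \<zero>\<^bsub>E\<^esub>)"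

definition local_ring :: "('a, 'r) ring_scheme \<Rightarrow> 'a set \<Rightarrow> bool"
  where "local_ring R \<mm> \<longleftrightarrow>
    cring R \<and> maximalideal \<mm> R \<and> (\<forall>\<nn>. maximalideal \<nn> R \<longrightarrow> \<nn> = \<mm>)"


section \<open>Localization\<close>

text \<open>A fraction is the equivalence class of a pair (numerator, denominator). The operations are
  given on representatives: each union below is a union of equal classes
  (\<open>loc_ring_mult\<close>, \<open>loc_ring_add\<close>, \<open>loc_module_add\<close>, \<open>loc_module_smult\<close>).\<close>

definition rfrac :: "('a, 'r) ring_scheme \<Rightarrow> 'a set \<Rightarrow> 'a \<Rightarrow> 'a \<Rightarrow> ('a \<times> 'a) set"
  where "rfrac R S a s =
    {(b, t). b \<in> carrier R \<and> t \<in> S \<and>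
             (\<exists>u\<in>S. u \<otimes>\<^bsub>R\<^esub> (t \<otimes>\<^bsub>R\<^esub> a) = u \<otimes>\<^bsub>R\<^esub> (s \<otimes>\<^bsub>R\<^esub> b))}"

definition mfrac :: "('a, 'e, 'm) module_scheme \<Rightarrow> 'a set \<Rightarrow> 'e \<Rightarrow> 'a \<Rightarrow> ('e \<times> 'a) set"
  where "mfrac E S x s =
    {(y, t). y \<in> carrier E \<and> t \<in> S \<and>
             (\<exists>u\<in>S. u \<odot>\<^bsub>E\<^esub> (t \<odot>\<^bsub>E\<^esub> x) = u \<odot>\<^bsub>E\<^esub> (s \<odot>\<^bsub>E\<^esub> y))}"

definition loc_ideal :: "('a, 'r) ring_scheme \<Rightarrow> 'a set \<Rightarrow> 'a set \<Rightarrow> ('a \<times> 'a) set set"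
  where "loc_ideal R S I = {rfrac R S a s | a s. a \<in> I \<and> s \<in> S}"

definition loc_submodule :: "('a, 'e, 'm) module_scheme \<Rightarrow> 'a set \<Rightarrow> 'e set \<Rightarrow> ('e \<times> 'a) set set"
  where "loc_submodule E S N = {mfrac E S x s | x s. x \<in> N \<and> s \<in> S}"

definition loc_ring :: "('a, 'r) ring_scheme \<Rightarrow> 'a set \<Rightarrow> ('a \<times> 'a) set ring"
  where "loc_ring R S =
    \<lparr>carrier = loc_ideal R S (carrier R),
     monoid.mult = (\<lambda>A B. \<Union>(a, s)\<in>A. \<Union>(b, t)\<in>B. rfrac R S (a \<otimes>\<^bsub>R\<^esub> b) (s \<otimes>\<^bsub>R\<^esub> t)),
     one = rfrac R S \<one>\<^bsub>R\<^esub> \<one>\<^bsub>R\<^esub>,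
     ring.zero = rfrac R S \<zero>\<^bsub>R\<^esub> \<one>\<^bsub>R\<^esub>,
     ring.add = (\<lambda>A B. \<Union>(a, s)\<in>A. \<Union>(b, t)\<in>B.
              rfrac R S ((t \<otimes>\<^bsub>R\<^esub> a) \<oplus>\<^bsub>R\<^esub> (s \<otimes>\<^bsub>R\<^esub> b)) (s \<otimes>\<^bsub>R\<^esub> t))\<rparr>"

text \<open>A module record extends a ring record, but its ring multiplication and unit play no role.\<close>

definition loc_module ::
  "('a, 'r) ring_scheme \<Rightarrow> ('a, 'e, 'm) module_scheme \<Rightarrow> 'a set
    \<Rightarrow> (('a \<times> 'a) set, ('e \<times> 'a) set) module"
  where "loc_module R E S =
    \<lparr>carrier = loc_submodule E S (carrier E),
     monoid.mult = undefined,
     one = undefined,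
     ring.zero = mfrac E S \<zero>\<^bsub>E\<^esub> \<one>\<^bsub>R\<^esub>,
     ring.add = (\<lambda>P Q. \<Union>(x, s)\<in>P. \<Union>(y, t)\<in>Q.
              mfrac E S ((t \<odot>\<^bsub>E\<^esub> x) \<oplus>\<^bsub>E\<^esub> (s \<odot>\<^bsub>E\<^esub> y)) (s \<otimes>\<^bsub>R\<^esub> t)),
     smult = (\<lambda>A P. \<Union>(a, s)\<in>A. \<Union>(x, t)\<in>P. mfrac E S (a \<odot>\<^bsub>E\<^esub> x) (s \<otimes>\<^bsub>R\<^esub> t))\<rparr>"


section \<open>Completion\<close>

text \<open>The inverse limit of the rings \<open>R/I\<^sup>n\<close>, as a ring of sequences of cosets with
  componentwise operations. Compatibility with the projection from \<open>R/I\<^sup>n\<^sup>+\<^sup>1\<close> to \<open>R/I\<^sup>n\<close> says that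
  each coset contains the next one.\<close>

definition adic_completion :: "('a, 'r) ring_scheme \<Rightarrow> 'a set \<Rightarrow> (nat \<Rightarrow> 'a set) ring"
  where "adic_completion R I =
    \<lparr>carrier = {x. \<forall>n. x n \<in> carrier (R Quot ideal_pow R I n) \<and> x (Suc n) \<subseteq> x n},
     monoid.mult = (\<lambda>x y n. x n \<otimes>\<^bsub>R Quot ideal_pow R I n\<^esub> y n),
     one = (\<lambda>n. \<one>\<^bsub>R Quot ideal_pow R I n\<^esub>),
     ring.zero = (\<lambda>n. \<zero>\<^bsub>R Quot ideal_pow R I n\<^esub>),
     ring.add = (\<lambda>x y n. x n \<oplus>\<^bsub>R Quot ideal_pow R I n\<^esub> y n)\<rparr>"

definition to_completion :: "('a, 'r) ring_scheme \<Rightarrow> 'a set \<Rightarrow> 'a \<Rightarrow> nat \<Rightarrow> 'a set"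
  where "to_completion R I a = (\<lambda>n. ideal_pow R I n +>\<^bsub>R\<^esub> a)"


section \<open>Extension of scalars\<close>

text \<open>For a ring homomorphism \<open>\<phi>\<close> from \<open>R\<close> to \<open>B\<close>, the \<open>B\<close>-module \<open>E \<otimes>\<^sub>R B\<close>: the free abelian group
  on pairs \<open>(x, b)\<close> modulo the bilinearity relations, where \<open>b'\<close> acts by
  \<open>b' (x \<otimes> b) = x \<otimes> b' b\<close>. The union in the scalar multiplication is a union of equal cosets.\<close>

definition tensor_rels ::
  "('a, 'r) ring_scheme \<Rightarrow> ('a, 'e, 'm) module_scheme \<Rightarrow> ('b, 's) ring_scheme \<Rightarrow> ('a \<Rightarrow> 'b)
    \<Rightarrow> ('e \<times> 'b \<Rightarrow>\<^sub>0 int) set"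
  where "tensor_rels R E B \<phi> =
     {frag_of (x \<oplus>\<^bsub>E\<^esub> y, b) - (frag_of (x, b) + frag_of (y, b)) | x y b.
        x \<in> carrier E \<and> y \<in> carrier E \<and> b \<in> carrier B}
   \<union> {frag_of (x, b \<oplus>\<^bsub>B\<^esub> c) - (frag_of (x, b) + frag_of (x, c)) | x b c.
        x \<in> carrier E \<and> b \<in> carrier B \<and> c \<in> carrier B}
   \<union> {frag_of (a \<odot>\<^bsub>E\<^esub> x, b) - frag_of (x, \<phi> a \<otimes>\<^bsub>B\<^esub> b) | a x b.
        a \<in> carrier R \<and> x \<in> carrier E \<and> b \<in> carrier B}"

definition tensor_free ::
  "('a, 'e, 'm) module_scheme \<Rightarrow> ('b, 's) ring_scheme \<Rightarrow> ('e \<times> 'b \<Rightarrow>\<^sub>0 int) monoid"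
  where "tensor_free E B = free_Abelian_group (carrier E \<times> carrier B)"

definition tensor_sub ::
  "('a, 'r) ring_scheme \<Rightarrow> ('a, 'e, 'm) module_scheme \<Rightarrow> ('b, 's) ring_scheme \<Rightarrow> ('a \<Rightarrow> 'b)
    \<Rightarrow> ('e \<times> 'b \<Rightarrow>\<^sub>0 int) set"
  where "tensor_sub R E B \<phi> = generate (tensor_free E B) (tensor_rels R E B \<phi>)"

definition base_change ::
  "('a, 'r) ring_scheme \<Rightarrow> ('a, 'e, 'm) module_scheme \<Rightarrow> ('b, 's) ring_scheme \<Rightarrow> ('a \<Rightarrow> 'b)
    \<Rightarrow> ('b, ('e \<times> 'b \<Rightarrow>\<^sub>0 int) set) module"
  where "base_change R E B \<phi> =
    \<lparr>carrier = carrier (tensor_free E B Mod tensor_sub R E B \<phi>),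
     monoid.mult = undefined,
     one = undefined,
     ring.zero = \<one>\<^bsub>tensor_free E B Mod tensor_sub R E B \<phi>\<^esub>,
     ring.add = (\<lambda>P Q. P \<otimes>\<^bsub>tensor_free E B Mod tensor_sub R E B \<phi>\<^esub> Q),
     smult = (\<lambda>b P. \<Union>c\<in>P. tensor_sub R E B \<phi> #>\<^bsub>tensor_free E B\<^esub>
                             frag_extend (\<lambda>(x, d). frag_of (x, b \<otimes>\<^bsub>B\<^esub> d)) c)\<rparr>"

definition pure_tensor ::
  "('a, 'r) ring_scheme \<Rightarrow> ('a, 'e, 'm) module_scheme \<Rightarrow> ('b, 's) ring_scheme \<Rightarrow> ('a \<Rightarrow> 'b)
    \<Rightarrow> 'e \<Rightarrow> 'b \<Rightarrow> ('e \<times> 'b \<Rightarrow>\<^sub>0 int) set"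
  where "pure_tensor R E B \<phi> x b = tensor_sub R E B \<phi> #>\<^bsub>tensor_free E B\<^esub> frag_of (x, b)"

definition extended_submodule ::
  "('a, 'r) ring_scheme \<Rightarrow> ('a, 'e, 'm) module_scheme \<Rightarrow> ('b, 's) ring_scheme \<Rightarrow> ('a \<Rightarrow> 'b)
    \<Rightarrow> 'e set \<Rightarrow> ('e \<times> 'b \<Rightarrow>\<^sub>0 int) set set"
  where "extended_submodule R E B \<phi> K =
    submod_gen B (base_change R E B \<phi>) ((\<lambda>x. pure_tensor R E B \<phi> x \<one>\<^bsub>B\<^esub>) ` K)"

section \<open>The constructions yield rings and modules\<close>

locale module_localization = module R M for R (structure) and M (structure) +
  fixes S assumes S: "submonoid S R"
begin

lemma S_carr: "s \<in> S \<Longrightarrow> s \<in> carrier R"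
  using submonoid.subset[OF S] by blast

lemma S_mult [simp]: "s \<in> S \<Longrightarrow> t \<in> S \<Longrightarrow> s \<otimes> t \<in> S"
  using submonoid.m_closed[OF S] .

lemma S_one [simp]: "\<one> \<in> S"
  using submonoid.one_closed[OF S] .

lemma smult_swap:
  "a \<in> carrier R \<Longrightarrow> b \<in> carrier R \<Longrightarrow> x \<in> carrier M \<Longrightarrow> a \<odot>\<^bsub>M\<^esub> (b \<odot>\<^bsub>M\<^esub> x) = b \<odot>\<^bsub>M\<^esub> (a \<odot>\<^bsub>M\<^esub> x)"
  by (simp add: smult_assoc1[symmetric] R.m_comm)

definition frac_rel where
  "frac_rel x s y t \<longleftrightarrow> (\<exists>u\<in>S. u \<odot>\<^bsub>M\<^esub> (t \<odot>\<^bsub>M\<^esub> x) = u \<odot>\<^bsub>M\<^esub> (s \<odot>\<^bsub>M\<^esub> y))"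

lemma frac_rel_refl: "x \<in> carrier M \<Longrightarrow> s \<in> S \<Longrightarrow> frac_rel x s x s"
  unfolding frac_rel_def using S_one by blast

lemma frac_rel_sym: "frac_rel x s y t \<Longrightarrow> frac_rel y t x s"
  unfolding frac_rel_def by metis

lemma frac_rel_trans:
  assumes c: "x \<in> carrier M" "y \<in> carrier M" "z \<in> carrier M" "s \<in> S" "t \<in> S" "r \<in> S"
    and "frac_rel x s y t" "frac_rel y t z r"
  shows "frac_rel x s z r"
proof -
  obtain u where u: "u \<in> S" "u \<odot>\<^bsub>M\<^esub> (t \<odot>\<^bsub>M\<^esub> x) = u \<odot>\<^bsub>M\<^esub> (s \<odot>\<^bsub>M\<^esub> y)"
    using assms unfolding frac_rel_def by blast
  obtain v where v: "v \<in> S" "v \<odot>\<^bsub>M\<^esub> (r \<odot>\<^bsub>M\<^esub> y) = v \<odot>\<^bsub>M\<^esub> (t \<odot>\<^bsub>M\<^esub> z)"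
    using assms unfolding frac_rel_def by blast
  have "(u \<otimes> v \<otimes> t) \<odot>\<^bsub>M\<^esub> (r \<odot>\<^bsub>M\<^esub> x) = (v \<otimes> r) \<odot>\<^bsub>M\<^esub> (u \<odot>\<^bsub>M\<^esub> (t \<odot>\<^bsub>M\<^esub> x))"
    using c u(1) v(1) c(4-6)[THEN S_carr] u(1)[THEN S_carr] v(1)[THEN S_carr] by (simp add: smult_assoc1[symmetric] R.m_ac)
  also have "\<dots> = (u \<otimes> s) \<odot>\<^bsub>M\<^esub> (v \<odot>\<^bsub>M\<^esub> (r \<odot>\<^bsub>M\<^esub> y))"
    using c u(1) v(1) c(4-6)[THEN S_carr] u(1)[THEN S_carr] v(1)[THEN S_carr] unfolding u(2) by (simp add: smult_assoc1[symmetric] R.m_ac)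
  also have "\<dots> = (u \<otimes> v \<otimes> t) \<odot>\<^bsub>M\<^esub> (s \<odot>\<^bsub>M\<^esub> z)"
    using c u(1) v(1) c(4-6)[THEN S_carr] u(1)[THEN S_carr] v(1)[THEN S_carr] unfolding v(2) by (simp add: smult_assoc1[symmetric] R.m_ac)
  finally show ?thesis unfolding frac_rel_def using u v c by (meson S_mult)
qed

lemma mem_mfrac: "(y, t) \<in> mfrac M S x s \<longleftrightarrow> y \<in> carrier M \<and> t \<in> S \<and> frac_rel x s y t"
  by (simp add: mfrac_def frac_rel_def)

lemma mfrac_eq_iff:
  assumes "x \<in> carrier M" "y \<in> carrier M" "s \<in> S" "t \<in> S"
  shows "mfrac M S x s = mfrac M S y t \<longleftrightarrow>
    (\<exists>u\<in>S. u \<odot>\<^bsub>M\<^esub> (t \<odot>\<^bsub>M\<^esub> x) = u \<odot>\<^bsub>M\<^esub> (s \<odot>\<^bsub>M\<^esub> y))"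
proof -
  have "mfrac M S x s = mfrac M S y t \<longleftrightarrow> frac_rel x s y t"
  proof
    assume "mfrac M S x s = mfrac M S y t"
    then have "(y, t) \<in> mfrac M S x s"
      using assms by (simp add: mem_mfrac frac_rel_refl)
    then show "frac_rel x s y t" by (simp add: mem_mfrac)
  next
    assume r: "frac_rel x s y t"
    show "mfrac M S x s = mfrac M S y t"
      using assms r by (auto simp: mem_mfrac) (meson frac_rel_sym frac_rel_trans)+
  qed
  then show ?thesis by (simp add: frac_rel_def)
qed

lemma UN_mfrac:
  assumes "x \<in> carrier M" "s \<in> S"
    and "\<And>y t. y \<in> carrier M \<Longrightarrow> t \<in> S \<Longrightarrow> mfrac M S x s = mfrac M S y t \<Longrightarrow> f y t = C"
  shows "(\<Union>(y, t)\<in>mfrac M S x s. f y t) = C"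
proof -
  have "f y t = C" if "(y, t) \<in> mfrac M S x s" for y t
    using that assms mfrac_eq_iff[OF assms(1) _ assms(2)] by (simp add: mfrac_def)
  moreover have "(x, s) \<in> mfrac M S x s"
    using assms by (simp add: mem_mfrac frac_rel_refl)
  ultimately show ?thesis by fastforce
qed

lemma loc_module_add:
  assumes c: "x \<in> carrier M" "y \<in> carrier M" "s \<in> S" "t \<in> S"
  shows "mfrac M S x s \<oplus>\<^bsub>loc_module R M S\<^esub> mfrac M S y t
    = mfrac M S ((t \<odot>\<^bsub>M\<^esub> x) \<oplus>\<^bsub>M\<^esub> (s \<odot>\<^bsub>M\<^esub> y)) (s \<otimes> t)"
proof -
  have main: "mfrac M S ((t' \<odot>\<^bsub>M\<^esub> x') \<oplus>\<^bsub>M\<^esub> (s' \<odot>\<^bsub>M\<^esub> y')) (s' \<otimes> t')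
      = mfrac M S ((t \<odot>\<^bsub>M\<^esub> x) \<oplus>\<^bsub>M\<^esub> (s \<odot>\<^bsub>M\<^esub> y)) (s \<otimes> t)"
    if c': "x' \<in> carrier M" "y' \<in> carrier M" "s' \<in> S" "t' \<in> S"
      and e1: "mfrac M S x s = mfrac M S x' s'" and e2: "mfrac M S y t = mfrac M S y' t'"
    for x' y' s' t'
  proof -
    obtain u where u: "u \<in> S" "u \<odot>\<^bsub>M\<^esub> (s' \<odot>\<^bsub>M\<^esub> x) = u \<odot>\<^bsub>M\<^esub> (s \<odot>\<^bsub>M\<^esub> x')"
      using e1 mfrac_eq_iff c c' by meson
    obtain v where v: "v \<in> S" "v \<odot>\<^bsub>M\<^esub> (t' \<odot>\<^bsub>M\<^esub> y) = v \<odot>\<^bsub>M\<^esub> (t \<odot>\<^bsub>M\<^esub> y')"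
      using e2 mfrac_eq_iff c c' by meson
    have 1: "(u \<otimes> v) \<odot>\<^bsub>M\<^esub> ((s \<otimes> t) \<odot>\<^bsub>M\<^esub> (t' \<odot>\<^bsub>M\<^esub> x'))
        = (u \<otimes> v) \<odot>\<^bsub>M\<^esub> ((s' \<otimes> t') \<odot>\<^bsub>M\<^esub> (t \<odot>\<^bsub>M\<^esub> x))"
    proof -
      have "(u \<otimes> v) \<odot>\<^bsub>M\<^esub> ((s \<otimes> t) \<odot>\<^bsub>M\<^esub> (t' \<odot>\<^bsub>M\<^esub> x'))
          = (v \<otimes> t \<otimes> t') \<odot>\<^bsub>M\<^esub> (u \<odot>\<^bsub>M\<^esub> (s \<odot>\<^bsub>M\<^esub> x'))"
        using c c' u(1) v(1) c(3,4)[THEN S_carr] c'(3,4)[THEN S_carr] u(1)[THEN S_carr] v(1)[THEN S_carr] by (simp add: smult_assoc1[symmetric] R.m_ac)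
      also have "\<dots> = (v \<otimes> t \<otimes> t') \<odot>\<^bsub>M\<^esub> (u \<odot>\<^bsub>M\<^esub> (s' \<odot>\<^bsub>M\<^esub> x))" unfolding u(2) ..
      also have "\<dots> = (u \<otimes> v) \<odot>\<^bsub>M\<^esub> ((s' \<otimes> t') \<odot>\<^bsub>M\<^esub> (t \<odot>\<^bsub>M\<^esub> x))"
        using c c' u(1) v(1) c(3,4)[THEN S_carr] c'(3,4)[THEN S_carr] u(1)[THEN S_carr] v(1)[THEN S_carr] by (simp add: smult_assoc1[symmetric] R.m_ac)
      finally show ?thesis .
    qed
    have 2: "(u \<otimes> v) \<odot>\<^bsub>M\<^esub> ((s \<otimes> t) \<odot>\<^bsub>M\<^esub> (s' \<odot>\<^bsub>M\<^esub> y'))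
        = (u \<otimes> v) \<odot>\<^bsub>M\<^esub> ((s' \<otimes> t') \<odot>\<^bsub>M\<^esub> (s \<odot>\<^bsub>M\<^esub> y))"
    proof -
      have "(u \<otimes> v) \<odot>\<^bsub>M\<^esub> ((s \<otimes> t) \<odot>\<^bsub>M\<^esub> (s' \<odot>\<^bsub>M\<^esub> y'))
          = (u \<otimes> s \<otimes> s') \<odot>\<^bsub>M\<^esub> (v \<odot>\<^bsub>M\<^esub> (t \<odot>\<^bsub>M\<^esub> y'))"
        using c c' u(1) v(1) c(3,4)[THEN S_carr] c'(3,4)[THEN S_carr] u(1)[THEN S_carr] v(1)[THEN S_carr] by (simp add: smult_assoc1[symmetric] R.m_ac)
      also have "\<dots> = (u \<otimes> s \<otimes> s') \<odot>\<^bsub>M\<^esub> (v \<odot>\<^bsub>M\<^esub> (t' \<odot>\<^bsub>M\<^esub> y))" unfolding v(2) ..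
      also have "\<dots> = (u \<otimes> v) \<odot>\<^bsub>M\<^esub> ((s' \<otimes> t') \<odot>\<^bsub>M\<^esub> (s \<odot>\<^bsub>M\<^esub> y))"
        using c c' u(1) v(1) c(3,4)[THEN S_carr] c'(3,4)[THEN S_carr] u(1)[THEN S_carr] v(1)[THEN S_carr] by (simp add: smult_assoc1[symmetric] R.m_ac)
      finally show ?thesis .
    qed
    have "(u \<otimes> v) \<odot>\<^bsub>M\<^esub> ((s \<otimes> t) \<odot>\<^bsub>M\<^esub> ((t' \<odot>\<^bsub>M\<^esub> x') \<oplus>\<^bsub>M\<^esub> (s' \<odot>\<^bsub>M\<^esub> y')))
        = (u \<otimes> v) \<odot>\<^bsub>M\<^esub> ((s' \<otimes> t') \<odot>\<^bsub>M\<^esub> ((t \<odot>\<^bsub>M\<^esub> x) \<oplus>\<^bsub>M\<^esub> (s \<odot>\<^bsub>M\<^esub> y)))"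
      using c c' u(1) v(1) c(3,4)[THEN S_carr] c'(3,4)[THEN S_carr] u(1)[THEN S_carr] v(1)[THEN S_carr] 1 2 by (simp add: smult_r_distr)
    then show ?thesis
      using c c' u(1) v(1) c(3,4)[THEN S_carr] c'(3,4)[THEN S_carr] u(1)[THEN S_carr] v(1)[THEN S_carr] by (subst mfrac_eq_iff) (auto intro!: bexI[of _ "u \<otimes> v"])
  qed
  show ?thesis
    unfolding loc_module_def ring.simps
    by (rule UN_mfrac[OF c(1,3)], rule UN_mfrac[OF c(2,4)], rule main)
qed

lemma regular_module_localization:
  "module_localization R \<lparr>carrier = carrier R, monoid.mult = monoid.mult R, one = one R,
     ring.zero = ring.zero R, ring.add = ring.add R, smult = monoid.mult R\<rparr> S"
  (is "module_localization R ?M S")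
proof -
  have "abelian_group ?M"
    by (rule abelian_groupI) (auto simp: R.a_ac R.add.l_inv_ex)
  then have "module R ?M"
    by (rule moduleI[OF R.is_cring]) (auto simp: R.l_distr R.r_distr R.m_assoc)
  then show ?thesis
    by (simp add: module_localization_def module_localization_axioms_def S)
qed

lemma rfrac_eq_iff:
  assumes "a \<in> carrier R" "b \<in> carrier R" "s \<in> S" "t \<in> S"
  shows "rfrac R S a s = rfrac R S b t \<longleftrightarrow>
    (\<exists>u\<in>S. u \<otimes> (t \<otimes> a) = u \<otimes> (s \<otimes> b))"
  using module_localization.mfrac_eq_iff[OF regular_module_localization, of a b s t] assms
  by (simp add: rfrac_def mfrac_def)

lemma UN_rfrac:
  assumes "a \<in> carrier R" "s \<in> S"
    and "\<And>b t. b \<in> carrier R \<Longrightarrow> t \<in> S \<Longrightarrow> rfrac R S a s = rfrac R S b t \<Longrightarrow> f b t = C"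
  shows "(\<Union>(b, t)\<in>rfrac R S a s. f b t) = C"
  using module_localization.UN_mfrac[OF regular_module_localization, of a s f C] assms
  by (simp add: rfrac_def mfrac_def)

lemma loc_ring_add:
  assumes "a \<in> carrier R" "b \<in> carrier R" "s \<in> S" "t \<in> S"
  shows "rfrac R S a s \<oplus>\<^bsub>loc_ring R S\<^esub> rfrac R S b t
    = rfrac R S ((t \<otimes> a) \<oplus> (s \<otimes> b)) (s \<otimes> t)"
  using module_localization.loc_module_add[OF regular_module_localization, of a b s t] assms
  by (simp add: rfrac_def mfrac_def loc_ring_def loc_module_def)

lemma loc_module_smult:
  assumes c: "a \<in> carrier R" "x \<in> carrier M" "s \<in> S" "t \<in> S"
  shows "rfrac R S a s \<odot>\<^bsub>loc_module R M S\<^esub> mfrac M S x t = mfrac M S (a \<odot>\<^bsub>M\<^esub> x) (s \<otimes> t)"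
proof -
  have main: "mfrac M S (a' \<odot>\<^bsub>M\<^esub> x') (s' \<otimes> t') = mfrac M S (a \<odot>\<^bsub>M\<^esub> x) (s \<otimes> t)"
    if c': "a' \<in> carrier R" "x' \<in> carrier M" "s' \<in> S" "t' \<in> S"
      and e1: "rfrac R S a s = rfrac R S a' s'" and e2: "mfrac M S x t = mfrac M S x' t'"
    for a' x' s' t'
  proof -
    obtain u where u: "u \<in> S" "u \<otimes> (s' \<otimes> a) = u \<otimes> (s \<otimes> a')"
      using e1 rfrac_eq_iff c c' by meson
    obtain v where v: "v \<in> S" "v \<odot>\<^bsub>M\<^esub> (t' \<odot>\<^bsub>M\<^esub> x) = v \<odot>\<^bsub>M\<^esub> (t \<odot>\<^bsub>M\<^esub> x')"
      using e2 mfrac_eq_iff c c' by meson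
    have "(u \<otimes> v) \<odot>\<^bsub>M\<^esub> ((s \<otimes> t) \<odot>\<^bsub>M\<^esub> (a' \<odot>\<^bsub>M\<^esub> x'))
        = (u \<otimes> (s \<otimes> a')) \<odot>\<^bsub>M\<^esub> (v \<odot>\<^bsub>M\<^esub> (t \<odot>\<^bsub>M\<^esub> x'))"
      using c c' u(1) v(1) c(3,4)[THEN S_carr] c'(3,4)[THEN S_carr] u(1)[THEN S_carr] v(1)[THEN S_carr] by (simp add: smult_assoc1[symmetric] R.m_ac)
    also have "\<dots> = (u \<otimes> (s' \<otimes> a)) \<odot>\<^bsub>M\<^esub> (v \<odot>\<^bsub>M\<^esub> (t' \<odot>\<^bsub>M\<^esub> x))" unfolding u(2) v(2) ..
    also have "\<dots> = (u \<otimes> v) \<odot>\<^bsub>M\<^esub> ((s' \<otimes> t') \<odot>\<^bsub>M\<^esub> (a \<odot>\<^bsub>M\<^esub> x))"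
      using c c' u(1) v(1) c(3,4)[THEN S_carr] c'(3,4)[THEN S_carr] u(1)[THEN S_carr] v(1)[THEN S_carr] by (simp add: smult_assoc1[symmetric] R.m_ac)
    finally show ?thesis
      using c c' u(1) v(1) c(3,4)[THEN S_carr] c'(3,4)[THEN S_carr] u(1)[THEN S_carr] v(1)[THEN S_carr] by (subst mfrac_eq_iff) (auto intro!: bexI[of _ "u \<otimes> v"])
  qed
  show ?thesis
    unfolding loc_module_def module.simps
    by (rule UN_rfrac[OF c(1,3)], rule UN_mfrac[OF c(2,4)], rule main)
qed

lemma loc_ring_mult:
  assumes "a \<in> carrier R" "b \<in> carrier R" "s \<in> S" "t \<in> S"
  shows "rfrac R S a s \<otimes>\<^bsub>loc_ring R S\<^esub> rfrac R S b t = rfrac R S (a \<otimes> b) (s \<otimes> t)"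
  using module_localization.loc_module_smult[OF regular_module_localization, of a b s t] assms
  by (simp add: rfrac_def mfrac_def loc_ring_def loc_module_def)

lemma loc_module_elim:
  assumes "P \<in> carrier (loc_module R M S)"
  obtains x s where "x \<in> carrier M" "s \<in> S" "s \<in> carrier R" "P = mfrac M S x s"
  using assms S_carr by (auto simp: loc_module_def loc_submodule_def)

lemma mfrac_closed: "x \<in> carrier M \<Longrightarrow> s \<in> S \<Longrightarrow> mfrac M S x s \<in> carrier (loc_module R M S)"
  by (auto simp: loc_module_def loc_submodule_def)

lemma mfrac_eqI:
  assumes "x \<in> carrier M" "y \<in> carrier M" "s \<in> S" "t \<in> S" "t \<odot>\<^bsub>M\<^esub> x = s \<odot>\<^bsub>M\<^esub> y"
  shows "mfrac M S x s = mfrac M S y t"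
  using assms by (subst mfrac_eq_iff) (auto intro!: bexI[of _ \<one>])

lemma loc_module_abelian_group: "abelian_group (loc_module R M S)"
proof -
  have z: "\<zero>\<^bsub>loc_module R M S\<^esub> = mfrac M S \<zero>\<^bsub>M\<^esub> \<one>"
    by (simp add: loc_module_def)
  show ?thesis
  proof (rule abelian_groupI)
    fix P Q
    assume "P \<in> carrier (loc_module R M S)" "Q \<in> carrier (loc_module R M S)"
    then show "P \<oplus>\<^bsub>loc_module R M S\<^esub> Q \<in> carrier (loc_module R M S)"
      by (elim loc_module_elim) (simp add: loc_module_add mfrac_closed)
  next
    show "\<zero>\<^bsub>loc_module R M S\<^esub> \<in> carrier (loc_module R M S)"
      by (simp add: z mfrac_closed)
  next
    fix P Q T
    assume "P \<in> carrier (loc_module R M S)" "Q \<in> carrier (loc_module R M S)"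
      "T \<in> carrier (loc_module R M S)"
    then show "P \<oplus>\<^bsub>loc_module R M S\<^esub> Q \<oplus>\<^bsub>loc_module R M S\<^esub> T
        = P \<oplus>\<^bsub>loc_module R M S\<^esub> (Q \<oplus>\<^bsub>loc_module R M S\<^esub> T)"
      by (elim loc_module_elim)
        (simp add: loc_module_add smult_r_distr smult_assoc1[symmetric] R.m_ac M.a_ac)
  next
    fix P Q
    assume "P \<in> carrier (loc_module R M S)" "Q \<in> carrier (loc_module R M S)"
    then show "P \<oplus>\<^bsub>loc_module R M S\<^esub> Q = Q \<oplus>\<^bsub>loc_module R M S\<^esub> P"
      by (elim loc_module_elim) (simp add: loc_module_add R.m_comm M.a_comm)
  next
    fix P
    assume "P \<in> carrier (loc_module R M S)"
    then show "\<zero>\<^bsub>loc_module R M S\<^esub> \<oplus>\<^bsub>loc_module R M S\<^esub> P = P"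
      by (elim loc_module_elim) (simp add: loc_module_add z)
  next
    fix P
    assume "P \<in> carrier (loc_module R M S)"
    then obtain x s where x: "x \<in> carrier M" "s \<in> S" "s \<in> carrier R" "P = mfrac M S x s"
      by (elim loc_module_elim)
    have "mfrac M S (\<ominus>\<^bsub>M\<^esub> x) s \<oplus>\<^bsub>loc_module R M S\<^esub> P = \<zero>\<^bsub>loc_module R M S\<^esub>"
      using x by (simp add: loc_module_add z smult_r_distr[symmetric] M.l_neg, intro mfrac_eqI)
          simp_all
    then show "\<exists>Q\<in>carrier (loc_module R M S). Q \<oplus>\<^bsub>loc_module R M S\<^esub> P = \<zero>\<^bsub>loc_module R M S\<^esub>"
      using x mfrac_closed by (meson M.a_inv_closed)
  qed
qed

lemma loc_ring_elim:
  assumes "P \<in> carrier (loc_ring R S)"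
  obtains a s where "a \<in> carrier R" "s \<in> S" "s \<in> carrier R" "P = rfrac R S a s"
  using assms S_carr by (auto simp: loc_ring_def loc_ideal_def)

lemma rfrac_closed: "a \<in> carrier R \<Longrightarrow> s \<in> S \<Longrightarrow> rfrac R S a s \<in> carrier (loc_ring R S)"
  by (auto simp: loc_ring_def loc_ideal_def)

lemma rfrac_eqI:
  assumes "a \<in> carrier R" "b \<in> carrier R" "s \<in> S" "t \<in> S" "t \<otimes> a = s \<otimes> b"
  shows "rfrac R S a s = rfrac R S b t"
  using assms by (subst rfrac_eq_iff) (auto intro!: bexI[of _ \<one>])

lemma loc_ring_cring: "cring (loc_ring R S)"
proof -
  let ?M = "\<lparr>carrier = carrier R, monoid.mult = monoid.mult R, one = one R,
     ring.zero = ring.zero R, ring.add = ring.add R, smult = monoid.mult R\<rparr>"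
  let ?Q = "loc_ring R S"
  have o: "\<one>\<^bsub>?Q\<^esub> = rfrac R S \<one> \<one>"
    by (simp add: loc_ring_def)
  have eq: "carrier ?Q = carrier (loc_module R ?M S)" "ring.zero ?Q = ring.zero (loc_module R ?M S)"
    "ring.add ?Q = ring.add (loc_module R ?M S)"
    by (simp_all add: loc_ring_def loc_module_def loc_ideal_def loc_submodule_def rfrac_def
        mfrac_def)
  have ab: "abelian_group (loc_module R ?M S)"
    by (rule module_localization.loc_module_abelian_group[OF regular_module_localization])
  interpret L: abelian_group "loc_module R ?M S" by (rule ab)
  have ag: "abelian_group ?Q"
    by (rule abelian_groupI) (auto simp: eq L.a_ac L.add.l_inv_ex)
  show ?thesis
  proof (rule cringI[OF ag])
    show "Group.comm_monoid ?Q"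
    proof (rule comm_monoidI)
      fix P Q assume "P \<in> carrier ?Q" "Q \<in> carrier ?Q"
      then show "P \<otimes>\<^bsub>?Q\<^esub> Q \<in> carrier ?Q"
        by (elim loc_ring_elim) (simp add: loc_ring_mult rfrac_closed)
    next
      show "\<one>\<^bsub>?Q\<^esub> \<in> carrier ?Q" by (simp add: o rfrac_closed)
    next
      fix P Q T assume "P \<in> carrier ?Q" "Q \<in> carrier ?Q" "T \<in> carrier ?Q"
      then show "P \<otimes>\<^bsub>?Q\<^esub> Q \<otimes>\<^bsub>?Q\<^esub> T = P \<otimes>\<^bsub>?Q\<^esub> (Q \<otimes>\<^bsub>?Q\<^esub> T)"
        by (elim loc_ring_elim) (simp add: loc_ring_mult R.m_assoc)
    next
      fix P Q assume "P \<in> carrier ?Q" "Q \<in> carrier ?Q"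
      then show "P \<otimes>\<^bsub>?Q\<^esub> Q = Q \<otimes>\<^bsub>?Q\<^esub> P"
        by (elim loc_ring_elim) (simp add: loc_ring_mult R.m_comm)
    next
      fix P assume "P \<in> carrier ?Q"
      then show "\<one>\<^bsub>?Q\<^esub> \<otimes>\<^bsub>?Q\<^esub> P = P"
        by (elim loc_ring_elim) (simp add: loc_ring_mult o)
    qed
  next
    fix P Q T assume "P \<in> carrier ?Q" "Q \<in> carrier ?Q" "T \<in> carrier ?Q"
    then show "(P \<oplus>\<^bsub>?Q\<^esub> Q) \<otimes>\<^bsub>?Q\<^esub> T = P \<otimes>\<^bsub>?Q\<^esub> T \<oplus>\<^bsub>?Q\<^esub> Q \<otimes>\<^bsub>?Q\<^esub> T"
      by (elim loc_ring_elim)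
        (simp add: loc_ring_mult loc_ring_add, intro rfrac_eqI,
          simp_all add: R.l_distr R.r_distr R.m_ac)
  qed
qed

lemma loc_module_module: "module (loc_ring R S) (loc_module R M S)"
proof (rule moduleI[OF loc_ring_cring loc_module_abelian_group])
  let ?Q = "loc_ring R S" and ?L = "loc_module R M S"
  fix P T assume "P \<in> carrier ?Q" "T \<in> carrier ?L"
  then show "P \<odot>\<^bsub>?L\<^esub> T \<in> carrier ?L"
    by (elim loc_ring_elim loc_module_elim) (simp add: loc_module_smult mfrac_closed)
next
  let ?Q = "loc_ring R S" and ?L = "loc_module R M S"
  fix P Q T assume "P \<in> carrier ?Q" "Q \<in> carrier ?Q" "T \<in> carrier ?L"
  then show "(P \<oplus>\<^bsub>?Q\<^esub> Q) \<odot>\<^bsub>?L\<^esub> T = P \<odot>\<^bsub>?L\<^esub> T \<oplus>\<^bsub>?L\<^esub> Q \<odot>\<^bsub>?L\<^esub> T"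
    by (elim loc_ring_elim loc_module_elim)
      (simp add: loc_module_smult loc_module_add loc_ring_add, intro mfrac_eqI,
        simp_all add: smult_l_distr smult_r_distr smult_assoc1[symmetric] R.m_ac)
next
  let ?Q = "loc_ring R S" and ?L = "loc_module R M S"
  fix P Q T assume "P \<in> carrier ?Q" "Q \<in> carrier ?L" "T \<in> carrier ?L"
  then show "P \<odot>\<^bsub>?L\<^esub> (Q \<oplus>\<^bsub>?L\<^esub> T) = P \<odot>\<^bsub>?L\<^esub> Q \<oplus>\<^bsub>?L\<^esub> P \<odot>\<^bsub>?L\<^esub> T"
    by (elim loc_ring_elim loc_module_elim)
      (simp add: loc_module_smult loc_module_add loc_ring_add, intro mfrac_eqI,
        simp_all add: smult_l_distr smult_r_distr smult_assoc1[symmetric] R.m_ac)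
next
  let ?Q = "loc_ring R S" and ?L = "loc_module R M S"
  fix P Q T assume "P \<in> carrier ?Q" "Q \<in> carrier ?Q" "T \<in> carrier ?L"
  then show "(P \<otimes>\<^bsub>?Q\<^esub> Q) \<odot>\<^bsub>?L\<^esub> T = P \<odot>\<^bsub>?L\<^esub> (Q \<odot>\<^bsub>?L\<^esub> T)"
    by (elim loc_ring_elim loc_module_elim)
      (auto simp: loc_module_smult loc_ring_mult smult_assoc1 R.m_ac)
next
  let ?Q = "loc_ring R S" and ?L = "loc_module R M S"
  fix T assume "T \<in> carrier ?L"
  moreover have "\<one>\<^bsub>?Q\<^esub> = rfrac R S \<one> \<one>"
    by (simp add: loc_ring_def)
  ultimately show "\<one>\<^bsub>?Q\<^esub> \<odot>\<^bsub>?L\<^esub> T = T"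
    by (elim loc_module_elim) (simp add: loc_module_smult)
qed

end


lemma (in cring) ideal_pow_ideal:
  assumes "ideal I R"
  shows "ideal (ideal_pow R I n) R"
proof (induction n)
  case 0
  show ?case
    by (simp add: ideal_pow_def nat_pow_def) (simp add: ideals_set_def oneideal)
next
  case (Suc n)
  then show ?case
    using ideal_prod_is_ideal[OF Suc assms]
    by (simp add: ideal_pow_def nat_pow_def ideals_set_def)
qed

lemma (in cring) ideal_pow_Suc: "ideal_pow R I (Suc n) = ideal_pow R I n \<cdot> I"
  by (simp add: ideal_pow_def nat_pow_def ideals_set_def)

lemma (in cring) to_completion_hom:
  assumes I: "ideal I R"
  shows "cring (adic_completion R I)"
    and "to_completion R I \<in> ring_hom R (adic_completion R I)"
proof -
  let ?J = "ideal_pow R I" and ?C = "adic_completion R I"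
  have J: "ideal (?J n) R" for n by (rule ideal_pow_ideal[OF I])
  have JS: "?J (Suc n) \<subseteq> ?J n" for n
    using ideal_prod_inter[OF J I] by (auto simp: ideal_pow_Suc)
  have Q: "cring (R Quot ?J n)" for n
    by (rule ideal.quotient_is_cring[OF J is_cring])
  have h: "(+>) (?J n) \<in> ring_hom R (R Quot ?J n)" for n
    by (rule ideal.rcos_ring_hom[OF J])
  have rep: "\<exists>a\<in>carrier R. x n = ?J n +> a \<and> x (Suc n) = ?J (Suc n) +> a"
    if x: "x \<in> carrier ?C" for x n
  proof -
    have c: "x (Suc n) \<in> carrier (R Quot ?J (Suc n))" "x n \<in> carrier (R Quot ?J n)"
      and s: "x (Suc n) \<subseteq> x n"
      using x by (auto simp: adic_completion_def)
    obtain a where a: "a \<in> carrier R" "x (Suc n) = ?J (Suc n) +> a"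
      using c by (auto simp: FactRing_def A_RCOSETS_def' )
    have "a \<in> x (Suc n)"
      using a J additive_subgroup.a_subset abelian_subgroup.a_rcos_self ideal.axioms
      by (metis abelian_subgroupI3 is_abelian_group)
    then have "a \<in> x n" using s by blast
    moreover obtain b where b: "b \<in> carrier R" "x n = ?J n +> b"
      using c by (auto simp: FactRing_def A_RCOSETS_def')
    ultimately have "x n = ?J n +> a"
      using group.repr_independence[OF a_group, of a "?J n" b] b
        additive_subgroup.a_subgroup[OF ideal.axioms(1)[OF J]]
      by (simp add: a_r_coset_def)
    then show ?thesis using a by blast
  qed
  have mono: "?J (Suc n) +> a \<subseteq> ?J n +> a" for n a
    using JS[of n] by (auto simp: a_r_coset_def')
  have cI: "x \<in> carrier ?C"
    if "\<And>n. \<exists>a\<in>carrier R. x n = ?J n +> a \<and> x (Suc n) = ?J (Suc n) +> a" for x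
  proof -
    have "x n \<in> carrier (R Quot ?J n) \<and> x (Suc n) \<subseteq> x n" for n
      using that[of n] mono[of n] ring_hom_closed[OF h] by metis
    then show ?thesis by (simp add: adic_completion_def)
  qed
  have comp: "x n \<in> carrier (R Quot ?J n)" if "x \<in> carrier ?C" for x n
    using that by (auto simp: adic_completion_def)
  have ops: "(x \<otimes>\<^bsub>?C\<^esub> y) n = x n \<otimes>\<^bsub>R Quot ?J n\<^esub> y n"
    "(x \<oplus>\<^bsub>?C\<^esub> y) n = x n \<oplus>\<^bsub>R Quot ?J n\<^esub> y n"
    "\<one>\<^bsub>?C\<^esub> n = \<one>\<^bsub>R Quot ?J n\<^esub>" "\<zero>\<^bsub>?C\<^esub> n = \<zero>\<^bsub>R Quot ?J n\<^esub>" for x y n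
    by (simp_all add: adic_completion_def)
  have hz: "?J n +> \<zero> = \<zero>\<^bsub>R Quot ?J n\<^esub>" for n
    using ring_hom_zero[OF h ring_axioms] Q cring.axioms(1) by blast
  have hminus: "(?J n +> (\<ominus> a)) \<oplus>\<^bsub>R Quot ?J n\<^esub> (?J n +> a) = \<zero>\<^bsub>R Quot ?J n\<^esub>"
    if "a \<in> carrier R" for a n
    using that ring_hom_add[OF h[of n], of "\<ominus> a" a] by (simp add: l_neg hz)
  have closed: "x \<oplus>\<^bsub>?C\<^esub> y \<in> carrier ?C" "x \<otimes>\<^bsub>?C\<^esub> y \<in> carrier ?C"
    if xy: "x \<in> carrier ?C" "y \<in> carrier ?C" for x y
  proof -
    show "x \<oplus>\<^bsub>?C\<^esub> y \<in> carrier ?C"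
    proof (rule cI)
      fix n
      obtain a where "a \<in> carrier R" "x n = ?J n +> a" "x (Suc n) = ?J (Suc n) +> a"
        using rep[OF xy(1), of n] by blast
      moreover obtain b where "b \<in> carrier R" "y n = ?J n +> b" "y (Suc n) = ?J (Suc n) +> b"
        using rep[OF xy(2), of n] by blast
      ultimately show "\<exists>a\<in>carrier R. (x \<oplus>\<^bsub>?C\<^esub> y) n = ?J n +> a \<and> (x \<oplus>\<^bsub>?C\<^esub> y) (Suc n) = ?J (Suc n) +> a"
        by (intro bexI[of _ "a \<oplus> b"]) (simp_all add: ops ring_hom_add[OF h])
    qed
    show "x \<otimes>\<^bsub>?C\<^esub> y \<in> carrier ?C"
    proof (rule cI)
      fix n
      obtain a where "a \<in> carrier R" "x n = ?J n +> a" "x (Suc n) = ?J (Suc n) +> a"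
        using rep[OF xy(1), of n] by blast
      moreover obtain b where "b \<in> carrier R" "y n = ?J n +> b" "y (Suc n) = ?J (Suc n) +> b"
        using rep[OF xy(2), of n] by blast
      ultimately show "\<exists>a\<in>carrier R. (x \<otimes>\<^bsub>?C\<^esub> y) n = ?J n +> a \<and> (x \<otimes>\<^bsub>?C\<^esub> y) (Suc n) = ?J (Suc n) +> a"
        by (intro bexI[of _ "a \<otimes> b"]) (simp_all add: ops ring_hom_mult[OF h])
    qed
  qed
  have img: "to_completion R I a \<in> carrier ?C" if "a \<in> carrier R" for a
    using that by (intro cI) (auto simp: to_completion_def)
  have img_one: "to_completion R I \<one> = \<one>\<^bsub>?C\<^esub>"
    by (rule ext) (simp add: to_completion_def ops ring_hom_one[OF h])
  have img_zero: "to_completion R I \<zero> = \<zero>\<^bsub>?C\<^esub>"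
    by (rule ext) (simp add: to_completion_def ops hz)
  have ab: "abelian_group ?C"
  proof (rule abelian_groupI)
    show "\<zero>\<^bsub>?C\<^esub> \<in> carrier ?C" using img[OF zero_closed] img_zero by simp
  next
    fix x assume x: "x \<in> carrier ?C"
    define y where "y n = \<ominus>\<^bsub>R Quot ?J n\<^esub> (x n)" for n
    have yrep: "y m = ?J m +> (\<ominus> a)" if "a \<in> carrier R" "x m = ?J m +> a" for m a
    proof -
      interpret q: cring "R Quot ?J m" by (rule Q)
      have "\<ominus>\<^bsub>R Quot ?J m\<^esub> (?J m +> a) = ?J m +> (\<ominus> a)"
        by (rule q.minus_equality[OF hminus[OF that(1)]])
          (use that ring_hom_closed[OF h[of m]] in auto)
      then show ?thesis using that by (simp add: y_def)
    qed
    have "y \<in> carrier ?C"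
    proof (rule cI)
      fix n
      obtain a where "a \<in> carrier R" "x n = ?J n +> a" "x (Suc n) = ?J (Suc n) +> a"
        using rep[OF x] by blast
      then show "\<exists>a\<in>carrier R. y n = ?J n +> a \<and> y (Suc n) = ?J (Suc n) +> a"
        using yrep by (intro bexI[of _ "\<ominus> a"]) auto
    qed
    moreover have "y \<oplus>\<^bsub>?C\<^esub> x = \<zero>\<^bsub>?C\<^esub>"
    proof (rule ext)
      fix n
      interpret q: cring "R Quot ?J n" by (rule Q)
      show "(y \<oplus>\<^bsub>?C\<^esub> x) n = \<zero>\<^bsub>?C\<^esub> n"
        by (simp add: ops y_def q.l_neg comp[OF x])
    qed
    ultimately show "\<exists>y\<in>carrier ?C. y \<oplus>\<^bsub>?C\<^esub> x = \<zero>\<^bsub>?C\<^esub>" by blast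
  next
    fix x y z assume xyz: "x \<in> carrier ?C" "y \<in> carrier ?C" "z \<in> carrier ?C"
    show "x \<oplus>\<^bsub>?C\<^esub> y \<oplus>\<^bsub>?C\<^esub> z = x \<oplus>\<^bsub>?C\<^esub> (y \<oplus>\<^bsub>?C\<^esub> z)"
    proof (rule ext)
      fix n
      interpret q: cring "R Quot ?J n" by (rule Q)
      show "(x \<oplus>\<^bsub>?C\<^esub> y \<oplus>\<^bsub>?C\<^esub> z) n = (x \<oplus>\<^bsub>?C\<^esub> (y \<oplus>\<^bsub>?C\<^esub> z)) n"
        using xyz by (simp add: ops q.a_assoc comp)
    qed
  next
    fix x y assume xy: "x \<in> carrier ?C" "y \<in> carrier ?C"
    show "x \<oplus>\<^bsub>?C\<^esub> y \<in> carrier ?C" using closed xy by simp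
    show "x \<oplus>\<^bsub>?C\<^esub> y = y \<oplus>\<^bsub>?C\<^esub> x"
    proof (rule ext)
      fix n
      interpret q: cring "R Quot ?J n" by (rule Q)
      show "(x \<oplus>\<^bsub>?C\<^esub> y) n = (y \<oplus>\<^bsub>?C\<^esub> x) n"
        using xy by (simp add: ops q.a_comm comp)
    qed
  next
    fix x assume x: "x \<in> carrier ?C"
    show "\<zero>\<^bsub>?C\<^esub> \<oplus>\<^bsub>?C\<^esub> x = x"
    proof (rule ext)
      fix n
      interpret q: cring "R Quot ?J n" by (rule Q)
      show "(\<zero>\<^bsub>?C\<^esub> \<oplus>\<^bsub>?C\<^esub> x) n = x n"
        using x by (simp add: ops comp)
    qed
  qed
  show "cring ?C"
  proof (rule cringI[OF ab comm_monoidI])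
    show "\<one>\<^bsub>?C\<^esub> \<in> carrier ?C" using img[OF one_closed] img_one by simp
  next
    fix x y assume xy: "x \<in> carrier ?C" "y \<in> carrier ?C"
    show "x \<otimes>\<^bsub>?C\<^esub> y \<in> carrier ?C" using closed xy by simp
    show "x \<otimes>\<^bsub>?C\<^esub> y = y \<otimes>\<^bsub>?C\<^esub> x"
    proof (rule ext)
      fix n
      interpret q: cring "R Quot ?J n" by (rule Q)
      show "(x \<otimes>\<^bsub>?C\<^esub> y) n = (y \<otimes>\<^bsub>?C\<^esub> x) n"
        using xy by (simp add: ops q.m_comm comp)
    qed
  next
    fix x y z assume xyz: "x \<in> carrier ?C" "y \<in> carrier ?C" "z \<in> carrier ?C"
    show "x \<otimes>\<^bsub>?C\<^esub> y \<otimes>\<^bsub>?C\<^esub> z = x \<otimes>\<^bsub>?C\<^esub> (y \<otimes>\<^bsub>?C\<^esub> z)"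
    proof (rule ext)
      fix n
      interpret q: cring "R Quot ?J n" by (rule Q)
      show "(x \<otimes>\<^bsub>?C\<^esub> y \<otimes>\<^bsub>?C\<^esub> z) n = (x \<otimes>\<^bsub>?C\<^esub> (y \<otimes>\<^bsub>?C\<^esub> z)) n"
        using xyz by (simp add: ops q.m_assoc comp)
    qed
    show "(x \<oplus>\<^bsub>?C\<^esub> y) \<otimes>\<^bsub>?C\<^esub> z = x \<otimes>\<^bsub>?C\<^esub> z \<oplus>\<^bsub>?C\<^esub> y \<otimes>\<^bsub>?C\<^esub> z"
    proof (rule ext)
      fix n
      interpret q: cring "R Quot ?J n" by (rule Q)
      show "((x \<oplus>\<^bsub>?C\<^esub> y) \<otimes>\<^bsub>?C\<^esub> z) n = (x \<otimes>\<^bsub>?C\<^esub> z \<oplus>\<^bsub>?C\<^esub> y \<otimes>\<^bsub>?C\<^esub> z) n"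
        using xyz by (simp add: ops q.l_distr comp)
    qed
  next
    fix x assume x: "x \<in> carrier ?C"
    show "\<one>\<^bsub>?C\<^esub> \<otimes>\<^bsub>?C\<^esub> x = x"
    proof (rule ext)
      fix n
      interpret q: cring "R Quot ?J n" by (rule Q)
      show "(\<one>\<^bsub>?C\<^esub> \<otimes>\<^bsub>?C\<^esub> x) n = x n"
        using x by (simp add: ops comp)
    qed
  qed
  show "to_completion R I \<in> ring_hom R ?C"
  proof (rule ring_hom_memI)
    fix a b assume "a \<in> carrier R" "b \<in> carrier R"
    then show "to_completion R I (a \<otimes> b) = to_completion R I a \<otimes>\<^bsub>?C\<^esub> to_completion R I b"
      "to_completion R I (a \<oplus> b) = to_completion R I a \<oplus>\<^bsub>?C\<^esub> to_completion R I b"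
      by (auto simp: to_completion_def ops ring_hom_mult[OF h] ring_hom_add[OF h])
  qed (use img img_one in auto)
qed

locale scalar_extension = module R M + B?: cring B for R (structure) and M (structure) and B (structure) +
  fixes \<phi> assumes hom: "\<phi> \<in> ring_hom R B"
begin

abbreviation "F \<equiv> tensor_free M B"
abbreviation "U \<equiv> tensor_sub R M B \<phi>"
abbreviation "act b \<equiv> frag_extend (\<lambda>(x, d). frag_of (x, b \<otimes>\<^bsub>B\<^esub> d))"

lemma F_group: "comm_group F"
  by (simp add: tensor_free_def abelian_free_Abelian_group)

lemma F_simps [simp]: "\<one>\<^bsub>F\<^esub> = 0" "x \<otimes>\<^bsub>F\<^esub> y = x + y"
  by (simp_all add: tensor_free_def)

lemma F_carrier:
  "x \<in> carrier F \<longleftrightarrow> Poly_Mapping.keys x \<subseteq> carrier M \<times> carrier B"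
  by (simp add: tensor_free_def)

lemma F_inv: "x \<in> carrier F \<Longrightarrow> inv\<^bsub>F\<^esub> x = - x"
  by (simp add: tensor_free_def)

lemma F_add: "x \<in> carrier F \<Longrightarrow> y \<in> carrier F \<Longrightarrow> x + y \<in> carrier F"
  unfolding F_carrier by (rule order_trans[OF keys_add]) auto

lemma F_diff: "x \<in> carrier F \<Longrightarrow> y \<in> carrier F \<Longrightarrow> x - y \<in> carrier F"
  unfolding F_carrier by (rule order_trans[OF keys_diff]) auto

lemma F_of: "x \<in> carrier M \<Longrightarrow> b \<in> carrier B \<Longrightarrow> frag_of (x, b) \<in> carrier F"
  by (simp add: F_carrier)

lemma hom_closed: "a \<in> carrier R \<Longrightarrow> \<phi> a \<in> carrier B"
  by (rule ring_hom_closed[OF hom])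

lemma rels_subset: "tensor_rels R M B \<phi> \<subseteq> carrier F"
  unfolding tensor_rels_def
  by (auto intro!: F_diff F_add F_of simp: hom_closed)

lemma U_subgroup: "subgroup U F"
  unfolding tensor_sub_def
  by (rule group.generate_is_subgroup[OF comm_group.axioms(2)[OF F_group] rels_subset])

lemma U_diff: "c \<in> U \<Longrightarrow> d \<in> U \<Longrightarrow> c - d \<in> U"
  using subgroup.m_closed[OF U_subgroup, of c "inv\<^bsub>F\<^esub> d"]
    subgroup.m_inv_closed[OF U_subgroup, of d] subgroup.mem_carrier[OF U_subgroup, of d]
  by (simp add: F_inv)

lemma U_normal: "U \<lhd> F"
  by (rule comm_group.subgroup_imp_normal[OF F_group U_subgroup])

lemma act_F: "b \<in> carrier B \<Longrightarrow> c \<in> carrier F \<Longrightarrow> act b c \<in> carrier F"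
  unfolding F_carrier by (rule order_trans[OF keys_frag_extend]) auto

lemma act_U:
  assumes b: "b \<in> carrier B" and c: "c \<in> U"
  shows "act b c \<in> U"
proof -
  interpret U: subgroup U F by (rule U_subgroup)
  have rel: "act b h \<in> tensor_rels R M B \<phi>" if h: "h \<in> tensor_rels R M B \<phi>" for h
  proof -
    consider
      (l) x y d where "h = frag_of (x \<oplus>\<^bsub>M\<^esub> y, d) - (frag_of (x, d) + frag_of (y, d))"
        "x \<in> carrier M" "y \<in> carrier M" "d \<in> carrier B"
    | (r) x d e where "h = frag_of (x, d \<oplus>\<^bsub>B\<^esub> e) - (frag_of (x, d) + frag_of (x, e))"
        "x \<in> carrier M" "d \<in> carrier B" "e \<in> carrier B"
    | (s) a x d where "h = frag_of (a \<odot>\<^bsub>M\<^esub> x, d) - frag_of (x, \<phi> a \<otimes>\<^bsub>B\<^esub> d)"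
        "a \<in> carrier R" "x \<in> carrier M" "d \<in> carrier B"
      using h unfolding tensor_rels_def by blast
    then show ?thesis
    proof cases
      case l
      then have "act b h = frag_of (x \<oplus>\<^bsub>M\<^esub> y, b \<otimes>\<^bsub>B\<^esub> d)
          - (frag_of (x, b \<otimes>\<^bsub>B\<^esub> d) + frag_of (y, b \<otimes>\<^bsub>B\<^esub> d))"
        by (simp add: frag_extend_diff frag_extend_add)
      moreover have "b \<otimes>\<^bsub>B\<^esub> d \<in> carrier B" using l b by simp
      ultimately show ?thesis unfolding tensor_rels_def using l(2,3) by blast
    next
      case r
      then have "act b h = frag_of (x, (b \<otimes>\<^bsub>B\<^esub> d) \<oplus>\<^bsub>B\<^esub> (b \<otimes>\<^bsub>B\<^esub> e))
          - (frag_of (x, b \<otimes>\<^bsub>B\<^esub> d) + frag_of (x, b \<otimes>\<^bsub>B\<^esub> e))"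
        using b by (simp add: frag_extend_diff frag_extend_add B.r_distr)
      moreover have "b \<otimes>\<^bsub>B\<^esub> d \<in> carrier B" "b \<otimes>\<^bsub>B\<^esub> e \<in> carrier B" using r b by simp_all
      ultimately show ?thesis unfolding tensor_rels_def using r(2) by blast
    next
      case s
      then have "act b h = frag_of (a \<odot>\<^bsub>M\<^esub> x, b \<otimes>\<^bsub>B\<^esub> d) - frag_of (x, \<phi> a \<otimes>\<^bsub>B\<^esub> (b \<otimes>\<^bsub>B\<^esub> d))"
        using b by (simp add: frag_extend_diff B.m_lcomm hom_closed)
      moreover have "b \<otimes>\<^bsub>B\<^esub> d \<in> carrier B" using s b by simp
      ultimately show ?thesis unfolding tensor_rels_def using s(2,3) by blast
    qed
  qed
  show ?thesis
    using c unfolding tensor_sub_def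
  proof (induction rule: generate.induct)
    case one
    then show ?case using generate.one[of F] by simp
  next
    case (incl h)
    then show ?case using rel generate.incl by metis
  next
    case (inv h)
    then have "h \<in> carrier F" "act b h \<in> carrier F"
      using rels_subset act_F[OF b] by blast+
    then have "act b (inv\<^bsub>F\<^esub> h) = inv\<^bsub>F\<^esub> (act b h)"
      by (simp only: F_inv frag_extend_minus)
    then show ?case using rel[OF inv] generate.inv by metis
  next
    case (eng h k)
    then show ?case using generate.eng[of "act b h" F _ "act b k"]
      by (simp add: frag_extend_add)
  qed
qed

lemma coset_eq_iff:
  assumes "c \<in> carrier F" "d \<in> carrier F"
  shows "U #>\<^bsub>F\<^esub> c = U #>\<^bsub>F\<^esub> d \<longleftrightarrow> c - d \<in> U"
proof -
  interpret F: comm_group F by (rule F_group)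
  have "U #>\<^bsub>F\<^esub> c = U #>\<^bsub>F\<^esub> d \<longleftrightarrow> c \<otimes>\<^bsub>F\<^esub> inv\<^bsub>F\<^esub> d \<in> U"
  proof
    assume "U #>\<^bsub>F\<^esub> c = U #>\<^bsub>F\<^esub> d"
    then have "c \<in> U #>\<^bsub>F\<^esub> d"
      using F.rcos_self[OF assms(1) U_subgroup] by simp
    then show "c \<otimes>\<^bsub>F\<^esub> inv\<^bsub>F\<^esub> d \<in> U"
      by (rule subgroup.rcos_module_imp[OF U_subgroup F.is_group assms(2)])
  next
    assume "c \<otimes>\<^bsub>F\<^esub> inv\<^bsub>F\<^esub> d \<in> U"
    then have "c \<in> U #>\<^bsub>F\<^esub> d"
      using subgroup.rcos_module_rev[OF U_subgroup F.is_group assms(2,1)] by blast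
    then show "U #>\<^bsub>F\<^esub> c = U #>\<^bsub>F\<^esub> d"
      using F.repr_independence[OF _ assms(2) U_subgroup] by simp
  qed
  then show ?thesis using assms(2) F_inv[OF assms(2)] by simp
qed

lemma base_change_smult:
  assumes b: "b \<in> carrier B" and c: "c \<in> carrier F"
  shows "b \<odot>\<^bsub>base_change R M B \<phi>\<^esub> (U #>\<^bsub>F\<^esub> c) = U #>\<^bsub>F\<^esub> act b c"
proof -
  interpret F: comm_group F by (rule F_group)
  have "U #>\<^bsub>F\<^esub> act b d = U #>\<^bsub>F\<^esub> act b c" if "d \<in> U #>\<^bsub>F\<^esub> c" for d
  proof -
    have d: "d \<in> carrier F" using that c F.r_coset_subset_G[OF _ c] subgroup.subset[OF U_subgroup]
      by blast
    have "d - c \<in> U" using that by (auto simp: r_coset_def)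
    then have "act b d - act b c \<in> U"
      using act_U[OF b] by (metis frag_extend_diff)
    then show ?thesis using coset_eq_iff act_F[OF b] c d by blast
  qed
  moreover have "c \<in> U #>\<^bsub>F\<^esub> c" by (rule F.rcos_self[OF c U_subgroup])
  ultimately show ?thesis
    unfolding base_change_def module.simps by (intro SUP_eq_const) blast+
qed

lemma base_change_add:
  assumes "c \<in> carrier F" "d \<in> carrier F"
  shows "(U #>\<^bsub>F\<^esub> c) \<oplus>\<^bsub>base_change R M B \<phi>\<^esub> (U #>\<^bsub>F\<^esub> d) = U #>\<^bsub>F\<^esub> (c + d)"
  using normal.rcos_sum[OF U_normal assms] by (simp add: base_change_def FactGroup_def)

lemma base_change_elim:
  assumes "P \<in> carrier (base_change R M B \<phi>)"
  obtains c where "c \<in> carrier F" "P = U #>\<^bsub>F\<^esub> c"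
  using assms by (auto simp: base_change_def FactGroup_def RCOSETS_def)

lemma coset_closed: "c \<in> carrier F \<Longrightarrow> U #>\<^bsub>F\<^esub> c \<in> carrier (base_change R M B \<phi>)"
  by (auto simp: base_change_def FactGroup_def RCOSETS_def)

lemma frag_induct_F [consumes 1, case_names of diff zero]:
  assumes "c \<in> carrier F"
    and "\<And>x d. x \<in> carrier M \<Longrightarrow> d \<in> carrier B \<Longrightarrow> P (frag_of (x, d))"
    and "\<And>c d. c \<in> carrier F \<Longrightarrow> d \<in> carrier F \<Longrightarrow> P c \<Longrightarrow> P d \<Longrightarrow> P (c - d)"
    and "P 0"
  shows "P c"
proof -
  have k: "Poly_Mapping.keys c \<subseteq> carrier M \<times> carrier B" using assms(1) F_carrier by simp
  show ?thesis
    by (rule free_Abelian_group_induct[OF k, of P]) (use assms(2-4) F_carrier in auto)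
qed

lemma base_change_module: "module B (base_change R M B \<phi>)"
proof -
  let ?T = "base_change R M B \<phi>"
  interpret Q: comm_group "F Mod U"
    by (rule comm_group.abelian_FactGroup[OF F_group U_subgroup])
  have eq: "carrier ?T = carrier (F Mod U)" "\<zero>\<^bsub>?T\<^esub> = \<one>\<^bsub>F Mod U\<^esub>"
    "\<And>P Q. P \<oplus>\<^bsub>?T\<^esub> Q = P \<otimes>\<^bsub>F Mod U\<^esub> Q"
    by (simp_all add: base_change_def)
  have ab: "abelian_group ?T"
  proof (rule abelian_groupI, unfold eq)
    fix P Q T
    assume P: "P \<in> carrier (F Mod U)"
    show "\<one>\<^bsub>F Mod U\<^esub> \<otimes>\<^bsub>F Mod U\<^esub> P = P" by (rule Q.l_one[OF P])
    show "\<exists>Q\<in>carrier (F Mod U). Q \<otimes>\<^bsub>F Mod U\<^esub> P = \<one>\<^bsub>F Mod U\<^esub>" by (rule Q.l_inv_ex[OF P])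
    assume Q: "Q \<in> carrier (F Mod U)"
    show "P \<otimes>\<^bsub>F Mod U\<^esub> Q \<in> carrier (F Mod U)" by (rule Q.m_closed[OF P Q])
    show "P \<otimes>\<^bsub>F Mod U\<^esub> Q = Q \<otimes>\<^bsub>F Mod U\<^esub> P" by (rule Q.m_comm[OF P Q])
    assume T: "T \<in> carrier (F Mod U)"
    show "P \<otimes>\<^bsub>F Mod U\<^esub> Q \<otimes>\<^bsub>F Mod U\<^esub> T = P \<otimes>\<^bsub>F Mod U\<^esub> (Q \<otimes>\<^bsub>F Mod U\<^esub> T)"
      by (rule Q.m_assoc[OF P Q T])
  qed (rule Q.one_closed)
  have l_distr: "act (a \<oplus>\<^bsub>B\<^esub> b) c - (act a c + act b c) \<in> U"
    if "a \<in> carrier B" "b \<in> carrier B" "c \<in> carrier F" for a b c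
    using that(3)
  proof (induction rule: frag_induct_F)
    case (of x d)
    have "frag_of (x, (a \<otimes>\<^bsub>B\<^esub> d) \<oplus>\<^bsub>B\<^esub> (b \<otimes>\<^bsub>B\<^esub> d))
        - (frag_of (x, a \<otimes>\<^bsub>B\<^esub> d) + frag_of (x, b \<otimes>\<^bsub>B\<^esub> d)) \<in> tensor_rels R M B \<phi>"
      unfolding tensor_rels_def using of that by blast
    then have "frag_of (x, (a \<otimes>\<^bsub>B\<^esub> d) \<oplus>\<^bsub>B\<^esub> (b \<otimes>\<^bsub>B\<^esub> d))
        - (frag_of (x, a \<otimes>\<^bsub>B\<^esub> d) + frag_of (x, b \<otimes>\<^bsub>B\<^esub> d)) \<in> U"
      unfolding tensor_sub_def by (rule generate.incl)
    then show ?case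
      using of that by (simp add: B.l_distr)
  next
    case (diff c d)
    have "(act (a \<oplus>\<^bsub>B\<^esub> b) c - (act a c + act b c))
        - (act (a \<oplus>\<^bsub>B\<^esub> b) d - (act a d + act b d)) \<in> U"
      by (rule U_diff[OF diff(3,4)])
    then show ?case by (simp add: frag_extend_diff algebra_simps)
  next
    case zero
    show ?case using subgroup.one_closed[OF U_subgroup] by simp
  qed
  have assoc: "act (a \<otimes>\<^bsub>B\<^esub> b) c = act a (act b c)"
    if "a \<in> carrier B" "b \<in> carrier B" "c \<in> carrier F" for a b c
    using that(3)
    by (induction rule: frag_induct_F) (use that in \<open>auto simp: frag_extend_diff B.m_assoc\<close>)
  have one: "act \<one>\<^bsub>B\<^esub> c = c" if "c \<in> carrier F" for c
    using that by (induction rule: frag_induct_F) (auto simp: frag_extend_diff)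
  show ?thesis
  proof (rule moduleI[OF B.is_cring ab])
    fix b P assume "b \<in> carrier B" "P \<in> carrier ?T"
    then show "b \<odot>\<^bsub>?T\<^esub> P \<in> carrier ?T"
      by (elim base_change_elim) (simp add: base_change_smult coset_closed act_F)
  next
    fix a b P assume ab: "a \<in> carrier B" "b \<in> carrier B" and "P \<in> carrier ?T"
    then obtain c where c: "c \<in> carrier F" "P = U #>\<^bsub>F\<^esub> c" by (elim base_change_elim)
    then show "(a \<oplus>\<^bsub>B\<^esub> b) \<odot>\<^bsub>?T\<^esub> P = a \<odot>\<^bsub>?T\<^esub> P \<oplus>\<^bsub>?T\<^esub> b \<odot>\<^bsub>?T\<^esub> P"
      using ab l_distr[OF ab c(1)]
      by (simp add: base_change_smult base_change_add act_F F_add coset_eq_iff)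
  next
    fix b P Q assume "b \<in> carrier B" "P \<in> carrier ?T" "Q \<in> carrier ?T"
    then show "b \<odot>\<^bsub>?T\<^esub> (P \<oplus>\<^bsub>?T\<^esub> Q) = b \<odot>\<^bsub>?T\<^esub> P \<oplus>\<^bsub>?T\<^esub> b \<odot>\<^bsub>?T\<^esub> Q"
      by (elim base_change_elim)
        (simp add: base_change_smult base_change_add act_F F_add frag_extend_add)
  next
    fix a b P assume "a \<in> carrier B" "b \<in> carrier B" "P \<in> carrier ?T"
    then show "(a \<otimes>\<^bsub>B\<^esub> b) \<odot>\<^bsub>?T\<^esub> P = a \<odot>\<^bsub>?T\<^esub> (b \<odot>\<^bsub>?T\<^esub> P)"
      by (elim base_change_elim)
        (simp add: base_change_smult act_F assoc)
  next
    fix P assume "P \<in> carrier ?T"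
    then show "\<one>\<^bsub>B\<^esub> \<odot>\<^bsub>?T\<^esub> P = P"
      by (elim base_change_elim) (simp add: base_change_smult one)
  qed
qed

end

end

theory Submission
  imports Defs
begin

text \<open>
  Most parts rest on one observation: if \<open>I\<^sup>n x \<subseteq> I\<^sup>n\<^sup>+\<^sup>1 N\<close> holds for one exponent \<open>n\<close>, then
  it holds for all larger ones. Hence finitely many elements share an exponent, and the closure
  \<open>ratliff_rush R M I N\<close> is a submodule, so that a module is contained in it as soon as a
  generating set is. Sums and products with an ideal are therefore checked on generators, while
  monotonicity and enlarging the smaller module only need \<open>I\<^sup>n\<^sup>+\<^sup>1 N \<subseteq> I\<^sup>n\<^sup>+\<^sup>1 K\<close>. Cancelling a
  regular \<open>c\<close> works because \<open>I\<^sup>n\<^sup>+\<^sup>1 (c N)\<close> consists of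
  multiples \<open>c y\<close> with \<open>y \<in> I\<^sup>n\<^sup>+\<^sup>1 N\<close>. For transitivity a finitely generated \<open>K\<close> gives a single
  \<open>n\<close> with \<open>I\<^sup>n K \<subseteq> I\<^sup>n\<^sup>+\<^sup>1 N\<close>; from \<open>I\<^sup>m x \<subseteq> I\<^sup>m\<^sup>+\<^sup>1 K\<close> follows
  \<open>I\<^sup>n\<^sup>+\<^sup>m x \<subseteq> I\<^sup>m\<^sup>+\<^sup>1 I\<^sup>n K \<subseteq> I\<^sup>n\<^sup>+\<^sup>m\<^sup>+\<^sup>2 N\<close>.

  Localization and completion are both instances of a semilinear map \<open>f : M \<rightarrow> T\<close> over a ring
  homomorphism \<open>\<phi> : R \<rightarrow> B\<close>. Extension of ideals and submodules along such a pair commutes with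
  products (\<open>ext_ideal_prod\<close>, \<open>ext_submodule_smult\<close>), so it carries reductions to
  reductions (\<open>ratliff_rush_reduction_ext\<close>).

  To descend from the completion, it suffices that extension to \<open>M \<otimes> R\<^sup>*\<close> is faithful on
  submodules: if \<open>y \<otimes> 1\<close> lies in \<open>N R\<^sup>*\<close> then \<open>y \<in> N\<close>. The map
  \<open>x \<otimes> b \<mapsto> b\<^sub>k x\<close> into \<open>M / (N + \<mm>\<^sup>k M)\<close>, where \<open>b\<^sub>k\<close> is the component of \<open>b\<close> in
  \<open>R / \<mm>\<^sup>k\<close>, kills \<open>N R\<^sup>*\<close> and sends \<open>y \<otimes> 1\<close> to the class of \<open>y\<close>
  (\<open>completion_contraction\<close>). Hence \<open>y \<in> N + \<mm>\<^sup>k M\<close> for every \<open>k\<close>, and Krull's intersection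
  theorem (\<open>krull_intersection\<close>) gives \<open>y \<in> N\<close>. That theorem is derived from the ascending
  chain condition and Nakayama's lemma.
\<close>

section \<open>Submodules, colons and products\<close>

lemma (in cring) ideal_by_closure:
  assumes "H \<subseteq> carrier R" "\<zero> \<in> H" "\<And>a b. a \<in> H \<Longrightarrow> b \<in> H \<Longrightarrow> a \<oplus> b \<in> H"
    and "\<And>a r. a \<in> H \<Longrightarrow> r \<in> carrier R \<Longrightarrow> r \<otimes> a \<in> H"
  shows "ideal H R"
proof (rule idealI[OF ring_axioms])
  show "subgroup H (add_monoid R)"
  proof (rule group.subgroupI[OF a_group])
    fix a assume a: "a \<in> H"
    then have "\<ominus> a = (\<ominus> \<one>) \<otimes> a" using assms(1) by (auto simp: l_minus subset_iff)
    then have "\<ominus> a \<in> H" using assms(4)[OF a, of "\<ominus> \<one>"] by simp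
    then show "inv\<^bsub>add_monoid R\<^esub> a \<in> H" by (simp add: a_inv_def)
  qed (use assms in auto)
  show "a \<otimes> x \<in> H" if "a \<in> H" "x \<in> carrier R" for a x
    using assms(1,4) that m_comm by (metis subsetD)
qed (rule assms(4))

lemma (in cring) ideal_prod_least:
  assumes "ideal H R" "\<And>i j. i \<in> I \<Longrightarrow> j \<in> J \<Longrightarrow> i \<otimes> j \<in> H"
  shows "I \<cdot> J \<subseteq> H"
proof
  fix s assume "s \<in> I \<cdot> J"
  then show "s \<in> H"
    by induction (use assms additive_subgroup.a_closed[OF ideal.axioms(1)] in auto)
qed

context module
begin

lemma submodule_by_closure:
  assumes "H \<subseteq> carrier M" "\<zero>\<^bsub>M\<^esub> \<in> H" "\<And>x y. x \<in> H \<Longrightarrow> y \<in> H \<Longrightarrow> x \<oplus>\<^bsub>M\<^esub> y \<in> H"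
    and "\<And>a x. a \<in> carrier R \<Longrightarrow> x \<in> H \<Longrightarrow> a \<odot>\<^bsub>M\<^esub> x \<in> H"
  shows "submodule H R M"
proof (rule submoduleI)
  fix x assume x: "x \<in> H"
  then have "\<ominus>\<^bsub>M\<^esub> x = (\<ominus> \<one>) \<odot>\<^bsub>M\<^esub> x" using assms(1) by (auto simp: smult_l_minus subset_iff)
  then show "\<ominus>\<^bsub>M\<^esub> x \<in> H" using assms(4)[OF _ x, of "\<ominus> \<one>"] by simp
qed (use assms in auto)

lemma submodule_zero: "submodule H R M \<Longrightarrow> \<zero>\<^bsub>M\<^esub> \<in> H"
  using subgroup.one_closed[OF submodule.axioms(1)] by force

lemma submodule_minus: "submodule H R M \<Longrightarrow> x \<in> H \<Longrightarrow> y \<in> H \<Longrightarrow> x \<ominus>\<^bsub>M\<^esub> y \<in> H"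
  using submoduleE(3,5) by (metis M.minus_eq)

lemma minus_eq_zero_iff: "x \<in> carrier M \<Longrightarrow> y \<in> carrier M \<Longrightarrow> x \<ominus>\<^bsub>M\<^esub> y = \<zero>\<^bsub>M\<^esub> \<longleftrightarrow> x = y"
  by (metis M.minus_eq M.minus_equality M.minus_minus M.a_inv_closed M.r_neg)

lemma submod_gen_submodule:
  assumes "P \<subseteq> carrier M"
  shows "submodule (submod_gen R M P) R M"
  unfolding submod_gen_def
  by (rule submodule_by_closure) (use assms carrier_is_submodule submodule_zero in \<open>auto simp: submoduleE(3-5)\<close>)

lemma submod_gen_least: "submodule H R M \<Longrightarrow> P \<subseteq> H \<Longrightarrow> submod_gen R M P \<subseteq> H"
  unfolding submod_gen_def by blast

lemma submod_gen_incl: "P \<subseteq> submod_gen R M P"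
  unfolding submod_gen_def by blast

lemma ideal_smult_submodule:
  assumes "I \<subseteq> carrier R" "N \<subseteq> carrier M"
  shows "submodule (ideal_smult R M I N) R M"
  unfolding ideal_smult_def by (rule submod_gen_submodule) (use assms in auto)

lemma ideal_smult_least:
  assumes "submodule H R M" "\<And>a x. a \<in> I \<Longrightarrow> x \<in> N \<Longrightarrow> a \<odot>\<^bsub>M\<^esub> x \<in> H"
  shows "ideal_smult R M I N \<subseteq> H"
  unfolding ideal_smult_def by (rule submod_gen_least) (use assms in auto)

lemma ideal_smult_memI: "a \<in> I \<Longrightarrow> x \<in> N \<Longrightarrow> a \<odot>\<^bsub>M\<^esub> x \<in> ideal_smult R M I N"
  unfolding ideal_smult_def by (rule subsetD[OF submod_gen_incl]) blast

lemma ideal_smult_mono: "I \<subseteq> J \<Longrightarrow> N \<subseteq> K \<Longrightarrow> ideal_smult R M I N \<subseteq> ideal_smult R M J K"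
  unfolding ideal_smult_def submod_gen_def by (rule Inter_anti_mono) blast

lemma ideal_smult_subset: "submodule N R M \<Longrightarrow> I \<subseteq> carrier R \<Longrightarrow> ideal_smult R M I N \<subseteq> N"
  by (rule ideal_smult_least) (use submoduleE(4) in auto)

text \<open>The colons \<open>H : A\<close> in the module and \<open>H : Y\<close> in the ring reduce most inclusions below to
  generators: to show \<open>a x \<in> H\<close> for all \<open>a\<close> in a generated ideal (or all \<open>x\<close> in a generated
  submodule), it is enough to place the generators in a colon.\<close>

lemma submodule_colon:
  assumes "submodule H R M" "A \<subseteq> carrier R"
  shows "submodule {x \<in> carrier M. \<forall>a\<in>A. a \<odot>\<^bsub>M\<^esub> x \<in> H} R M"
proof (rule submodule_by_closure)
  fix b x assume "b \<in> carrier R" "x \<in> {x \<in> carrier M. \<forall>a\<in>A. a \<odot>\<^bsub>M\<^esub> x \<in> H}"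
  moreover have "a \<odot>\<^bsub>M\<^esub> (b \<odot>\<^bsub>M\<^esub> x) = b \<odot>\<^bsub>M\<^esub> (a \<odot>\<^bsub>M\<^esub> x)"
    if "a \<in> A" "b \<in> carrier R" "x \<in> carrier M" for a
    using that assms(2) by (metis R.m_comm smult_assoc1 subsetD)
  ultimately show "b \<odot>\<^bsub>M\<^esub> x \<in> {x \<in> carrier M. \<forall>a\<in>A. a \<odot>\<^bsub>M\<^esub> x \<in> H}"
    using submoduleE(4)[OF assms(1)] by auto
qed (use assms submoduleE(5) submodule_zero[OF assms(1)] in
     \<open>auto simp: smult_r_distr subset_iff\<close>)

lemma ideal_colon:
  assumes H: "submodule H R M" and Y: "Y \<subseteq> carrier M"
  shows "ideal {a \<in> carrier R. \<forall>x\<in>Y. a \<odot>\<^bsub>M\<^esub> x \<in> H} R"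
  by (rule R.ideal_by_closure)
    (use Y submodule_zero[OF H] submoduleE(4,5)[OF H] in
      \<open>auto simp: smult_l_distr smult_assoc1 subset_iff\<close>)

lemma ideal_smult_prod:
  assumes I: "ideal I R" and J: "ideal J R" and N: "N \<subseteq> carrier M"
  shows "ideal_smult R M (I \<cdot> J) N = ideal_smult R M I (ideal_smult R M J N)"
proof
  have c: "I \<subseteq> carrier R" "J \<subseteq> carrier R" "I \<cdot> J \<subseteq> carrier R"
    using ideal.Icarr[OF I] ideal.Icarr[OF J] ideal_prod_in_carrier[OF I J] by auto
  have JN: "submodule (ideal_smult R M J N) R M" by (rule ideal_smult_submodule[OF c(2) N])
  note JNc = submoduleE(1)[OF JN]
  show "ideal_smult R M (I \<cdot> J) N \<subseteq> ideal_smult R M I (ideal_smult R M J N)" (is "_ \<subseteq> ?H")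
  proof -
    have H: "submodule ?H R M" by (rule ideal_smult_submodule[OF c(1) JNc])
    have "I \<cdot> J \<subseteq> {a \<in> carrier R. \<forall>x\<in>N. a \<odot>\<^bsub>M\<^esub> x \<in> ?H}"
      by (rule ideal_prod_least[OF ideal_colon[OF H N]])
        (use c N in \<open>auto simp: smult_assoc1 subset_iff intro!: ideal_smult_memI\<close>)
    then show ?thesis by (intro ideal_smult_least[OF H]) blast
  qed
  show "?H \<subseteq> ideal_smult R M (I \<cdot> J) N" (is "_ \<subseteq> ?G")
  proof -
    have G: "submodule ?G R M" by (rule ideal_smult_submodule[OF c(3) N])
    have "ideal_smult R M J N \<subseteq> {x \<in> carrier M. \<forall>a\<in>I. a \<odot>\<^bsub>M\<^esub> x \<in> ?G}"
      by (rule ideal_smult_least[OF submodule_colon[OF G c(1)]])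
        (use c N in \<open>auto simp: smult_assoc1[symmetric] subset_iff intro!: ideal_smult_memI ideal_prod.prod\<close>)
    then show ?thesis by (intro ideal_smult_least[OF G]) blast
  qed
qed

lemma ideal_smult_swap:
  assumes "ideal I R" "ideal J R" "N \<subseteq> carrier M"
  shows "ideal_smult R M I (ideal_smult R M J N) = ideal_smult R M J (ideal_smult R M I N)"
  using assms by (simp add: ideal_smult_prod[symmetric] ideal_prod_commute)

lemma set_add_mem: "x \<in> A <+>\<^bsub>M\<^esub> B \<longleftrightarrow> (\<exists>a\<in>A. \<exists>b\<in>B. x = a \<oplus>\<^bsub>M\<^esub> b)"
  by (auto simp: set_add_def')

lemma submodule_sum:
  assumes A: "submodule A R M" and B: "submodule B R M"
  shows "submodule (A <+>\<^bsub>M\<^esub> B) R M"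
proof (rule submodule_by_closure)
  note Ac = submoduleE(1)[OF A, THEN subsetD] and Bc = submoduleE(1)[OF B, THEN subsetD]
  show "A <+>\<^bsub>M\<^esub> B \<subseteq> carrier M" using Ac Bc by (auto simp: set_add_mem)
  show "\<zero>\<^bsub>M\<^esub> \<in> A <+>\<^bsub>M\<^esub> B"
    using submodule_zero[OF A] submodule_zero[OF B] by (force simp: set_add_mem)
  fix x assume "x \<in> A <+>\<^bsub>M\<^esub> B"
  then obtain a b where x: "a \<in> A" "b \<in> B" "x = a \<oplus>\<^bsub>M\<^esub> b" by (auto simp: set_add_mem)
  show "c \<odot>\<^bsub>M\<^esub> x \<in> A <+>\<^bsub>M\<^esub> B" if "c \<in> carrier R" for c
  proof -
    have "c \<odot>\<^bsub>M\<^esub> x = c \<odot>\<^bsub>M\<^esub> a \<oplus>\<^bsub>M\<^esub> c \<odot>\<^bsub>M\<^esub> b" using x Ac Bc that by (simp add: smult_r_distr)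
    then show ?thesis
      using submoduleE(4)[OF A that x(1)] submoduleE(4)[OF B that x(2)] by (auto simp: set_add_mem)
  qed
  fix y assume "y \<in> A <+>\<^bsub>M\<^esub> B"
  then obtain a' b' where y: "a' \<in> A" "b' \<in> B" "y = a' \<oplus>\<^bsub>M\<^esub> b'" by (auto simp: set_add_mem)
  have "x \<oplus>\<^bsub>M\<^esub> y = (a \<oplus>\<^bsub>M\<^esub> a') \<oplus>\<^bsub>M\<^esub> (b \<oplus>\<^bsub>M\<^esub> b')"
    using x y Ac Bc by (simp add: M.a_ac)
  then show "x \<oplus>\<^bsub>M\<^esub> y \<in> A <+>\<^bsub>M\<^esub> B"
    using submoduleE(5)[OF A x(1) y(1)] submoduleE(5)[OF B x(2) y(2)] by (auto simp: set_add_mem)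
qed

lemma submodule_sum_upper:
  assumes A: "submodule A R M" and B: "submodule B R M"
  shows "A \<subseteq> A <+>\<^bsub>M\<^esub> B" "B \<subseteq> A <+>\<^bsub>M\<^esub> B"
proof -
  have "a = a \<oplus>\<^bsub>M\<^esub> \<zero>\<^bsub>M\<^esub>" if "a \<in> A" for a using that submoduleE(1)[OF A] by auto
  moreover have "b = \<zero>\<^bsub>M\<^esub> \<oplus>\<^bsub>M\<^esub> b" if "b \<in> B" for b using that submoduleE(1)[OF B] by auto
  ultimately show "A \<subseteq> A <+>\<^bsub>M\<^esub> B" "B \<subseteq> A <+>\<^bsub>M\<^esub> B"
    using submodule_zero[OF A] submodule_zero[OF B] by (auto simp: set_add_mem) blast+
qed

lemma submodule_sum_least:
  assumes "submodule H R M" "A \<subseteq> H" "B \<subseteq> H"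
  shows "A <+>\<^bsub>M\<^esub> B \<subseteq> H"
  using assms(2,3) submoduleE(5)[OF assms(1)] by (auto simp: set_add_mem subset_iff)

end

section \<open>Ratliff-Rush closure\<close>

context module
begin

lemma ideal_pow_carrier: "ideal I R \<Longrightarrow> ideal_pow R I n \<subseteq> carrier R"
  using ideal.Icarr[OF ideal_pow_ideal] by blast

lemma ideal_pow_smult_submodule:
  "ideal I R \<Longrightarrow> submodule N R M \<Longrightarrow> submodule (ideal_smult R M (ideal_pow R I n) N) R M"
  by (intro ideal_smult_submodule ideal_pow_carrier submoduleE(1))

lemma ideal_pow_smult_Suc:
  assumes "ideal I R" "N \<subseteq> carrier M"
  shows "ideal_smult R M (ideal_pow R I (Suc n)) N = ideal_smult R M I (ideal_smult R M (ideal_pow R I n) N)"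
  using assms by (simp add: ideal_pow_Suc ideal_prod_commute[of "ideal_pow R I n" I]
      ideal_pow_ideal ideal_smult_prod)

lemma ratliff_rush_iff:
  "x \<in> ratliff_rush R M I N \<longleftrightarrow> x \<in> carrier M \<and>
    (\<exists>n. \<forall>a\<in>ideal_pow R I n. a \<odot>\<^bsub>M\<^esub> x \<in> ideal_smult R M (ideal_pow R I (Suc n)) N)"
  by (auto simp: ratliff_rush_def)

lemma ratliff_rushE:
  assumes "x \<in> ratliff_rush R M I N"
  obtains n where "x \<in> carrier M"
    "\<forall>a\<in>ideal_pow R I n. a \<odot>\<^bsub>M\<^esub> x \<in> ideal_smult R M (ideal_pow R I (Suc n)) N"
  using assms unfolding ratliff_rush_iff by blast

text \<open>Since \<open>I\<^sup>k\<^sup>+\<^sup>1\<close> is generated by products \<open>a b\<close> with \<open>a \<in> I\<^sup>k\<close> and \<open>b \<in> I\<close>, one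
  more factor \<open>b\<close> can be applied to both sides of the inclusion.\<close>

lemma ratliff_rush_exponent_mono:
  assumes I: "ideal I R" and N: "N \<subseteq> carrier M" and x: "x \<in> carrier M" and "n \<le> m"
    and n: "\<forall>a\<in>ideal_pow R I n. a \<odot>\<^bsub>M\<^esub> x \<in> ideal_smult R M (ideal_pow R I (Suc n)) N"
  shows "\<forall>a\<in>ideal_pow R I m. a \<odot>\<^bsub>M\<^esub> x \<in> ideal_smult R M (ideal_pow R I (Suc m)) N"
  using \<open>n \<le> m\<close>
proof (induction rule: dec_induct)
  case base
  show ?case by (rule n)
next
  case (step k)
  let ?T = "ideal_smult R M (ideal_pow R I (Suc (Suc k))) N"
  have c: "I \<subseteq> carrier R" "ideal_pow R I k \<subseteq> carrier R"
    using ideal.Icarr[OF I] ideal_pow_carrier[OF I] by auto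
  have T: "submodule ?T R M"
    by (rule ideal_smult_submodule[OF ideal_pow_carrier[OF I] N])
  have "ideal_pow R I (Suc k) \<subseteq> {a \<in> carrier R. \<forall>y\<in>{x}. a \<odot>\<^bsub>M\<^esub> y \<in> ?T}"
    unfolding ideal_pow_Suc[of I k]
  proof (rule ideal_prod_least[OF ideal_colon[OF T]])
    fix a b assume ab: "a \<in> ideal_pow R I k" "b \<in> I"
    have "(a \<otimes> b) \<odot>\<^bsub>M\<^esub> x = b \<odot>\<^bsub>M\<^esub> (a \<odot>\<^bsub>M\<^esub> x)"
      using ab c x by (metis R.m_comm smult_assoc1 subsetD)
    moreover have "b \<odot>\<^bsub>M\<^esub> (a \<odot>\<^bsub>M\<^esub> x) \<in> ?T"
      unfolding ideal_pow_smult_Suc[OF I N, of "Suc k"] using ab step.IH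
      by (intro ideal_smult_memI[of b]) blast+
    ultimately show "a \<otimes> b \<in> {a \<in> carrier R. \<forall>y\<in>{x}. a \<odot>\<^bsub>M\<^esub> y \<in> ?T}"
      using ab c by auto
  qed (use x in auto)
  then show ?case by blast
qed

text \<open>By monotonicity in the exponent the closure is an increasing union of colon submodules.\<close>

lemma ratliff_rush_submodule:
  assumes I: "ideal I R" and N: "submodule N R M"
  shows "submodule (ratliff_rush R M I N) R M"
proof -
  let ?C = "\<lambda>n. {x \<in> carrier M. \<forall>a\<in>ideal_pow R I n. a \<odot>\<^bsub>M\<^esub> x \<in> ideal_smult R M (ideal_pow R I (Suc n)) N}"
  have C: "submodule (?C n) R M" for n
    by (rule submodule_colon[OF ideal_pow_smult_submodule[OF I N] ideal_pow_carrier[OF I]])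
  have mono: "?C n \<subseteq> ?C m" if "n \<le> m" for n m
    using ratliff_rush_exponent_mono[OF I submoduleE(1)[OF N] _ that] by blast
  have eq: "ratliff_rush R M I N = (\<Union>n. ?C n)"
    unfolding set_eq_iff ratliff_rush_iff by blast
  show ?thesis
    unfolding eq
  proof (rule submodule_by_closure)
    fix x y assume "x \<in> (\<Union>n. ?C n)" "y \<in> (\<Union>n. ?C n)"
    then obtain n m where nm: "x \<in> ?C n" "y \<in> ?C m" by blast
    have "x \<in> ?C (max n m)" "y \<in> ?C (max n m)"
      using nm mono[of n "max n m"] mono[of m "max n m"] by (meson max.cobounded1 max.cobounded2 subsetD)+
    then have "x \<oplus>\<^bsub>M\<^esub> y \<in> ?C (max n m)" by (rule submoduleE(5)[OF C])
    then show "x \<oplus>\<^bsub>M\<^esub> y \<in> (\<Union>n. ?C n)" by blast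
  next
    show "\<zero>\<^bsub>M\<^esub> \<in> (\<Union>n. ?C n)" using submodule_zero[OF C[of 0]] by blast
  next
    fix x assume "x \<in> (\<Union>n. ?C n)"
    then obtain n where n: "x \<in> ?C n" by blast
    show "a \<odot>\<^bsub>M\<^esub> x \<in> (\<Union>n. ?C n)" if "a \<in> carrier R" for a
      using submoduleE(4)[OF C that n] by blast
  qed blast
qed

lemma ratliff_rush_mono: "N \<subseteq> K \<Longrightarrow> ratliff_rush R M I N \<subseteq> ratliff_rush R M I K"
  unfolding ratliff_rush_iff subset_iff using ideal_smult_mono[OF order_refl] by blast

end

section \<open>Ratliff-Rush reductions\<close>

lemma (in cring) ideal_pow_add:
  assumes "ideal I R"
  shows "ideal_pow R I (m + n) = ideal_pow R I m \<cdot> ideal_pow R I n"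
proof -
  interpret S: comm_monoid "ideals_set R" by (rule ideals_set_is_comm_monoid)
  show ?thesis
    using S.nat_pow_mult[of I m n] assms by (simp add: ideal_pow_def ideals_set_def)
qed

context module
begin

lemma ratliff_rush_reductionI:
  assumes "submodule N R M" "submodule K R M" "N \<subseteq> K" "K \<subseteq> ratliff_rush R M I N"
  shows "ratliff_rush_reduction R M I N K"
  using assms by (simp add: ratliff_rush_reduction_def)

lemma ratliff_rush_reductionD:
  assumes "ratliff_rush_reduction R M I N K"
  shows "submodule N R M" "submodule K R M" "N \<subseteq> K" "K \<subseteq> ratliff_rush R M I N"
  using assms by (simp_all add: ratliff_rush_reduction_def)

lemma ratliff_rush_reduction_enlarge:
  assumes "ratliff_rush_reduction R M I N\<^sub>1 N\<^sub>3" "submodule N\<^sub>2 R M" "N\<^sub>1 \<subseteq> N\<^sub>2" "N\<^sub>2 \<subseteq> N\<^sub>3"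
  shows "ratliff_rush_reduction R M I N\<^sub>2 N\<^sub>3"
  using assms ratliff_rush_mono[of N\<^sub>1 N\<^sub>2 I] unfolding ratliff_rush_reduction_def by blast

text \<open>On a generator \<open>a x\<close> of \<open>J K\<close> the exponent of \<open>x\<close> still works, because
  \<open>J (I\<^sup>n\<^sup>+\<^sup>1 N) = I\<^sup>n\<^sup>+\<^sup>1 (J N)\<close>.\<close>

lemma ratliff_rush_reduction_smult:
  assumes I: "ideal I R" and J: "ideal J R" and red: "ratliff_rush_reduction R M I N K"
  shows "ratliff_rush_reduction R M I (ideal_smult R M J N) (ideal_smult R M J K)"
proof -
  note r = ratliff_rush_reductionD[OF red]
  have Jc: "J \<subseteq> carrier R" using ideal.Icarr[OF J] by blast
  have Nc: "N \<subseteq> carrier M" and Kc: "K \<subseteq> carrier M" using r(1,2) submoduleE(1) by auto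
  have JN: "submodule (ideal_smult R M J N) R M" by (rule ideal_smult_submodule[OF Jc Nc])
  show ?thesis
  proof (rule ratliff_rush_reductionI)
    show "ideal_smult R M J K \<subseteq> ratliff_rush R M I (ideal_smult R M J N)"
    proof (rule ideal_smult_least[OF ratliff_rush_submodule[OF I JN]])
      fix a x assume a: "a \<in> J" and x: "x \<in> K"
      obtain n where n: "\<forall>c\<in>ideal_pow R I n. c \<odot>\<^bsub>M\<^esub> x \<in> ideal_smult R M (ideal_pow R I (Suc n)) N"
        using r(4) x by (elim ratliff_rushE[OF subsetD])
      have "c \<odot>\<^bsub>M\<^esub> (a \<odot>\<^bsub>M\<^esub> x) \<in> ideal_smult R M (ideal_pow R I (Suc n)) (ideal_smult R M J N)"
        if c: "c \<in> ideal_pow R I n" for c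
      proof -
        have "c \<odot>\<^bsub>M\<^esub> (a \<odot>\<^bsub>M\<^esub> x) = a \<odot>\<^bsub>M\<^esub> (c \<odot>\<^bsub>M\<^esub> x)"
          using a x c Jc Kc ideal_pow_carrier[OF I, of n] by (metis R.m_comm smult_assoc1 subsetD)
        also have "\<dots> \<in> ideal_smult R M J (ideal_smult R M (ideal_pow R I (Suc n)) N)"
          using n c by (intro ideal_smult_memI[OF a]) blast
        finally show ?thesis
          by (simp only: ideal_smult_swap[OF J ideal_pow_ideal[OF I] Nc])
      qed
      moreover have "a \<odot>\<^bsub>M\<^esub> x \<in> carrier M" using a x Jc Kc by auto
      ultimately show "a \<odot>\<^bsub>M\<^esub> x \<in> ratliff_rush R M I (ideal_smult R M J N)"
        unfolding ratliff_rush_iff by blast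
    qed
  qed (use JN ideal_smult_submodule[OF Jc Kc] ideal_smult_mono[OF order_refl r(3)] in auto)
qed

lemma ratliff_rush_reduction_sum:
  assumes I: "ideal I R" and N: "ratliff_rush_reduction R M I N\<^sub>1 N\<^sub>2"
    and M: "ratliff_rush_reduction R M I M\<^sub>1 M\<^sub>2"
  shows "ratliff_rush_reduction R M I (N\<^sub>1 <+>\<^bsub>M\<^esub> M\<^sub>1) (N\<^sub>2 <+>\<^bsub>M\<^esub> M\<^sub>2)"
proof -
  note n = ratliff_rush_reductionD[OF N] and m = ratliff_rush_reductionD[OF M]
  have s: "submodule (N\<^sub>1 <+>\<^bsub>M\<^esub> M\<^sub>1) R M" "submodule (N\<^sub>2 <+>\<^bsub>M\<^esub> M\<^sub>2) R M"
    using n m by (auto intro: submodule_sum)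
  show ?thesis
  proof (rule ratliff_rush_reductionI[OF s])
    show "N\<^sub>1 <+>\<^bsub>M\<^esub> M\<^sub>1 \<subseteq> N\<^sub>2 <+>\<^bsub>M\<^esub> M\<^sub>2"
      using submodule_sum_upper[OF n(2) m(2)] n(3) m(3) by (intro submodule_sum_least s) auto
    show "N\<^sub>2 <+>\<^bsub>M\<^esub> M\<^sub>2 \<subseteq> ratliff_rush R M I (N\<^sub>1 <+>\<^bsub>M\<^esub> M\<^sub>1)"
      using n(4) m(4) ratliff_rush_mono[OF submodule_sum_upper(1)[OF n(1) m(1)]]
        ratliff_rush_mono[OF submodule_sum_upper(2)[OF n(1) m(1)]]
      by (intro submodule_sum_least ratliff_rush_submodule I s) blast+
  qed
qed

lemma submodule_image_smult:
  assumes H: "submodule H R M" and c: "c \<in> carrier R"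
  shows "submodule {c \<odot>\<^bsub>M\<^esub> x | x. x \<in> H} R M" (is "submodule ?cH R M")
proof (rule submodule_by_closure)
  note Hc = submoduleE(1)[OF H, THEN subsetD]
  show "?cH \<subseteq> carrier M" using Hc c by auto
  show "\<zero>\<^bsub>M\<^esub> \<in> ?cH" using submodule_zero[OF H] c by force
  show "y \<oplus>\<^bsub>M\<^esub> z \<in> ?cH" if yz: "y \<in> ?cH" "z \<in> ?cH" for y z
  proof -
    obtain u v where "u \<in> H" "v \<in> H" "y = c \<odot>\<^bsub>M\<^esub> u" "z = c \<odot>\<^bsub>M\<^esub> v" using yz by blast
    then show ?thesis using submoduleE(5)[OF H, of u v] Hc c by (auto simp: smult_r_distr[symmetric])
  qed
  show "b \<odot>\<^bsub>M\<^esub> y \<in> ?cH" if scaled: "b \<in> carrier R" "y \<in> ?cH" for b y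
  proof -
    obtain u where u: "u \<in> H" "y = c \<odot>\<^bsub>M\<^esub> u" using scaled(2) by blast
    then have "b \<odot>\<^bsub>M\<^esub> y = c \<odot>\<^bsub>M\<^esub> (b \<odot>\<^bsub>M\<^esub> u)" using scaled(1) Hc c by (metis R.m_comm smult_assoc1)
    then show ?thesis using submoduleE(4)[OF H scaled(1) u(1)] by blast
  qed
qed

text \<open>Every element of \<open>I\<^sup>n\<^sup>+\<^sup>1 (c N)\<close> has the form \<open>c y\<close> with \<open>y \<in> I\<^sup>n\<^sup>+\<^sup>1 N\<close>, so an equation
  \<open>a (c x) = c y\<close> can be divided by the regular element \<open>c\<close>.\<close>

lemma ratliff_rush_reduction_cancel:
  assumes I: "ideal I R" and c: "module_regular R M c"
    and N: "submodule N R M" and K: "submodule K R M" and NK: "N \<subseteq> K"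
    and red: "ratliff_rush_reduction R M I {c \<odot>\<^bsub>M\<^esub> x | x. x \<in> N} {c \<odot>\<^bsub>M\<^esub> x | x. x \<in> K}"
  shows "ratliff_rush_reduction R M I N K"
proof (rule ratliff_rush_reductionI[OF N K NK], rule subsetI)
  note Nc = submoduleE(1)[OF N] and Kc = submoduleE(1)[OF K]
  have cR: "c \<in> carrier R" and cz: "\<And>x. x \<in> carrier M \<Longrightarrow> c \<odot>\<^bsub>M\<^esub> x = \<zero>\<^bsub>M\<^esub> \<Longrightarrow> x = \<zero>\<^bsub>M\<^esub>"
    using c by (auto simp: module_regular_def)
  fix x assume x: "x \<in> K"
  then have xc: "x \<in> carrier M" using Kc by blast
  have "c \<odot>\<^bsub>M\<^esub> x \<in> ratliff_rush R M I {c \<odot>\<^bsub>M\<^esub> x | x. x \<in> N}"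
    using ratliff_rush_reductionD(4)[OF red] x by blast
  then obtain n where n: "\<forall>a\<in>ideal_pow R I n. a \<odot>\<^bsub>M\<^esub> (c \<odot>\<^bsub>M\<^esub> x)
      \<in> ideal_smult R M (ideal_pow R I (Suc n)) {c \<odot>\<^bsub>M\<^esub> x | x. x \<in> N}"
    by (elim ratliff_rushE)
  let ?P = "ideal_smult R M (ideal_pow R I (Suc n)) N"
  note Ic = ideal_pow_carrier[OF I, THEN subsetD]
  have P: "submodule ?P R M" by (rule ideal_pow_smult_submodule[OF I N])
  note Pc = submoduleE(1)[OF P, THEN subsetD]
  have sub: "ideal_smult R M (ideal_pow R I (Suc n)) {c \<odot>\<^bsub>M\<^esub> x | x. x \<in> N} \<subseteq> {c \<odot>\<^bsub>M\<^esub> y | y. y \<in> ?P}"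
  proof (rule ideal_smult_least[OF submodule_image_smult[OF P cR]])
    fix a y assume a: "a \<in> ideal_pow R I (Suc n)" and "y \<in> {c \<odot>\<^bsub>M\<^esub> x | x. x \<in> N}"
    then obtain z where z: "z \<in> N" "y = c \<odot>\<^bsub>M\<^esub> z" by blast
    then have "a \<odot>\<^bsub>M\<^esub> y = c \<odot>\<^bsub>M\<^esub> (a \<odot>\<^bsub>M\<^esub> z)"
      using Ic[OF a] Nc cR by (metis R.m_comm smult_assoc1 subsetD)
    then show "a \<odot>\<^bsub>M\<^esub> y \<in> {c \<odot>\<^bsub>M\<^esub> y | y. y \<in> ?P}"
      using ideal_smult_memI[OF a z(1)] by blast
  qed
  have "a \<odot>\<^bsub>M\<^esub> x \<in> ?P" if a: "a \<in> ideal_pow R I n" for a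
  proof -
    have "a \<odot>\<^bsub>M\<^esub> (c \<odot>\<^bsub>M\<^esub> x) \<in> {c \<odot>\<^bsub>M\<^esub> y | y. y \<in> ?P}" using n a sub by blast
    then obtain y where y: "y \<in> ?P" "a \<odot>\<^bsub>M\<^esub> (c \<odot>\<^bsub>M\<^esub> x) = c \<odot>\<^bsub>M\<^esub> y" by blast
    have "c \<odot>\<^bsub>M\<^esub> (a \<odot>\<^bsub>M\<^esub> x) = a \<odot>\<^bsub>M\<^esub> (c \<odot>\<^bsub>M\<^esub> x)"
      using Ic[OF a] cR xc by (metis R.m_comm smult_assoc1)
    then have "c \<odot>\<^bsub>M\<^esub> (a \<odot>\<^bsub>M\<^esub> x) \<ominus>\<^bsub>M\<^esub> c \<odot>\<^bsub>M\<^esub> y = \<zero>\<^bsub>M\<^esub>"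
      using y Pc[OF y(1)] cR by (simp add: minus_eq_zero_iff)
    then have "c \<odot>\<^bsub>M\<^esub> (a \<odot>\<^bsub>M\<^esub> x \<ominus>\<^bsub>M\<^esub> y) = \<zero>\<^bsub>M\<^esub>"
      using Pc[OF y(1)] cR Ic[OF a] xc by (simp add: M.minus_eq smult_r_distr smult_r_minus)
    then have "a \<odot>\<^bsub>M\<^esub> x \<ominus>\<^bsub>M\<^esub> y = \<zero>\<^bsub>M\<^esub>"
      using Pc[OF y(1)] cz Ic[OF a] xc by simp
    then have "a \<odot>\<^bsub>M\<^esub> x = y"
      using Pc[OF y(1)] Ic[OF a] xc by (simp add: minus_eq_zero_iff)
    then show ?thesis using y by simp
  qed
  then show "x \<in> ratliff_rush R M I N" using xc unfolding ratliff_rush_iff by blast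
qed

text \<open>The maximum of the exponents of finitely many generators serves the whole module.\<close>

lemma ratliff_rush_uniform_exponent:
  assumes I: "ideal I R" and N: "submodule N R M" and P: "finite P"
    and K: "K = submod_gen R M P" "K \<subseteq> ratliff_rush R M I N"
  shows "\<exists>n. ideal_smult R M (ideal_pow R I n) K \<subseteq> ideal_smult R M (ideal_pow R I (Suc n)) N"
proof -
  let ?C = "\<lambda>n. {x \<in> carrier M. \<forall>a\<in>ideal_pow R I n. a \<odot>\<^bsub>M\<^esub> x \<in> ideal_smult R M (ideal_pow R I (Suc n)) N}"
  have "P \<subseteq> ratliff_rush R M I N" using K submod_gen_incl[of P] by simp
  then have "\<exists>n. x \<in> ?C n" if "x \<in> P" for x
    using that ratliff_rush_iff[of x I N] by auto
  then have "\<forall>x\<in>P. \<exists>n. x \<in> ?C n" by (rule ballI)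
  from bchoice[OF this] obtain f where f: "\<forall>x\<in>P. x \<in> ?C (f x)" ..
  define n where "n = Max (insert 0 (f ` P))"
  have "P \<subseteq> ?C n"
  proof
    fix x assume x: "x \<in> P"
    then have "f x \<le> n" using P by (simp add: n_def)
    then show "x \<in> ?C n"
      using bspec[OF f x] ratliff_rush_exponent_mono[OF I submoduleE(1)[OF N]] by blast
  qed
  then have "K \<subseteq> ?C n"
    unfolding K(1)
    by (intro submod_gen_least submodule_colon ideal_pow_smult_submodule I N ideal_pow_carrier)
  then show ?thesis
    by (intro exI[of _ n] ideal_smult_least ideal_pow_smult_submodule I N) blast
qed

text \<open>With the uniform exponent \<open>n\<close> for \<open>K\<close>, an element with \<open>I\<^sup>m x \<subseteq> I\<^sup>m\<^sup>+\<^sup>1 K\<close> satisfies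
  \<open>I\<^sup>n\<^sup>+\<^sup>m x \<subseteq> I\<^sup>m\<^sup>+\<^sup>1 (I\<^sup>n K) \<subseteq> I\<^sup>n\<^sup>+\<^sup>m\<^sup>+\<^sup>2 N\<close>, which is one power more than required.\<close>

lemma ratliff_rush_reduction_trans:
  assumes I: "ideal I R" and P: "finite P" "K = submod_gen R M P"
    and NK: "ratliff_rush_reduction R M I N K" and KL: "ratliff_rush_reduction R M I K L"
  shows "ratliff_rush_reduction R M I N L"
proof -
  note r = ratliff_rush_reductionD[OF NK] and s = ratliff_rush_reductionD[OF KL]
  note Nc = submoduleE(1)[OF r(1)] and Kc = submoduleE(1)[OF r(2)]
  note Ii = ideal_pow_ideal[OF I] and Ic = ideal_pow_carrier[OF I, THEN subsetD]
  obtain n where n: "ideal_smult R M (ideal_pow R I n) K \<subseteq> ideal_smult R M (ideal_pow R I (Suc n)) N"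
    using ratliff_rush_uniform_exponent[OF I r(1) P r(4)] by blast
  show ?thesis
  proof (rule ratliff_rush_reductionI)
    show "L \<subseteq> ratliff_rush R M I N"
    proof
      fix x assume "x \<in> L"
      then obtain m where x: "x \<in> carrier M"
        and m: "\<forall>a\<in>ideal_pow R I m. a \<odot>\<^bsub>M\<^esub> x \<in> ideal_smult R M (ideal_pow R I (Suc m)) K"
        by (elim ratliff_rushE[OF subsetD[OF s(4)]])
      let ?T = "ideal_smult R M (ideal_pow R I (Suc (n + m))) N"
      have T: "submodule ?T R M" by (rule ideal_pow_smult_submodule[OF I r(1)])
      have "ideal_smult R M (ideal_pow R I n) (ideal_smult R M (ideal_pow R I (Suc m)) K)
          = ideal_smult R M (ideal_pow R I (Suc m)) (ideal_smult R M (ideal_pow R I n) K)"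
        by (rule ideal_smult_swap[OF Ii Ii Kc])
      also have "\<dots> \<subseteq> ideal_smult R M (ideal_pow R I (Suc m)) (ideal_smult R M (ideal_pow R I (Suc n)) N)"
        by (rule ideal_smult_mono[OF order_refl n])
      also have "\<dots> = ideal_smult R M (ideal_pow R I (Suc (Suc (n + m)))) N"
        using ideal_smult_prod[OF Ii Ii Nc, of "Suc m" "Suc n"] ideal_pow_add[OF I, of "Suc m" "Suc n"]
        by (simp add: add.commute)
      also have "\<dots> \<subseteq> ?T"
        unfolding ideal_pow_Suc[of I "Suc (n + m)"]
        using ideal_prod_inter[OF Ii I] by (intro ideal_smult_mono) auto
      finally have sub: "ideal_smult R M (ideal_pow R I n) (ideal_smult R M (ideal_pow R I (Suc m)) K) \<subseteq> ?T" .
      have "ideal_pow R I (n + m) \<subseteq> {a \<in> carrier R. \<forall>y\<in>{x}. a \<odot>\<^bsub>M\<^esub> y \<in> ?T}"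
        unfolding ideal_pow_add[OF I]
      proof (rule ideal_prod_least[OF ideal_colon[OF T]])
        fix a b assume ab: "a \<in> ideal_pow R I n" "b \<in> ideal_pow R I m"
        have "a \<odot>\<^bsub>M\<^esub> (b \<odot>\<^bsub>M\<^esub> x) \<in> ?T"
          using sub ideal_smult_memI[OF ab(1) bspec[OF m ab(2)]] by blast
        then show "a \<otimes> b \<in> {a \<in> carrier R. \<forall>y\<in>{x}. a \<odot>\<^bsub>M\<^esub> y \<in> ?T}"
          using x Ic ab by (simp add: smult_assoc1)
      qed (use x in simp)
      then show "x \<in> ratliff_rush R M I N" using x unfolding ratliff_rush_iff by blast
    qed
  qed (use r s in auto)
qed

end

section \<open>Powers of ideals in Noetherian rings\<close>

lemma (in noetherian_ring) proper_ideal_in_maximal: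
  assumes A: "ideal A R" "A \<noteq> carrier R"
  obtains \<nn> where "maximalideal \<nn> R" "A \<subseteq> \<nn>"
proof -
  let ?F = "{J. ideal J R \<and> A \<subseteq> J \<and> J \<noteq> carrier R}"
  have "\<exists>M\<in>?F. \<forall>J\<in>?F. M \<subseteq> J \<longrightarrow> J = M"
  proof (rule subset_Zorn_nonempty)
    show "?F \<noteq> {}" using A by blast
    fix C assume C: "C \<noteq> {}" "subset.chain ?F C"
    have F: "C \<subseteq> ?F" using C(2) unfolding subset_chain_def by (rule conjunct1)
    then have "subset.chain {I. ideal I R} C" using C(2) unfolding subset_chain_def by auto
    then have "\<Union>C \<in> C" by (rule ideal_chain_is_trivial[OF C(1)])
    then show "\<Union>C \<in> ?F" by (rule subsetD[OF F])
  qed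
  then obtain \<nn> where n: "\<nn> \<in> ?F" "\<forall>J\<in>?F. \<nn> \<subseteq> J \<longrightarrow> J = \<nn>" ..
  have "maximalideal \<nn> R"
  proof (rule maximalidealI)
    fix J assume J: "ideal J R" "\<nn> \<subseteq> J" "J \<subseteq> carrier R"
    show "J = \<nn> \<or> J = carrier R"
    proof (rule disjCI)
      assume "J \<noteq> carrier R"
      then have "J \<in> ?F" using J(1,2) n(1) by auto
      then show "J = \<nn>" using n(2) J(2) by simp
    qed
  qed (use n(1) in auto)
  then show thesis using that n(1) by blast
qed

context cring
begin

lemma ideal_subset_carrier: "ideal A R \<Longrightarrow> A \<subseteq> carrier R"
  by (rule subsetI) (rule ideal.Icarr)

lemma ideal_prod_mono: "A \<subseteq> A' \<Longrightarrow> B \<subseteq> B' \<Longrightarrow> A \<cdot> B \<subseteq> A' \<cdot> B'"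
proof
  fix s assume AB: "A \<subseteq> A'" "B \<subseteq> B'" and "s \<in> A \<cdot> B"
  from this(3) show "s \<in> A' \<cdot> B'"
    by induction (use AB in \<open>auto intro: ideal_prod.intros\<close>)
qed

lemma ideal_pow_0: "ideal_pow R A 0 = carrier R"
  by (simp add: ideal_pow_def nat_pow_def ideals_set_def)

lemma ideal_pow_mono: "A \<subseteq> B \<Longrightarrow> ideal_pow R A n \<subseteq> ideal_pow R B n"
  by (induction n) (simp_all add: ideal_pow_0 ideal_pow_Suc ideal_prod_mono)

lemma ideal_pow_mult:
  assumes "ideal A R"
  shows "ideal_pow R A (m * n) = ideal_pow R (ideal_pow R A m) n"
proof -
  interpret S: comm_monoid "ideals_set R" by (rule ideals_set_is_comm_monoid)
  show ?thesis
    using S.nat_pow_pow[of A m n] assms by (simp add: ideal_pow_def ideals_set_def)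
qed

text \<open>In the expansion of a product of \<open>n\<close> factors \<open>a + b\<close>, every term other than the product of
  the \<open>b\<close>'s contains a factor from \<open>A\<close>.\<close>

lemma ideal_pow_sum:
  assumes A: "ideal A R" and B: "ideal B R"
  shows "ideal_pow R (A <+>\<^bsub>R\<^esub> B) n \<subseteq> A <+>\<^bsub>R\<^esub> ideal_pow R B n"
proof (induction n)
  case 0
  have "\<zero> \<in> A" using A by (simp add: additive_subgroup.zero_closed ideal.axioms(1))
  then have "x \<in> A <+>\<^bsub>R\<^esub> carrier R" if "x \<in> carrier R" for x
    using that by (force simp: set_add_def')
  then show ?case by (auto simp: ideal_pow_0)
next
  case (Suc n)
  note Bn = ideal_pow_ideal[OF B]
  have c: "A \<subseteq> carrier R" "B \<subseteq> carrier R" "\<And>k. ideal_pow R B k \<subseteq> carrier R"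
    using A B Bn ideal_subset_carrier by auto
  have "ideal_pow R (A <+>\<^bsub>R\<^esub> B) n \<cdot> (A <+>\<^bsub>R\<^esub> B) \<subseteq> A <+>\<^bsub>R\<^esub> ideal_pow R B (Suc n)"
  proof (rule ideal_prod_least)
    show "ideal (A <+>\<^bsub>R\<^esub> ideal_pow R B (Suc n)) R" by (rule add_ideals[OF A Bn])
    fix i j assume "i \<in> ideal_pow R (A <+>\<^bsub>R\<^esub> B) n" "j \<in> A <+>\<^bsub>R\<^esub> B"
    then obtain a b a' b' where ab: "a \<in> A" "b \<in> ideal_pow R B n" "a' \<in> A" "b' \<in> B"
      "i = a \<oplus> b" "j = a' \<oplus> b'"
      using Suc.IH by (auto simp: set_add_def' subset_iff)
    have cc: "a \<in> carrier R" "b \<in> carrier R" "a' \<in> carrier R" "b' \<in> carrier R"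
      using ab(1-4) c by auto
    have "i \<otimes> j = (a \<otimes> (a' \<oplus> b') \<oplus> b \<otimes> a') \<oplus> b \<otimes> b'"
      unfolding ab(5,6) using cc by (simp add: l_distr r_distr a_ac)
    moreover have "a \<otimes> (a' \<oplus> b') \<in> A" "b \<otimes> a' \<in> A"
      using cc ab ideal.I_l_closed[OF A] ideal.I_r_closed[OF A] by auto
    then have "a \<otimes> (a' \<oplus> b') \<oplus> b \<otimes> a' \<in> A"
      using A by (simp add: additive_subgroup.a_closed ideal.axioms(1))
    moreover have "b \<otimes> b' \<in> ideal_pow R B (Suc n)"
      using ab by (simp add: ideal_pow_Suc ideal_prod.prod)
    ultimately show "i \<otimes> j \<in> A <+>\<^bsub>R\<^esub> ideal_pow R B (Suc n)"
      by (auto simp: set_add_def')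
  qed
  then show ?case by (simp add: ideal_pow_Suc)
qed

lemma ideal_pow_cgenideal:
  assumes "x \<in> carrier R"
  shows "ideal_pow R (PIdl x) n \<subseteq> PIdl (x [^] n)"
proof (induction n)
  case 0
  then show ?case using assms by (force simp: ideal_pow_0 cgenideal_def)
next
  case (Suc n)
  have "ideal_pow R (PIdl x) n \<cdot> (PIdl x) \<subseteq> PIdl (x [^] Suc n)"
  proof (rule ideal_prod_least)
    show "ideal (PIdl (x [^] Suc n)) R" using assms by (intro cgenideal_ideal) auto
    fix i j assume "i \<in> ideal_pow R (PIdl x) n" "j \<in> PIdl x"
    then obtain a b where ab: "a \<in> carrier R" "b \<in> carrier R" "i = a \<otimes> x [^] n" "j = b \<otimes> x"
      using Suc.IH by (auto simp: cgenideal_def)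
    then have "i \<otimes> j = (a \<otimes> b) \<otimes> x [^] Suc n"
      using assms by (simp add: m_ac)
    then show "i \<otimes> j \<in> PIdl (x [^] Suc n)"
      using ab(1,2) by (auto simp: cgenideal_def)
  qed
  then show ?case by (simp add: ideal_pow_Suc)
qed

lemma ideal_sum_least:
  assumes "ideal J R" "A \<subseteq> J" "B \<subseteq> J"
  shows "A <+>\<^bsub>R\<^esub> B \<subseteq> J"
  using assms(2,3) additive_subgroup.a_closed[OF ideal.axioms(1)[OF assms(1)]]
  by (auto simp: set_add_def' subset_iff)

text \<open>A finitely generated ideal inside the radical of \<open>J\<close> has a power inside \<open>J\<close>. A new generator
  \<open>x\<close> with \<open>x\<^sup>l \<in> J\<close> is absorbed first, \<open>(A + (x))\<^sup>l \<subseteq> A + J\<close>, and the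
  \<open>k\<close>-th power of \<open>J + A\<close> lies in \<open>J + A\<^sup>k \<subseteq> J\<close>.\<close>

lemma nilpotent_gens_imp_nilpotent:
  assumes "finite S" "S \<subseteq> carrier R" and J: "ideal J R"
    and "\<And>x. x \<in> S \<Longrightarrow> \<exists>k::nat. x [^] k \<in> J"
  shows "\<exists>k. ideal_pow R (Idl S) k \<subseteq> J"
  using assms(1,2,4)
proof (induction S rule: finite_induct)
  case empty
  have "ideal_pow R (Idl {}) (Suc 0) \<subseteq> Idl {}"
    using ideal_prod_inter[OF ideal_pow_ideal genideal_ideal, of "Idl {}" "{}" 0]
      genideal_ideal[of "{}"] by (auto simp: ideal_pow_Suc)
  also have "\<dots> \<subseteq> J" by (rule genideal_minimal[OF J]) simp
  finally show ?case by blast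
next
  case (insert x S)
  obtain k where k: "ideal_pow R (Idl S) k \<subseteq> J" using insert by auto
  obtain l :: nat where l: "x [^] l \<in> J" using insert.prems(2) by auto
  have x: "x \<in> carrier R" and S: "S \<subseteq> carrier R" using insert.prems(1) by auto
  let ?A = "Idl S" and ?B = "PIdl x" and ?T = "Idl (insert x S)"
  have A: "ideal ?A R" and B: "ideal ?B R" and T: "ideal ?T R"
    using x S by (auto intro: genideal_ideal cgenideal_ideal)
  have z: "\<zero> \<in> ?A" "\<zero> \<in> ?B"
    using A B by (auto intro: additive_subgroup.zero_closed ideal.axioms(1))
  have "insert x S \<subseteq> ?A <+>\<^bsub>R\<^esub> ?B"
  proof
    fix y assume y: "y \<in> insert x S"
    then have "y = y \<oplus> \<zero>" "y = \<zero> \<oplus> y" using x S by auto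
    then show "y \<in> ?A <+>\<^bsub>R\<^esub> ?B"
      using y z genideal_self[OF S] cgenideal_self[OF x] unfolding set_add_def' by blast
  qed
  then have "?T \<subseteq> ?A <+>\<^bsub>R\<^esub> ?B" by (rule genideal_minimal[OF add_ideals[OF A B]])
  then have "ideal_pow R ?T l \<subseteq> ideal_pow R (?A <+>\<^bsub>R\<^esub> ?B) l" by (rule ideal_pow_mono)
  also have "\<dots> \<subseteq> ?A <+>\<^bsub>R\<^esub> ideal_pow R ?B l" by (rule ideal_pow_sum[OF A B])
  also have "\<dots> \<subseteq> ?A <+>\<^bsub>R\<^esub> J"
    using ideal_pow_cgenideal[OF x, of l] cgenideal_minimal[OF J l] by (auto simp: set_add_def')
  also have "\<dots> = J <+>\<^bsub>R\<^esub> ?A"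
    using ideal_subset_carrier[OF A] ideal_subset_carrier[OF J] by (rule set_add_comm)
  finally have "ideal_pow R (ideal_pow R ?T l) k \<subseteq> ideal_pow R (J <+>\<^bsub>R\<^esub> ?A) k"
    by (rule ideal_pow_mono)
  also have "\<dots> \<subseteq> J <+>\<^bsub>R\<^esub> ideal_pow R ?A k" by (rule ideal_pow_sum[OF J A])
  also have "\<dots> \<subseteq> J" by (rule ideal_sum_least[OF J order_refl k])
  finally show ?case using ideal_pow_mult[OF T] by metis
qed

end

section \<open>Noetherian modules\<close>

lemma (in module) ideal_smult_elem_submodule:
  assumes A: "ideal A R" and x: "x \<in> carrier M"
  shows "submodule ((\<lambda>a. a \<odot>\<^bsub>M\<^esub> x) ` A) R M" (is "submodule ?H R M")
proof (rule submodule_by_closure)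
  note Ac = ideal.Icarr[OF A]
  interpret A: ideal A R by (rule A)
  show "?H \<subseteq> carrier M" using Ac x by auto
  show "\<zero>\<^bsub>M\<^esub> \<in> ?H" using x A.zero_closed smult_l_null[OF x] by (metis image_eqI)
  show "y \<oplus>\<^bsub>M\<^esub> z \<in> ?H" if "y \<in> ?H" "z \<in> ?H" for y z
    using that x Ac A.a_closed by (auto simp: smult_l_distr[symmetric])
  show "b \<odot>\<^bsub>M\<^esub> y \<in> ?H" if "b \<in> carrier R" "y \<in> ?H" for b y
    using that x Ac A.I_l_closed by (auto simp: smult_assoc1[symmetric])
qed

locale noetherian_module = module +
  assumes submodule_fin_gen: "submodule H R M \<Longrightarrow> \<exists>P. finite P \<and> H = submod_gen R M P"
begin

text \<open>The union of a chain of submodules is generated by finitely many elements, which already lie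
  in one member of the chain. So the union belongs to the chain, and Zorn's lemma applies.\<close>

lemma exists_maximal_submodule:
  assumes F: "F \<noteq> {}" "\<And>H. H \<in> F \<Longrightarrow> submodule H R M"
  shows "\<exists>C\<in>F. \<forall>H\<in>F. C \<subseteq> H \<longrightarrow> H = C"
proof (rule subset_Zorn_nonempty[OF F(1)])
  fix \<C> assume C: "\<C> \<noteq> {}" "subset.chain F \<C>"
  have sub: "submodule H R M" if "H \<in> \<C>" for H
    using that C F(2) by (auto simp: subset_chain_def)
  obtain H0 where H0: "H0 \<in> \<C>" using C(1) by blast
  have U: "submodule (\<Union>\<C>) R M"
  proof (rule submodule_by_closure)
    fix x y assume "x \<in> \<Union>\<C>" "y \<in> \<Union>\<C>"
    then obtain A B where AB: "A \<in> \<C>" "B \<in> \<C>" "x \<in> A" "y \<in> B" by blast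
    then consider "A \<subseteq> B" | "B \<subseteq> A" using C(2) by (auto simp: subset_chain_def)
    then show "x \<oplus>\<^bsub>M\<^esub> y \<in> \<Union>\<C>"
    proof cases
      case 1
      then show ?thesis using AB submoduleE(5)[OF sub[OF AB(2)], of x y] by blast
    next
      case 2
      then show ?thesis using AB submoduleE(5)[OF sub[OF AB(1)], of x y] by blast
    qed
  next
    show "\<Union>\<C> \<subseteq> carrier M" using submoduleE(1)[OF sub] by blast
    show "\<zero>\<^bsub>M\<^esub> \<in> \<Union>\<C>" using submodule_zero[OF sub[OF H0]] H0 by blast
    fix x assume "x \<in> \<Union>\<C>"
    then obtain A where A: "A \<in> \<C>" "x \<in> A" by blast
    show "a \<odot>\<^bsub>M\<^esub> x \<in> \<Union>\<C>" if "a \<in> carrier R" for a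
      using submoduleE(4)[OF sub[OF A(1)] that A(2)] A(1) by blast
  qed
  obtain P where P: "finite P" "\<Union>\<C> = submod_gen R M P" using submodule_fin_gen[OF U] by blast
  have "P \<subseteq> \<Union>\<C>" unfolding P(2) by (rule submod_gen_incl)
  then obtain Y where Y: "Y \<in> \<C>" "P \<subseteq> Y"
    using finite_subset_Union_chain[OF P(1) _ C] by blast
  then have "\<Union>\<C> = Y" using P(2) submod_gen_least[OF sub[OF Y(1)] Y(2)] by blast
  then show "\<Union>\<C> \<in> F" using Y(1) C(2) by (auto simp: subset_chain_def)
qed

end

text \<open>The coefficients of \<open>x\<close> that occur in elements of \<open>G\<close> modulo \<open>A\<close> form an ideal, with
  finitely many generators. Lifting these generators to elements of \<open>G\<close> and adding generators of
  \<open>G \<inter> A\<close> gives generators of \<open>G\<close>.\<close>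

lemma (in module) submodule_fin_gen_extend:
  assumes R: "noetherian_ring R" and A: "submodule A R M" and x: "x \<in> carrier M"
    and fg: "\<And>H. submodule H R M \<Longrightarrow> H \<subseteq> A \<Longrightarrow> \<exists>P. finite P \<and> H = submod_gen R M P"
    and G: "submodule G R M" "G \<subseteq> A <+>\<^bsub>M\<^esub> (\<lambda>r. r \<odot>\<^bsub>M\<^esub> x) ` carrier R"
  shows "\<exists>P. finite P \<and> G = submod_gen R M P"
proof -
  interpret N: noetherian_ring R by (rule R)
  note Ac = submoduleE(1)[OF A, THEN subsetD] and Gc = submoduleE(1)[OF G(1), THEN subsetD]
  \<comment> \<open>the ideal of those \<open>r\<close> for which \<open>r x\<close> lies in \<open>G + A\<close>\<close>
  let ?J = "\<lambda>G. {r \<in> carrier R. \<forall>y\<in>{x}. r \<odot>\<^bsub>M\<^esub> y \<in> G <+>\<^bsub>M\<^esub> A}"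
  have J: "ideal (?J H) R" if "submodule H R M" for H
    using x by (intro ideal_colon submodule_sum that A) auto
  have "submodule (G \<inter> A) R M"
    using G(1) A by (intro submodule_by_closure) (auto simp: submoduleE(4,5) submodule_zero Gc)
  then obtain Q where Q: "finite Q" "G \<inter> A = submod_gen R M Q" using fg[of "G \<inter> A"] by auto
  obtain C where C: "C \<subseteq> carrier R" "finite C" "?J G = Idl C"
    using N.finetely_gen[OF J[OF G(1)]] by blast
  have "\<exists>g\<in>G. \<exists>a\<in>A. r \<odot>\<^bsub>M\<^esub> x = g \<oplus>\<^bsub>M\<^esub> a" if "r \<in> C" for r
  proof -
    have "r \<in> ?J G" using C genideal_self that by blast
    then show ?thesis by (auto simp: set_add_mem)
  qed
  then have "\<forall>r\<in>C. \<exists>g. g \<in> G \<and> (\<exists>a\<in>A. r \<odot>\<^bsub>M\<^esub> x = g \<oplus>\<^bsub>M\<^esub> a)" by blast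
  from bchoice[OF this] obtain g
    where g: "\<And>r. r \<in> C \<Longrightarrow> g r \<in> G" "\<And>r. r \<in> C \<Longrightarrow> \<exists>a\<in>A. r \<odot>\<^bsub>M\<^esub> x = g r \<oplus>\<^bsub>M\<^esub> a"
    by blast
  let ?G' = "submod_gen R M (Q \<union> g ` C)"
  have QG: "Q \<subseteq> G \<inter> A" unfolding Q(2) by (rule submod_gen_incl)
  have sub: "Q \<union> g ` C \<subseteq> G" using QG g(1) by blast
  have G': "submodule ?G' R M" using sub Gc by (intro submod_gen_submodule) blast
  have G'G: "?G' \<subseteq> G" by (rule submod_gen_least[OF G(1) sub])
  have "C \<subseteq> ?J ?G'"
  proof
    fix r assume r: "r \<in> C"
    have "g r \<in> ?G'" using r by (intro subsetD[OF submod_gen_incl]) blast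
    then show "r \<in> ?J ?G'" using r C(1) g(2)[OF r] by (auto simp: set_add_mem)
  qed
  then have JJ: "?J G \<subseteq> ?J ?G'"
    unfolding C(3) by (rule genideal_minimal[OF J[OF G']])
  have "G \<subseteq> ?G'"
  proof
    fix y assume y: "y \<in> G"
    then obtain a r where ar: "a \<in> A" "r \<in> carrier R" "y = a \<oplus>\<^bsub>M\<^esub> r \<odot>\<^bsub>M\<^esub> x"
      using G(2) by (force simp: set_add_mem)
    have "r \<odot>\<^bsub>M\<^esub> x = y \<oplus>\<^bsub>M\<^esub> \<ominus>\<^bsub>M\<^esub> a"
      unfolding ar(3) using x ar(2) Ac[OF ar(1)] by (simp add: M.a_ac M.r_neg1 M.r_neg2)
    then have "r \<in> ?J G" using ar(2) y submoduleE(3)[OF A ar(1)] by (auto simp: set_add_mem)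
    then have "r \<in> ?J ?G'" using JJ by blast
    then obtain g' a' where g': "g' \<in> ?G'" "a' \<in> A" "r \<odot>\<^bsub>M\<^esub> x = g' \<oplus>\<^bsub>M\<^esub> a'"
      by (auto simp: set_add_mem)
    have g'G: "g' \<in> G" using g'(1) G'G by blast
    have cc: "a \<in> carrier M" "a' \<in> carrier M" "g' \<in> carrier M"
      using Ac ar(1) g'(2) Gc[OF g'G] by auto
    have y': "y = g' \<oplus>\<^bsub>M\<^esub> (a \<oplus>\<^bsub>M\<^esub> a')" unfolding ar(3) g'(3) using cc by (simp add: M.a_ac)
    then have "y \<ominus>\<^bsub>M\<^esub> g' = a \<oplus>\<^bsub>M\<^esub> a'"
      using cc by (simp add: M.minus_eq M.a_ac M.r_neg M.r_neg1 M.r_neg2)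
    then have "a \<oplus>\<^bsub>M\<^esub> a' \<in> G" using submodule_minus[OF G(1) y g'G] by simp
    then have "a \<oplus>\<^bsub>M\<^esub> a' \<in> G \<inter> A" using submoduleE(5)[OF A ar(1) g'(2)] by (rule IntI)
    moreover have "G \<inter> A \<subseteq> ?G'"
      unfolding Q(2) by (rule submod_gen_least[OF G']) (rule subset_trans[OF Un_upper1 submod_gen_incl])
    ultimately have "a \<oplus>\<^bsub>M\<^esub> a' \<in> ?G'" by (rule subsetD[rotated])
    then show "y \<in> ?G'" unfolding y' by (rule submoduleE(5)[OF G' g'(1)])
  qed
  then have "G = ?G'" using G'G by (rule equalityI)
  then show ?thesis
    by (intro exI[of _ "Q \<union> g ` C"] conjI finite_UnI finite_imageI Q(1) C(2))
qed

text \<open>Induction on the number of generators of the module, one cyclic summand at a time.\<close>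

lemma (in module) noetherian_moduleI:
  assumes R: "noetherian_ring R" and fg: "fin_gen_module R M"
  shows "noetherian_module R M"
proof -
  obtain P where P: "finite P" "P \<subseteq> carrier M" "submod_gen R M P = carrier M"
    using fg by (auto simp: fin_gen_module_def)
  have "\<exists>Q. finite Q \<and> H = submod_gen R M Q"
    if "submodule H R M" "H \<subseteq> submod_gen R M P" for H
    using P(1,2) that
  proof (induction P arbitrary: H rule: finite_induct)
    case empty
    have "submod_gen R M {} \<subseteq> H" by (rule submod_gen_least[OF empty(2)]) simp
    then have "H = submod_gen R M {}" using empty(3) by blast
    then show ?case by blast
  next
    case (insert x P)
    have x: "x \<in> carrier M" and P: "P \<subseteq> carrier M" using insert.prems(1) by auto
    let ?A = "submod_gen R M P" and ?x = "(\<lambda>r. r \<odot>\<^bsub>M\<^esub> x) ` carrier R"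
    have A: "submodule ?A R M" by (rule submod_gen_submodule[OF P])
    have B: "submodule ?x R M" by (rule ideal_smult_elem_submodule[OF R.oneideal x])
    have "x \<in> ?x" using smult_one[OF x] by (metis R.one_closed image_eqI)
    then have "submod_gen R M (insert x P) \<subseteq> ?A <+>\<^bsub>M\<^esub> ?x"
      using submodule_sum_upper[OF A B] submod_gen_incl[of P]
      by (intro submod_gen_least submodule_sum A B) blast
    then have "H \<subseteq> ?A <+>\<^bsub>M\<^esub> ?x" using insert.prems(3) by (rule subset_trans[rotated])
    then show ?case
      using submodule_fin_gen_extend[OF R A x _ insert.prems(2)] insert.IH[OF P] by blast
  qed
  then show ?thesis
    using P(3) submoduleE(1) by unfold_locales auto
qed

section \<open>Nakayama's lemma and Krull's intersection theorem\<close>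

locale noetherian_local_module = noetherian_module +
  fixes \<mm>
  assumes noetherian: "noetherian_ring R" and local: "local_ring R \<mm>"
begin

lemma \<mm>_ideal: "ideal \<mm> R"
  using local by (auto simp: local_ring_def intro: maximalideal.axioms(1))

lemma \<mm>_carrier: "\<mm> \<subseteq> carrier R"
  by (rule ideal_subset_carrier[OF \<mm>_ideal])

lemma one_notin_\<mm>: "\<one> \<notin> \<mm>"
  using local maximalideal.I_notcarr[of \<mm> R] ideal.one_imp_carrier[OF \<mm>_ideal]
  by (auto simp: local_ring_def)

lemma proper_ideal_subset:
  assumes "ideal A R" "\<one> \<notin> A"
  shows "A \<subseteq> \<mm>"
proof -
  have "A \<noteq> carrier R" using assms(2) by auto
  then obtain \<nn> where "maximalideal \<nn> R" "A \<subseteq> \<nn>"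
    using noetherian_ring.proper_ideal_in_maximal[OF noetherian assms(1)] by metis
  then show ?thesis using local by (auto simp: local_ring_def)
qed

text \<open>Otherwise there is a maximal submodule \<open>C\<close> with \<open>H \<subseteq> C \<subset> D\<close>, and \<open>D = C + R x\<close> for any
  \<open>x \<in> D - C\<close>. Then \<open>x \<in> \<mm> D + H \<subseteq> \<mm> x + C\<close>, that is, \<open>(1 - a) x \<in> C\<close> with
  \<open>a \<in> \<mm>\<close>. As \<open>1 - a\<close> is not in \<open>\<mm>\<close>, the colon \<open>C : x\<close> is not contained in \<open>\<mm>\<close>,
  although it is a proper ideal.\<close>

lemma nakayama:
  assumes D: "submodule D R M" and H: "submodule H R M" and HD: "H \<subseteq> D"
    and le: "D \<subseteq> ideal_smult R M \<mm> D <+>\<^bsub>M\<^esub> H"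
  shows "D = H"
proof (rule ccontr)
  assume "D \<noteq> H"
  let ?F = "{C. submodule C R M \<and> H \<subseteq> C \<and> C \<subseteq> D \<and> C \<noteq> D}"
  have "?F \<noteq> {}" using \<open>D \<noteq> H\<close> HD H by auto
  then have "\<exists>C\<in>?F. \<forall>H\<in>?F. C \<subseteq> H \<longrightarrow> H = C"
    by (rule exists_maximal_submodule) simp
  then obtain C where C: "C \<in> ?F" and max: "\<forall>H\<in>?F. C \<subseteq> H \<longrightarrow> H = C" ..
  have Cs: "submodule C R M" and HC: "H \<subseteq> C" and CD: "C \<subseteq> D" "C \<noteq> D" using C by auto
  obtain x where x: "x \<in> D" "x \<notin> C" using CD by auto
  have xM: "x \<in> carrier M" using submoduleE(1)[OF D] x(1) by auto
  note Cc = submoduleE(1)[OF Cs, THEN subsetD]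
  let ?x = "(\<lambda>r. r \<odot>\<^bsub>M\<^esub> x) ` carrier R" and ?mx = "(\<lambda>r. r \<odot>\<^bsub>M\<^esub> x) ` \<mm>"
  have xs: "submodule ?x R M" "submodule ?mx R M"
    using ideal_smult_elem_submodule[OF _ xM] R.oneideal \<mm>_ideal by auto
  have Cx: "submodule (C <+>\<^bsub>M\<^esub> ?x) R M" by (rule submodule_sum[OF Cs xs(1)])
  have "x \<in> ?x" using smult_one[OF xM] by (metis R.one_closed image_eqI)
  then have xCx: "x \<in> C <+>\<^bsub>M\<^esub> ?x" using submodule_sum_upper(2)[OF Cs xs(1)] by auto
  have "?x \<subseteq> D" using submoduleE(4)[OF D _ x(1)] by auto
  then have "C <+>\<^bsub>M\<^esub> ?x \<subseteq> D" by (rule submodule_sum_least[OF D CD(1)])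
  then have DCx: "D = C <+>\<^bsub>M\<^esub> ?x"
    using max Cx submodule_sum_upper(1)[OF Cs xs(1)] HC x(2) xCx by auto
  \<comment> \<open>modulo \<open>C\<close>, multiplication by \<open>\<mm>\<close> takes \<open>D\<close> into \<open>\<mm> x\<close>\<close>
  let ?W = "C <+>\<^bsub>M\<^esub> ?mx"
  have W: "submodule ?W R M" by (rule submodule_sum[OF Cs xs(2)])
  have "ideal_smult R M \<mm> D \<subseteq> ?W"
  proof (rule ideal_smult_least[OF W])
    fix a d assume a: "a \<in> \<mm>" and "d \<in> D"
    then obtain c r where d: "c \<in> C" "r \<in> carrier R" "d = c \<oplus>\<^bsub>M\<^esub> r \<odot>\<^bsub>M\<^esub> x"
      unfolding DCx by (auto simp: set_add_mem)
    have aR: "a \<in> carrier R" using a \<mm>_carrier by auto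
    have "a \<odot>\<^bsub>M\<^esub> d = a \<odot>\<^bsub>M\<^esub> c \<oplus>\<^bsub>M\<^esub> (a \<otimes> r) \<odot>\<^bsub>M\<^esub> x"
      unfolding d(3) using aR d(2) Cc[OF d(1)] xM by (simp add: smult_r_distr smult_assoc1)
    moreover have "a \<odot>\<^bsub>M\<^esub> c \<in> C" by (rule submoduleE(4)[OF Cs aR d(1)])
    moreover have "a \<otimes> r \<in> \<mm>" by (rule ideal.I_r_closed[OF \<mm>_ideal a d(2)])
    ultimately show "a \<odot>\<^bsub>M\<^esub> d \<in> ?W" by (auto simp: set_add_mem)
  qed
  moreover have "H \<subseteq> ?W" using HC submodule_sum_upper(1)[OF Cs xs(2)] by (rule subset_trans)
  ultimately have "D \<subseteq> ?W" using le submodule_sum_least[OF W] by (meson subset_trans)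
  then obtain c a where ca: "c \<in> C" "a \<in> \<mm>" "x = c \<oplus>\<^bsub>M\<^esub> a \<odot>\<^bsub>M\<^esub> x"
    using x(1) by (force simp: set_add_mem)
  have aR: "a \<in> carrier R" using ca(2) \<mm>_carrier by auto
  have "(\<one> \<ominus> a) \<odot>\<^bsub>M\<^esub> x = x \<ominus>\<^bsub>M\<^esub> a \<odot>\<^bsub>M\<^esub> x"
    using xM aR by (simp add: R.minus_eq M.minus_eq smult_l_distr smult_l_minus)
  also have "\<dots> = (c \<oplus>\<^bsub>M\<^esub> a \<odot>\<^bsub>M\<^esub> x) \<ominus>\<^bsub>M\<^esub> a \<odot>\<^bsub>M\<^esub> x" by (simp only: ca(3)[symmetric])
  also have "\<dots> = c" using xM aR Cc[OF ca(1)] by (simp add: M.minus_eq M.a_assoc M.r_neg)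
  finally have "(\<one> \<ominus> a) \<odot>\<^bsub>M\<^esub> x \<in> C" using ca(1) by simp
  \<comment> \<open>the colon \<open>C : x\<close> contains \<open>1 - a\<close> but not \<open>1\<close>\<close>
  let ?A = "{r \<in> carrier R. \<forall>y\<in>{x}. r \<odot>\<^bsub>M\<^esub> y \<in> C}"
  have "ideal ?A R" using xM by (intro ideal_colon[OF Cs]) auto
  moreover have "\<one> \<notin> ?A" using x(2) xM by simp
  ultimately have "?A \<subseteq> \<mm>" by (rule proper_ideal_subset)
  then have "\<one> \<ominus> a \<in> \<mm>" using \<open>(\<one> \<ominus> a) \<odot>\<^bsub>M\<^esub> x \<in> C\<close> aR by auto
  then have "(\<one> \<ominus> a) \<oplus> a \<in> \<mm>"
    by (rule additive_subgroup.a_closed[OF ideal.axioms(1)[OF \<mm>_ideal] _ ca(2)])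
  then show False using one_notin_\<mm> aR by (simp add: R.minus_eq R.a_assoc R.l_neg)
qed

text \<open>Let \<open>D\<close> be the intersection and \<open>G = \<mm> D + H\<close>. Choose \<open>C\<close> maximal with \<open>C \<inter> D = G\<close>.
  For \<open>x \<in> \<mm>\<close> the colons \<open>C : x\<^sup>n\<close> stabilize at some \<open>n\<close>, and then also
  \<open>(C + x\<^sup>n M) \<inter> D = G\<close>, so \<open>x\<^sup>n M \<subseteq> C\<close> by maximality. As \<open>\<mm>\<close> is finitely generated,
  \<open>\<mm>\<^sup>k M \<subseteq> C\<close> for some \<open>k\<close>. Hence \<open>D \<subseteq> \<mm>\<^sup>k M + H \<subseteq> C\<close>, which means \<open>D = G\<close>, and
  Nakayama's lemma yields \<open>D = H\<close>.\<close>

lemma krull_intersection: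
  assumes H: "submodule H R M"
  shows "(\<Inter>k. H <+>\<^bsub>M\<^esub> ideal_smult R M (ideal_pow R \<mm> k) (carrier M)) = H" (is "?D = H")
proof -
  have S: "submodule (ideal_smult R M (ideal_pow R \<mm> k) (carrier M)) R M" for k
    by (rule ideal_pow_smult_submodule[OF \<mm>_ideal carrier_is_submodule])
  have T: "submodule (H <+>\<^bsub>M\<^esub> ideal_smult R M (ideal_pow R \<mm> k) (carrier M)) R M" for k
    by (rule submodule_sum[OF H S])
  have D: "submodule ?D R M"
    by (rule submoduleI) (use submoduleE(1)[OF T[of 0]] submodule_zero[OF T] submoduleE(3-5)[OF T] in auto)
  have HD: "H \<subseteq> ?D" using submodule_sum_upper(1)[OF H S] by auto
  note Dc = submoduleE(1)[OF D, THEN subsetD]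
  define G where "G = ideal_smult R M \<mm> ?D <+>\<^bsub>M\<^esub> H"
  have mD: "submodule (ideal_smult R M \<mm> ?D) R M"
    by (rule ideal_smult_submodule[OF \<mm>_carrier submoduleE(1)[OF D]])
  have G: "submodule G R M" unfolding G_def by (rule submodule_sum[OF mD H])
  have mG: "ideal_smult R M \<mm> ?D \<subseteq> G" and HG: "H \<subseteq> G"
    unfolding G_def using submodule_sum_upper[OF mD H] by auto
  have GD: "G \<subseteq> ?D"
    unfolding G_def by (rule submodule_sum_least[OF D ideal_smult_subset[OF D \<mm>_carrier] HD])
  let ?F = "{C. submodule C R M \<and> C \<inter> ?D = G}"
  have "G \<in> ?F" using G GD by auto
  then have "?F \<noteq> {}" by (metis empty_iff)
  then have "\<exists>C\<in>?F. \<forall>H\<in>?F. C \<subseteq> H \<longrightarrow> H = C"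
    by (rule exists_maximal_submodule) simp
  then obtain C where "C \<in> ?F" and max: "\<forall>H\<in>?F. C \<subseteq> H \<longrightarrow> H = C" ..
  then have C: "submodule C R M" and CD: "C \<inter> ?D = G" by auto
  note Cc = submoduleE(1)[OF C, THEN subsetD]
  have GC: "G \<subseteq> C" using CD by auto
  let ?J = "{a \<in> carrier R. \<forall>y\<in>carrier M. a \<odot>\<^bsub>M\<^esub> y \<in> C}"
  have J: "ideal ?J R" by (rule ideal_colon[OF C order_refl])
  have nil: "\<exists>n::nat. x [^] n \<in> ?J" if x: "x \<in> \<mm>" for x
  proof -
    have xR: "x \<in> carrier R" using x \<mm>_carrier by auto
    \<comment> \<open>the ascending chain of the colons \<open>C : x\<^sup>n\<close>\<close>
    define L where "L n = {y \<in> carrier M. \<forall>a\<in>{x [^] n}. a \<odot>\<^bsub>M\<^esub> y \<in> C}" for n :: nat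
    have L: "submodule (L n) R M" for n
      unfolding L_def using xR by (intro submodule_colon[OF C]) auto
    have "\<exists>B\<in>range L. \<forall>H\<in>range L. B \<subseteq> H \<longrightarrow> H = B"
      by (rule exists_maximal_submodule) (use L in auto)
    then obtain n where n: "\<And>m. L n \<subseteq> L m \<Longrightarrow> L m = L n" by auto
    have pow_Suc: "x [^] Suc n \<odot>\<^bsub>M\<^esub> y = x \<odot>\<^bsub>M\<^esub> (x [^] n \<odot>\<^bsub>M\<^esub> y)" if "y \<in> carrier M" for y
      using that xR by (simp add: R.m_comm smult_assoc1[symmetric])
    have "L n \<subseteq> L (Suc n)"
    proof
      fix y assume "y \<in> L n"
      then have y: "y \<in> carrier M" "x [^] n \<odot>\<^bsub>M\<^esub> y \<in> C" by (auto simp: L_def)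
      have "x [^] Suc n \<odot>\<^bsub>M\<^esub> y \<in> C"
        unfolding pow_Suc[OF y(1)] by (rule submoduleE(4)[OF C xR y(2)])
      then show "y \<in> L (Suc n)" using y(1) by (simp add: L_def)
    qed
    then have stable: "L (Suc n) = L n" by (rule n)
    let ?E = "{x [^] n \<odot>\<^bsub>M\<^esub> y | y. y \<in> carrier M}" and ?V = "C <+>\<^bsub>M\<^esub> {x [^] n \<odot>\<^bsub>M\<^esub> y | y. y \<in> carrier M}"
    have E: "submodule ?E R M"
      using xR by (intro submodule_image_smult carrier_is_submodule) auto
    have V: "submodule ?V R M" by (rule submodule_sum[OF C E])
    have CV: "C \<subseteq> ?V" by (rule submodule_sum_upper(1)[OF C E])
    have "d \<in> G" if d: "d \<in> ?V" "d \<in> ?D" for d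
    proof -
      obtain c y where cy: "c \<in> C" "y \<in> carrier M" "d = c \<oplus>\<^bsub>M\<^esub> x [^] n \<odot>\<^bsub>M\<^esub> y"
        using d(1) by (auto simp: set_add_mem)
      have "x \<odot>\<^bsub>M\<^esub> d \<in> C"
        using ideal_smult_memI[OF x d(2)] mG GC by blast
      moreover have "x \<odot>\<^bsub>M\<^esub> d = x \<odot>\<^bsub>M\<^esub> c \<oplus>\<^bsub>M\<^esub> x [^] Suc n \<odot>\<^bsub>M\<^esub> y"
        unfolding cy(3) pow_Suc[OF cy(2)] using xR cy Cc by (simp add: smult_r_distr)
      moreover have xc: "x \<odot>\<^bsub>M\<^esub> c \<in> C" by (rule submoduleE(4)[OF C xR cy(1)])
      ultimately have "(x \<odot>\<^bsub>M\<^esub> c \<oplus>\<^bsub>M\<^esub> x [^] Suc n \<odot>\<^bsub>M\<^esub> y) \<ominus>\<^bsub>M\<^esub> x \<odot>\<^bsub>M\<^esub> c \<in> C"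
        using submodule_minus[OF C] by metis
      moreover have "(x \<odot>\<^bsub>M\<^esub> c \<oplus>\<^bsub>M\<^esub> z) \<ominus>\<^bsub>M\<^esub> x \<odot>\<^bsub>M\<^esub> c = z" if "z \<in> carrier M" for z
        using that xR Cc[OF cy(1)] by (simp add: M.minus_eq M.a_ac M.r_neg M.r_neg1 M.r_neg2)
      ultimately have "x [^] Suc n \<odot>\<^bsub>M\<^esub> y \<in> C"
        using xR cy(2) by (simp del: R.nat_pow_Suc)
      then have "y \<in> L (Suc n)" using cy(2) by (simp add: L_def del: R.nat_pow_Suc)
      then have "x [^] n \<odot>\<^bsub>M\<^esub> y \<in> C" unfolding stable by (simp add: L_def)
      then have "d \<in> C" unfolding cy(3) by (rule submoduleE(5)[OF C cy(1)])
      then show "d \<in> G" using d(2) CD by auto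
    qed
    then have "?V \<inter> ?D = G" using CV GC GD by auto
    then have "?V = C" using max V CV by auto
    then have "?E \<subseteq> C" using submodule_sum_upper(2)[OF C E] by simp
    then have "x [^] n \<in> ?J" using xR by auto
    then show ?thesis ..
  qed
  obtain P where P: "P \<subseteq> carrier R" "finite P" "\<mm> = Idl P"
    using noetherian_ring.finetely_gen[OF noetherian \<mm>_ideal] by auto
  have "P \<subseteq> \<mm>" unfolding P(3) by (rule genideal_self[OF P(1)])
  then obtain k where k: "ideal_pow R \<mm> k \<subseteq> ?J"
    using nilpotent_gens_imp_nilpotent[OF P(2,1) J] nil unfolding P(3) by (metis (no_types, lifting) subsetD)
  have "ideal_smult R M (ideal_pow R \<mm> k) (carrier M) \<subseteq> C"
    by (rule ideal_smult_least[OF C]) (use k in auto)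
  then have "H <+>\<^bsub>M\<^esub> ideal_smult R M (ideal_pow R \<mm> k) (carrier M) \<subseteq> C"
    by (rule submodule_sum_least[OF C subset_trans[OF HG GC]])
  then have "?D \<subseteq> C" by (rule subset_trans[OF INT_lower[OF UNIV_I]])
  then have "?D \<subseteq> G" using CD by auto
  then show ?thesis unfolding G_def by (rule nakayama[OF D H HD])
qed

end

section \<open>Extension along semilinear maps\<close>

lemma (in cring) ideal_quotient:
  assumes K: "ideal K R" and Y: "Y \<subseteq> carrier R"
  shows "ideal {a \<in> carrier R. \<forall>b\<in>Y. a \<otimes> b \<in> K} R"
proof -
  interpret K: ideal K R by (rule K)
  show ?thesis
    by (rule ideal_by_closure)
      (use Y K.zero_closed K.a_closed K.I_l_closed in \<open>auto simp: l_distr m_assoc subset_iff\<close>)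
qed

text \<open>The common setting of localization (\<open>x \<mapsto> x/1\<close>) and of base change (\<open>x \<mapsto> x \<otimes> 1\<close>).\<close>

locale semilinear_map = R: module R M + B: module B T
    for R (structure) and M (structure) and B (structure) and T (structure) +
  fixes \<phi> and f
  assumes \<phi>: "\<phi> \<in> ring_hom R B"
    and f_closed: "x \<in> carrier M \<Longrightarrow> f x \<in> carrier T"
    and f_add: "x \<in> carrier M \<Longrightarrow> y \<in> carrier M \<Longrightarrow> f (x \<oplus>\<^bsub>M\<^esub> y) = f x \<oplus>\<^bsub>T\<^esub> f y"
    and f_smult: "a \<in> carrier R \<Longrightarrow> x \<in> carrier M \<Longrightarrow> f (a \<odot>\<^bsub>M\<^esub> x) = \<phi> a \<odot>\<^bsub>T\<^esub> f x"
begin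

abbreviation ext_ideal where "ext_ideal A \<equiv> Idl\<^bsub>B\<^esub> (\<phi> ` A)"
abbreviation ext_submodule where "ext_submodule N \<equiv> submod_gen B T (f ` N)"

lemma \<phi>_closed: "a \<in> carrier R \<Longrightarrow> \<phi> a \<in> carrier B"
  by (rule ring_hom_closed[OF \<phi>])

lemma \<phi>_zero: "\<phi> \<zero>\<^bsub>R\<^esub> = \<zero>\<^bsub>B\<^esub>"
  by (rule ring_hom_zero[OF \<phi> R.R.ring_axioms B.R.ring_axioms])

lemma f_zero: "f \<zero>\<^bsub>M\<^esub> = \<zero>\<^bsub>T\<^esub>"
  using f_smult[of "\<zero>\<^bsub>R\<^esub>" "\<zero>\<^bsub>M\<^esub>"] f_closed[of "\<zero>\<^bsub>M\<^esub>"] by (simp add: \<phi>_zero)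

lemma contract_ideal:
  assumes J: "ideal J B"
  shows "ideal {a \<in> carrier R. \<phi> a \<in> J} R"
proof -
  interpret J: ideal J B by (rule J)
  show ?thesis
    by (rule R.R.ideal_by_closure)
      (use J.zero_closed J.a_closed J.I_l_closed \<phi>_closed in
        \<open>auto simp: \<phi>_zero ring_hom_add[OF \<phi>] ring_hom_mult[OF \<phi>]\<close>)
qed

lemma contract_submodule:
  assumes H: "submodule H B T"
  shows "submodule {x \<in> carrier M. f x \<in> H} R M"
  by (rule R.submodule_by_closure)
    (use B.submodule_zero[OF H] B.submoduleE(4,5)[OF H] \<phi>_closed in
      \<open>auto simp: f_zero f_add f_smult\<close>)

lemma ext_ideal_ideal: "A \<subseteq> carrier R \<Longrightarrow> ideal (ext_ideal A) B"
  by (rule B.R.genideal_ideal) (use \<phi>_closed in auto)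

lemma ext_ideal_memI: "a \<in> A \<Longrightarrow> \<phi> a \<in> ext_ideal A"
  unfolding genideal_def by auto

lemma ext_submodule_submodule: "N \<subseteq> carrier M \<Longrightarrow> submodule (ext_submodule N) B T"
  by (rule B.submod_gen_submodule) (use f_closed in auto)

lemma ext_submodule_memI: "x \<in> N \<Longrightarrow> f x \<in> ext_submodule N"
  using B.submod_gen_incl[of "f ` N"] by auto

text \<open>One inclusion is checked on generators after pulling back along \<open>\<phi>\<close>. For the other, the
  generators are replaced by arbitrary elements in two rounds, one factor at a time.\<close>

lemma ext_ideal_prod:
  assumes A: "ideal A R" and C: "ideal C R"
  shows "ext_ideal (A \<cdot>\<^bsub>R\<^esub> C) = ext_ideal A \<cdot>\<^bsub>B\<^esub> ext_ideal C"
proof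
  note Ac = R.ideal_subset_carrier[OF A] and Cc = R.ideal_subset_carrier[OF C]
  note ACc = R.ideal_subset_carrier[OF R.ideal_prod_is_ideal[OF A C]]
  have eA: "ideal (ext_ideal A) B" and eC: "ideal (ext_ideal C) B" and eAC: "ideal (ext_ideal (A \<cdot>\<^bsub>R\<^esub> C)) B"
    using Ac Cc ACc ext_ideal_ideal by auto
  have P: "ideal (ext_ideal A \<cdot>\<^bsub>B\<^esub> ext_ideal C) B" by (rule B.R.ideal_prod_is_ideal[OF eA eC])
  have "A \<cdot>\<^bsub>R\<^esub> C \<subseteq> {a \<in> carrier R. \<phi> a \<in> ext_ideal A \<cdot>\<^bsub>B\<^esub> ext_ideal C}"
    by (rule R.ideal_prod_least[OF contract_ideal[OF P]])
      (use Ac Cc in \<open>auto simp: ring_hom_mult[OF \<phi>] subset_iff intro!: ideal_prod.prod ext_ideal_memI\<close>)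
  then show "ext_ideal (A \<cdot>\<^bsub>R\<^esub> C) \<subseteq> ext_ideal A \<cdot>\<^bsub>B\<^esub> ext_ideal C"
    by (intro B.R.genideal_minimal[OF P]) auto
  show "ext_ideal A \<cdot>\<^bsub>B\<^esub> ext_ideal C \<subseteq> ext_ideal (A \<cdot>\<^bsub>R\<^esub> C)" (is "_ \<subseteq> ?K")
  proof -
    have \<phi>C: "\<phi> ` C \<subseteq> carrier B" using Cc \<phi>_closed by auto
    have gen: "\<phi> a \<otimes>\<^bsub>B\<^esub> \<phi> c \<in> ?K" if "a \<in> A" "c \<in> C" for a c
      using that Ac Cc ext_ideal_memI[OF ideal_prod.prod[OF that, of R]]
      by (auto simp: ring_hom_mult[OF \<phi>] subset_iff)
    have 1: "ext_ideal A \<subseteq> {i \<in> carrier B. \<forall>j\<in>\<phi> ` C. i \<otimes>\<^bsub>B\<^esub> j \<in> ?K}"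
      by (rule B.R.genideal_minimal[OF B.R.ideal_quotient[OF eAC \<phi>C]])
        (use gen Ac \<phi>_closed in auto)
    have 2: "ext_ideal C \<subseteq> {j \<in> carrier B. \<forall>i\<in>ext_ideal A. j \<otimes>\<^bsub>B\<^esub> i \<in> ?K}"
    proof (rule B.R.genideal_minimal[OF B.R.ideal_quotient[OF eAC B.R.ideal_subset_carrier[OF eA]]])
      show "\<phi> ` C \<subseteq> {j \<in> carrier B. \<forall>i\<in>ext_ideal A. j \<otimes>\<^bsub>B\<^esub> i \<in> ?K}"
        using 1 \<phi>C B.R.m_comm by (auto simp: subset_iff)
    qed
    show ?thesis
    proof (rule B.R.ideal_prod_least[OF eAC])
      fix i j assume ij: "i \<in> ext_ideal A" "j \<in> ext_ideal C"
      then have "j \<in> carrier B" "j \<otimes>\<^bsub>B\<^esub> i \<in> ?K" using 2 by auto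
      then show "i \<otimes>\<^bsub>B\<^esub> j \<in> ?K" using B.R.m_comm[OF ideal.Icarr[OF eA ij(1)]] by simp
    qed
  qed
qed

lemma ext_ideal_pow:
  assumes I: "ideal I R"
  shows "ext_ideal (ideal_pow R I n) = ideal_pow B (ext_ideal I) n"
proof (induction n)
  case 0
  have "\<one>\<^bsub>B\<^esub> \<in> ext_ideal (carrier R)"
    using ext_ideal_memI[OF R.R.one_closed] by (simp add: ring_hom_one[OF \<phi>])
  then show ?case
    using ideal.one_imp_carrier[OF ext_ideal_ideal[OF order_refl]]
    by (simp add: R.R.ideal_pow_0 B.R.ideal_pow_0)
next
  case (Suc n)
  then show ?case
    by (simp add: R.R.ideal_pow_Suc B.R.ideal_pow_Suc ext_ideal_prod R.R.ideal_pow_ideal I)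
qed

lemma ext_submodule_smult:
  assumes A: "ideal A R" and N: "N \<subseteq> carrier M"
  shows "ideal_smult B T (ext_ideal A) (ext_submodule N) = ext_submodule (ideal_smult R M A N)"
proof
  note Ac = R.ideal_subset_carrier[OF A]
  note ANc = R.submoduleE(1)[OF R.ideal_smult_submodule[OF Ac N]]
  have eA: "ideal (ext_ideal A) B" by (rule ext_ideal_ideal[OF Ac])
  note eAc = B.R.ideal_subset_carrier[OF eA]
  have eN: "submodule (ext_submodule N) B T" and eAN: "submodule (ext_submodule (ideal_smult R M A N)) B T"
    using N ANc ext_submodule_submodule by auto
  have P: "submodule (ideal_smult B T (ext_ideal A) (ext_submodule N)) B T"
    by (rule B.ideal_smult_submodule[OF eAc B.submoduleE(1)[OF eN]])
  have "ideal_smult R M A N \<subseteq> {x \<in> carrier M. f x \<in> ideal_smult B T (ext_ideal A) (ext_submodule N)}"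
    by (rule R.ideal_smult_least[OF contract_submodule[OF P]])
      (use Ac N in \<open>auto simp: f_smult subset_iff intro!: B.ideal_smult_memI ext_ideal_memI ext_submodule_memI\<close>)
  then show "ext_submodule (ideal_smult R M A N) \<subseteq> ideal_smult B T (ext_ideal A) (ext_submodule N)"
    by (intro B.submod_gen_least[OF P]) auto
  show "ideal_smult B T (ext_ideal A) (ext_submodule N) \<subseteq> ext_submodule (ideal_smult R M A N)" (is "_ \<subseteq> ?K")
  proof -
    have fN: "f ` N \<subseteq> carrier T" using N f_closed by auto
    have gen: "\<phi> a \<odot>\<^bsub>T\<^esub> f x \<in> ?K" if "a \<in> A" "x \<in> N" for a x
      using that Ac N ext_submodule_memI[OF R.ideal_smult_memI[OF that]]
      by (auto simp: f_smult subset_iff)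
    have 1: "ext_ideal A \<subseteq> {i \<in> carrier B. \<forall>y\<in>f ` N. i \<odot>\<^bsub>T\<^esub> y \<in> ?K}"
      by (rule B.R.genideal_minimal[OF B.ideal_colon[OF eAN fN]])
        (use gen Ac \<phi>_closed in auto)
    have 2: "ext_submodule N \<subseteq> {y \<in> carrier T. \<forall>i\<in>ext_ideal A. i \<odot>\<^bsub>T\<^esub> y \<in> ?K}"
      by (rule B.submod_gen_least[OF B.submodule_colon[OF eAN eAc]])
        (use 1 fN in \<open>auto simp: subset_iff\<close>)
    show ?thesis by (rule B.ideal_smult_least[OF eAN]) (use 2 in auto)
  qed
qed

lemma ext_submodule_pow_smult:
  assumes "ideal I R" "N \<subseteq> carrier M"
  shows "ideal_smult B T (ideal_pow B (ext_ideal I) n) (ext_submodule N)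
    = ext_submodule (ideal_smult R M (ideal_pow R I n) N)"
  using assms by (simp add: ext_ideal_pow[symmetric] ext_submodule_smult R.R.ideal_pow_ideal)

text \<open>The closure of the extended module is a submodule, so only the images of elements of \<open>K\<close>
  matter, and for these the exponent found over \<open>R\<close> still works.\<close>

lemma ratliff_rush_reduction_ext:
  assumes I: "ideal I R" and red: "ratliff_rush_reduction R M I N K"
  shows "ratliff_rush_reduction B T (ext_ideal I) (ext_submodule N) (ext_submodule K)"
proof (rule B.ratliff_rush_reductionI)
  note r = R.ratliff_rush_reductionD[OF red]
  note Nc = R.submoduleE(1)[OF r(1)] and Kc = R.submoduleE(1)[OF r(2)]
  note Ic = R.ideal_subset_carrier[OF I]
  show N: "submodule (ext_submodule N) B T" and K: "submodule (ext_submodule K) B T"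
    using Nc Kc ext_submodule_submodule by auto
  have "f ` N \<subseteq> ext_submodule K" using r(3) ext_submodule_memI by auto
  then show "ext_submodule N \<subseteq> ext_submodule K" by (rule B.submod_gen_least[OF K])
  have "f x \<in> ratliff_rush B T (ext_ideal I) (ext_submodule N)" if xK: "x \<in> K" for x
  proof -
    obtain n where x: "x \<in> carrier M"
      and n: "\<forall>a\<in>ideal_pow R I n. a \<odot>\<^bsub>M\<^esub> x \<in> ideal_smult R M (ideal_pow R I (Suc n)) N"
      using xK by (elim R.ratliff_rushE[OF subsetD[OF r(4)]])
    let ?H = "ideal_smult R M (ideal_pow R I (Suc n)) N"
    have H: "submodule (ext_submodule ?H) B T"
      by (rule ext_submodule_submodule[OF R.submoduleE(1)[OF R.ideal_pow_smult_submodule[OF I r(1)]]])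
    have "ext_ideal (ideal_pow R I n) \<subseteq> {b \<in> carrier B. \<forall>y\<in>{f x}. b \<odot>\<^bsub>T\<^esub> y \<in> ext_submodule ?H}"
    proof (rule B.R.genideal_minimal[OF B.ideal_colon[OF H]])
      show "\<phi> ` ideal_pow R I n \<subseteq> {b \<in> carrier B. \<forall>y\<in>{f x}. b \<odot>\<^bsub>T\<^esub> y \<in> ext_submodule ?H}"
        using ext_submodule_memI[OF bspec[OF n]] x R.ideal_pow_carrier[OF I, of n] \<phi>_closed
        by (auto simp: f_smult subset_iff)
    qed (use x f_closed in auto)
    then show ?thesis
      using f_closed[OF x] ext_submodule_pow_smult[OF I Nc, of "Suc n"]
      unfolding B.ratliff_rush_iff ext_ideal_pow[OF I] by auto
  qed
  then have "f ` K \<subseteq> ratliff_rush B T (ext_ideal I) (ext_submodule N)" by auto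
  then show "ext_submodule K \<subseteq> ratliff_rush B T (ext_ideal I) (ext_submodule N)"
    by (rule B.submod_gen_least[OF B.ratliff_rush_submodule[OF ext_ideal_ideal[OF Ic] N]])
qed

end

section \<open>Localization\<close>

context module_localization
begin

lemma loc_ideal_memI: "a \<in> I \<Longrightarrow> s \<in> S \<Longrightarrow> rfrac R S a s \<in> loc_ideal R S I"
  unfolding loc_ideal_def by blast

lemma loc_submodule_memI: "x \<in> N \<Longrightarrow> s \<in> S \<Longrightarrow> mfrac M S x s \<in> loc_submodule M S N"
  unfolding loc_submodule_def by blast

lemma loc_ideal_ideal:
  assumes I: "ideal I R"
  shows "ideal (loc_ideal R S I) (loc_ring R S)"
proof -
  interpret Q: cring "loc_ring R S" by (rule loc_ring_cring)
  interpret I: ideal I R by (rule I)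
  show ?thesis
  proof (rule Q.ideal_by_closure)
    show "loc_ideal R S I \<subseteq> carrier (loc_ring R S)"
      using I.Icarr by (auto simp: loc_ideal_def intro!: rfrac_closed)
    show "\<zero>\<^bsub>loc_ring R S\<^esub> \<in> loc_ideal R S I"
      using loc_ideal_memI[OF I.zero_closed S_one] by (simp add: loc_ring_def)
  next
    fix x y assume "x \<in> loc_ideal R S I" "y \<in> loc_ideal R S I"
    then obtain a s b t where *: "a \<in> I" "s \<in> S" "x = rfrac R S a s" "b \<in> I" "t \<in> S" "y = rfrac R S b t"
      by (auto simp: loc_ideal_def)
    then have "x \<oplus>\<^bsub>loc_ring R S\<^esub> y = rfrac R S ((t \<otimes> a) \<oplus> (s \<otimes> b)) (s \<otimes> t)"
      using I.Icarr by (simp add: loc_ring_add)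
    moreover have "(t \<otimes> a) \<oplus> (s \<otimes> b) \<in> I"
      using * by (intro I.a_closed I.I_l_closed S_carr)
    ultimately show "x \<oplus>\<^bsub>loc_ring R S\<^esub> y \<in> loc_ideal R S I"
      using loc_ideal_memI[OF _ S_mult[OF *(2,5)]] by simp
  next
    fix x r assume "x \<in> loc_ideal R S I" "r \<in> carrier (loc_ring R S)"
    then obtain a s b t where *: "a \<in> I" "s \<in> S" "x = rfrac R S a s" "b \<in> carrier R" "t \<in> S" "r = rfrac R S b t"
      by (auto simp: loc_ideal_def elim!: loc_ring_elim)
    then have "r \<otimes>\<^bsub>loc_ring R S\<^esub> x = rfrac R S (b \<otimes> a) (t \<otimes> s)"
      using I.Icarr by (simp add: loc_ring_mult)
    then show "r \<otimes>\<^bsub>loc_ring R S\<^esub> x \<in> loc_ideal R S I"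
      using loc_ideal_memI[OF I.I_l_closed[OF *(1,4)] S_mult[OF *(5,2)]] by simp
  qed
qed

lemma loc_submodule_submodule:
  assumes N: "submodule N R M"
  shows "submodule (loc_submodule M S N) (loc_ring R S) (loc_module R M S)"
proof -
  interpret Q: module "loc_ring R S" "loc_module R M S" by (rule loc_module_module)
  note Nc = submoduleE(1)[OF N, THEN subsetD]
  show ?thesis
  proof (rule Q.submodule_by_closure)
    show "loc_submodule M S N \<subseteq> carrier (loc_module R M S)"
      using Nc by (auto simp: loc_submodule_def intro!: mfrac_closed)
    show "\<zero>\<^bsub>loc_module R M S\<^esub> \<in> loc_submodule M S N"
      using loc_submodule_memI[OF submodule_zero[OF N] S_one] by (simp add: loc_module_def)
  next
    fix x y assume "x \<in> loc_submodule M S N" "y \<in> loc_submodule M S N"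
    then obtain a s b t where *: "a \<in> N" "s \<in> S" "x = mfrac M S a s" "b \<in> N" "t \<in> S" "y = mfrac M S b t"
      by (auto simp: loc_submodule_def)
    then have "x \<oplus>\<^bsub>loc_module R M S\<^esub> y = mfrac M S ((t \<odot>\<^bsub>M\<^esub> a) \<oplus>\<^bsub>M\<^esub> (s \<odot>\<^bsub>M\<^esub> b)) (s \<otimes> t)"
      using Nc by (simp add: loc_module_add)
    moreover have "(t \<odot>\<^bsub>M\<^esub> a) \<oplus>\<^bsub>M\<^esub> (s \<odot>\<^bsub>M\<^esub> b) \<in> N"
      using * by (intro submoduleE(5)[OF N] submoduleE(4)[OF N] S_carr)
    ultimately show "x \<oplus>\<^bsub>loc_module R M S\<^esub> y \<in> loc_submodule M S N"
      using loc_submodule_memI[OF _ S_mult[OF *(2,5)]] by simp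
  next
    fix r x assume "r \<in> carrier (loc_ring R S)" "x \<in> loc_submodule M S N"
    then obtain a s b t where *: "a \<in> N" "s \<in> S" "x = mfrac M S a s" "b \<in> carrier R" "t \<in> S" "r = rfrac R S b t"
      by (auto simp: loc_submodule_def elim!: loc_ring_elim)
    then have "r \<odot>\<^bsub>loc_module R M S\<^esub> x = mfrac M S (b \<odot>\<^bsub>M\<^esub> a) (t \<otimes> s)"
      using Nc by (simp add: loc_module_smult)
    then show "r \<odot>\<^bsub>loc_module R M S\<^esub> x \<in> loc_submodule M S N"
      using loc_submodule_memI[OF submoduleE(4)[OF N *(4,1)] S_mult[OF *(5,2)]] by simp
  qed
qed

lemma localization_semilinear:
  "semilinear_map R M (loc_ring R S) (loc_module R M S) (\<lambda>a. rfrac R S a \<one>) (\<lambda>x. mfrac M S x \<one>)"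
proof -
  interpret Q: module "loc_ring R S" "loc_module R M S" by (rule loc_module_module)
  have "(\<lambda>a. rfrac R S a \<one>) \<in> ring_hom R (loc_ring R S)"
    by (rule ring_hom_memI) (simp_all add: loc_ring_mult loc_ring_add rfrac_closed, simp add: loc_ring_def)
  then show ?thesis
    by unfold_locales (auto simp: loc_module_add loc_module_smult mfrac_closed)
qed

lemma loc_ideal_eq_gen:
  assumes I: "ideal I R"
  shows "loc_ideal R S I = Idl\<^bsub>loc_ring R S\<^esub> ((\<lambda>a. rfrac R S a \<one>) ` I)" (is "_ = Idl\<^bsub>?Q\<^esub> ?G")
proof
  interpret Q: cring ?Q by (rule loc_ring_cring)
  note Ic = ideal.Icarr[OF I]
  have G: "?G \<subseteq> carrier ?Q" using Ic by (auto intro!: rfrac_closed)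
  show "loc_ideal R S I \<subseteq> Idl\<^bsub>?Q\<^esub> ?G"
  proof
    fix x assume "x \<in> loc_ideal R S I"
    then obtain a s where *: "a \<in> I" "s \<in> S" "x = rfrac R S a s" by (auto simp: loc_ideal_def)
    then have "x = rfrac R S \<one> s \<otimes>\<^bsub>?Q\<^esub> rfrac R S a \<one>"
      using Ic S_carr by (simp add: loc_ring_mult)
    also have "\<dots> \<in> Idl\<^bsub>?Q\<^esub> ?G"
      using * Q.genideal_self[OF G]
      by (intro ideal.I_l_closed[OF Q.genideal_ideal[OF G]] rfrac_closed) auto
    finally show "x \<in> Idl\<^bsub>?Q\<^esub> ?G" .
  qed
  show "Idl\<^bsub>?Q\<^esub> ?G \<subseteq> loc_ideal R S I"
    by (rule Q.genideal_minimal[OF loc_ideal_ideal[OF I]]) (auto intro: loc_ideal_memI)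
qed

lemma loc_submodule_eq_gen:
  assumes N: "submodule N R M"
  shows "loc_submodule M S N = submod_gen (loc_ring R S) (loc_module R M S) ((\<lambda>x. mfrac M S x \<one>) ` N)"
    (is "_ = submod_gen ?Q ?L ?G")
proof
  interpret Q: module ?Q ?L by (rule loc_module_module)
  note Nc = submoduleE(1)[OF N, THEN subsetD]
  have G: "submodule (submod_gen ?Q ?L ?G) ?Q ?L"
    using Nc by (intro Q.submod_gen_submodule) (auto intro!: mfrac_closed)
  show "loc_submodule M S N \<subseteq> submod_gen ?Q ?L ?G"
  proof
    fix y assume "y \<in> loc_submodule M S N"
    then obtain x s where *: "x \<in> N" "s \<in> S" "y = mfrac M S x s" by (auto simp: loc_submodule_def)
    then have "y = rfrac R S \<one> s \<odot>\<^bsub>?L\<^esub> mfrac M S x \<one>"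
      using Nc S_carr by (simp add: loc_module_smult)
    also have "\<dots> \<in> submod_gen ?Q ?L ?G"
      using * Q.submod_gen_incl[of ?G]
      by (intro Q.submoduleE(4)[OF G] rfrac_closed) auto
    finally show "y \<in> submod_gen ?Q ?L ?G" .
  qed
  show "submod_gen ?Q ?L ?G \<subseteq> loc_submodule M S N"
    by (rule Q.submod_gen_least[OF loc_submodule_submodule[OF N]]) (auto intro: loc_submodule_memI)
qed

lemma ratliff_rush_reduction_localization:
  assumes I: "ideal I R" and red: "ratliff_rush_reduction R M I N K"
  shows "ratliff_rush_reduction (loc_ring R S) (loc_module R M S) (loc_ideal R S I)
    (loc_submodule M S N) (loc_submodule M S K)"
  using semilinear_map.ratliff_rush_reduction_ext[OF localization_semilinear I red]
    ratliff_rush_reductionD(1,2)[OF red]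
  by (simp add: loc_ideal_eq_gen[OF I] loc_submodule_eq_gen)

end

section \<open>Base change\<close>

context scalar_extension
begin

lemma rels_in_U: "c \<in> tensor_rels R M B \<phi> \<Longrightarrow> c \<in> U"
  unfolding tensor_sub_def by (rule generate.incl)

lemma base_change_semilinear:
  "semilinear_map R M B (base_change R M B \<phi>) \<phi> (\<lambda>x. pure_tensor R M B \<phi> x \<one>\<^bsub>B\<^esub>)"
proof -
  let ?T = "base_change R M B \<phi>"
  interpret T: module B ?T by (rule base_change_module)
  show ?thesis
  proof (unfold_locales, unfold pure_tensor_def)
    fix x assume x: "x \<in> carrier M"
    show "U #>\<^bsub>F\<^esub> frag_of (x, \<one>\<^bsub>B\<^esub>) \<in> carrier ?T"
      using x by (intro coset_closed F_of) auto
    show "U #>\<^bsub>F\<^esub> frag_of (a \<odot>\<^bsub>M\<^esub> x, \<one>\<^bsub>B\<^esub>) = \<phi> a \<odot>\<^bsub>?T\<^esub> (U #>\<^bsub>F\<^esub> frag_of (x, \<one>\<^bsub>B\<^esub>))"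
      if a: "a \<in> carrier R" for a
    proof -
      have "frag_of (a \<odot>\<^bsub>M\<^esub> x, \<one>\<^bsub>B\<^esub>) - frag_of (x, \<phi> a \<otimes>\<^bsub>B\<^esub> \<one>\<^bsub>B\<^esub>) \<in> U"
        by (rule rels_in_U) (use a x in \<open>auto simp: tensor_rels_def\<close>)
      then show ?thesis
        using a x hom_closed[OF a] by (simp add: base_change_smult F_of coset_eq_iff)
    qed
    show "U #>\<^bsub>F\<^esub> frag_of (x \<oplus>\<^bsub>M\<^esub> y, \<one>\<^bsub>B\<^esub>)
        = (U #>\<^bsub>F\<^esub> frag_of (x, \<one>\<^bsub>B\<^esub>)) \<oplus>\<^bsub>?T\<^esub> (U #>\<^bsub>F\<^esub> frag_of (y, \<one>\<^bsub>B\<^esub>))"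
      if y: "y \<in> carrier M" for y
    proof -
      have "frag_of (x \<oplus>\<^bsub>M\<^esub> y, \<one>\<^bsub>B\<^esub>) - (frag_of (x, \<one>\<^bsub>B\<^esub>) + frag_of (y, \<one>\<^bsub>B\<^esub>)) \<in> U"
        by (rule rels_in_U) (use x y in \<open>auto simp: tensor_rels_def\<close>)
      then show ?thesis
        using x y by (simp add: base_change_add F_of F_add coset_eq_iff)
    qed
  qed (rule hom)
qed

text \<open>The tensors \<open>\<Sum> x\<^sub>i \<otimes> b\<^sub>i\<close> with all \<open>x\<^sub>i \<in> N\<close> already form a submodule over \<open>B\<close>.\<close>

lemma extended_submodule_repr:
  assumes N: "N \<subseteq> carrier M" and P: "P \<in> extended_submodule R M B \<phi> N"
  obtains c where "Poly_Mapping.keys c \<subseteq> N \<times> carrier B" "P = U #>\<^bsub>F\<^esub> c"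
proof -
  let ?T = "base_change R M B \<phi>"
  interpret T: module B ?T by (rule base_change_module)
  interpret F: comm_group F by (rule F_group)
  let ?W = "{U #>\<^bsub>F\<^esub> c | c. Poly_Mapping.keys c \<subseteq> N \<times> carrier B}"
  have cF: "c \<in> carrier F" if "Poly_Mapping.keys c \<subseteq> N \<times> carrier B" for c
    using that N by (auto simp: F_carrier)
  have "submodule ?W B ?T"
  proof (rule T.submodule_by_closure)
    show "?W \<subseteq> carrier ?T" using cF coset_closed by auto
    have "\<zero>\<^bsub>?T\<^esub> = U #>\<^bsub>F\<^esub> 0"
      using F.coset_mult_one[OF subgroup.subset[OF U_subgroup]]
      by (simp add: base_change_def FactGroup_def)
    then show "\<zero>\<^bsub>?T\<^esub> \<in> ?W" by (auto intro!: exI[of _ 0])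
    fix x assume "x \<in> ?W"
    then obtain c where c: "Poly_Mapping.keys c \<subseteq> N \<times> carrier B" "x = U #>\<^bsub>F\<^esub> c" by blast
    show "x \<oplus>\<^bsub>?T\<^esub> y \<in> ?W" if "y \<in> ?W" for y
    proof -
      obtain d where d: "Poly_Mapping.keys d \<subseteq> N \<times> carrier B" "y = U #>\<^bsub>F\<^esub> d"
        using \<open>y \<in> ?W\<close> by blast
      have "Poly_Mapping.keys (c + d) \<subseteq> N \<times> carrier B"
        using keys_add[of c d] c(1) d(1) by blast
      moreover have "x \<oplus>\<^bsub>?T\<^esub> y = U #>\<^bsub>F\<^esub> (c + d)"
        using c d by (simp add: base_change_add cF)
      ultimately show ?thesis by blast
    qed
    show "b \<odot>\<^bsub>?T\<^esub> x \<in> ?W" if b: "b \<in> carrier B" for b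
    proof -
      have "Poly_Mapping.keys (act b c) \<subseteq> N \<times> carrier B"
        by (rule order_trans[OF keys_frag_extend]) (use b c(1) in auto)
      moreover have "b \<odot>\<^bsub>?T\<^esub> x = U #>\<^bsub>F\<^esub> act b c"
        using b c by (simp add: base_change_smult cF)
      ultimately show ?thesis by blast
    qed
  qed
  moreover have "pure_tensor R M B \<phi> x \<one>\<^bsub>B\<^esub> \<in> ?W" if "x \<in> N" for x
    using that by (auto simp: pure_tensor_def intro!: exI[of _ "frag_of (x, \<one>\<^bsub>B\<^esub>)"])
  ultimately have "extended_submodule R M B \<phi> N \<subseteq> ?W"
    unfolding extended_submodule_def by (intro T.submod_gen_least) auto
  then show thesis using P that by blast
qed

text \<open>A balanced map into an abelian group \<open>G\<close> extends to the free abelian group on pairs and kills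
  the tensor relations, hence induces an additive map on tensors. The elements of the extension of \<open>N\<close> are sums
  of tensors on which this map vanishes.\<close>

lemma balanced_map_vanishes:
  assumes G: "comm_group G"
    and \<beta>: "\<And>x b. x \<in> carrier M \<Longrightarrow> b \<in> carrier B \<Longrightarrow> \<beta> x b \<in> carrier G"
    and add_l: "\<And>x y b. x \<in> carrier M \<Longrightarrow> y \<in> carrier M \<Longrightarrow> b \<in> carrier B
        \<Longrightarrow> \<beta> (x \<oplus>\<^bsub>M\<^esub> y) b = \<beta> x b \<otimes>\<^bsub>G\<^esub> \<beta> y b"
    and add_r: "\<And>x b c. x \<in> carrier M \<Longrightarrow> b \<in> carrier B \<Longrightarrow> c \<in> carrier B
        \<Longrightarrow> \<beta> x (b \<oplus>\<^bsub>B\<^esub> c) = \<beta> x b \<otimes>\<^bsub>G\<^esub> \<beta> x c"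
    and bal: "\<And>a x b. a \<in> carrier R \<Longrightarrow> x \<in> carrier M \<Longrightarrow> b \<in> carrier B
        \<Longrightarrow> \<beta> (a \<odot>\<^bsub>M\<^esub> x) b = \<beta> x (\<phi> a \<otimes>\<^bsub>B\<^esub> b)"
    and N: "N \<subseteq> carrier M" and vanish: "\<And>x b. x \<in> N \<Longrightarrow> b \<in> carrier B \<Longrightarrow> \<beta> x b = \<one>\<^bsub>G\<^esub>"
    and y: "y \<in> carrier M" and b: "b \<in> carrier B"
    and yN: "pure_tensor R M B \<phi> y b \<in> extended_submodule R M B \<phi> N"
  shows "\<beta> y b = \<one>\<^bsub>G\<^esub>"
proof -
  interpret G: comm_group G by (rule G)
  interpret F: comm_group F by (rule F_group)
  have "(\<lambda>(x, b). \<beta> x b) ` (carrier M \<times> carrier B) \<subseteq> carrier G" using \<beta> by auto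
  then obtain h where h: "h \<in> hom F G"
    and hb: "\<And>p. p \<in> carrier M \<times> carrier B \<Longrightarrow> h (frag_of p) = (\<lambda>(x, b). \<beta> x b) p"
    using G.free_Abelian_group_universal[of "\<lambda>(x, b). \<beta> x b" "carrier M \<times> carrier B" thesis]
    unfolding tensor_free_def by simp
  interpret h: group_hom F G h by unfold_locales (rule h)
  have hF: "h (frag_of (x, b)) = \<beta> x b" if "x \<in> carrier M" "b \<in> carrier B" for x b
    using hb[of "(x, b)"] that by simp
  have hadd: "h (c + d) = h c \<otimes>\<^bsub>G\<^esub> h d" if "c \<in> carrier F" "d \<in> carrier F" for c d
    using h.hom_mult[OF that] by simp
  have hdiff: "h (c - d) = \<one>\<^bsub>G\<^esub> \<longleftrightarrow> h c = h d" if "c \<in> carrier F" "d \<in> carrier F" for c d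
  proof -
    have "h (c - d) \<otimes>\<^bsub>G\<^esub> h d = h c" using hadd[OF F_diff[OF that] that(2)] by simp
    then show ?thesis
      using h.hom_closed that F_diff[OF that] by (metis G.l_one G.r_cancel_one)
  qed
  have "tensor_rels R M B \<phi> \<subseteq> kernel F G h"
  proof
    fix c assume c: "c \<in> tensor_rels R M B \<phi>"
    then have "h c = \<one>\<^bsub>G\<^esub>"
      unfolding tensor_rels_def
      by (auto simp: hdiff hadd hF F_of F_add hom_closed add_l add_r bal)
    then show "c \<in> kernel F G h" using c rels_subset by (auto simp: kernel_def)
  qed
  then have U: "U \<subseteq> kernel F G h"
    unfolding tensor_sub_def by (rule F.generate_subgroup_incl[OF _ h.subgroup_kernel])
  obtain c where c: "Poly_Mapping.keys c \<subseteq> N \<times> carrier B" "pure_tensor R M B \<phi> y b = U #>\<^bsub>F\<^esub> c"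
    using yN by (rule extended_submodule_repr[OF N])
  have "c \<in> carrier F \<and> h c = \<one>\<^bsub>G\<^esub>"
    using c(1)
  proof (induction rule: frag_induction)
    case zero
    then show ?case using F.one_closed h.hom_one by simp
  next
    case (one p)
    then show ?case using N vanish by (auto simp: hF F_of subset_iff)
  next
    case (diff c d)
    then show ?case by (simp add: F_diff hdiff)
  qed
  moreover have yF: "frag_of (y, b) \<in> carrier F" by (rule F_of[OF y b])
  ultimately have "frag_of (y, b) - c \<in> U" using c(2) coset_eq_iff by (simp add: pure_tensor_def)
  then have "h (frag_of (y, b) - c) = \<one>\<^bsub>G\<^esub>" using U by (auto simp: kernel_def)
  then show ?thesis using \<open>c \<in> carrier F \<and> h c = \<one>\<^bsub>G\<^esub>\<close> yF hdiff hF[OF y b] by simp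
qed

end

section \<open>Completion\<close>

lemma (in module) add_coset_eq_iff:
  assumes H: "submodule H R M" and x: "x \<in> carrier M" and y: "y \<in> carrier M"
  shows "H #>\<^bsub>add_monoid M\<^esub> x = H #>\<^bsub>add_monoid M\<^esub> y \<longleftrightarrow> x \<ominus>\<^bsub>M\<^esub> y \<in> H"
proof -
  note sg = submodule.axioms(1)[OF H]
  have "H #>\<^bsub>add_monoid M\<^esub> x = H #>\<^bsub>add_monoid M\<^esub> y \<longleftrightarrow> x \<in> H #>\<^bsub>add_monoid M\<^esub> y"
    using group.rcos_self[OF M.a_group _ sg, of x] group.repr_independence[OF M.a_group, of x H y] x y sg
    by auto
  also have "\<dots> \<longleftrightarrow> x \<ominus>\<^bsub>M\<^esub> y \<in> H"
    using subgroup.rcos_module[OF sg M.a_group, of y x] x y by (simp add: a_inv_def a_minus_def)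
  finally show ?thesis .
qed

lemma (in cring) completion_component:
  assumes J: "ideal J R" and b: "b \<in> carrier (adic_completion R J)"
  obtains r where "r \<in> carrier R" "r \<in> b k"
    "\<And>s. s \<in> b k \<Longrightarrow> s \<in> carrier R \<and> s \<ominus> r \<in> ideal_pow R J k"
    "b k = ideal_pow R J k +> r"
proof -
  have Jk: "ideal (ideal_pow R J k) R" by (rule ideal_pow_ideal[OF J])
  interpret Jk: ideal "ideal_pow R J k" R by (rule Jk)
  have "b k \<in> carrier (R Quot ideal_pow R J k)" using b by (simp add: adic_completion_def)
  then obtain r where r: "r \<in> carrier R" "b k = ideal_pow R J k +> r"
    by (auto simp: FactRing_def A_RCOSETS_def')
  have "r \<in> b k" unfolding r(2) using r(1) Jk.zero_closed by (force simp: a_r_coset_def')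
  moreover have "s \<in> carrier R \<and> s \<ominus> r \<in> ideal_pow R J k" if s: "s \<in> b k" for s
  proof -
    obtain j where "j \<in> ideal_pow R J k" "s = j \<oplus> r"
      using s unfolding r(2) by (auto simp: a_r_coset_def')
    then show ?thesis using r(1) by (simp add: minus_eq a_assoc r_neg Jk.Icarr)
  qed
  ultimately show thesis using that r by blast
qed

lemma (in cring) completion_component_add:
  assumes "r \<in> b k" "s \<in> c k"
  shows "r \<oplus> s \<in> (b \<oplus>\<^bsub>adic_completion R J\<^esub> c) k"
proof -
  have "b k <+>\<^bsub>R\<^esub> c k = (b \<oplus>\<^bsub>adic_completion R J\<^esub> c) k"
    by (simp add: adic_completion_def FactRing_def)
  then show ?thesis using assms unfolding set_add_def' by blast
qed

lemma (in cring) completion_component_smult: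
  assumes J: "ideal J R" and b: "b \<in> carrier (adic_completion R J)" "r \<in> b k" and a: "a \<in> carrier R"
  shows "a \<otimes> r \<in> (to_completion R J a \<otimes>\<^bsub>adic_completion R J\<^esub> b) k"
proof -
  interpret Jk: ideal "ideal_pow R J k" R by (rule ideal_pow_ideal[OF J])
  have rR: "r \<in> carrier R" using b by (auto elim: completion_component[OF J])
  obtain r' where r': "r' \<in> carrier R" "b k = ideal_pow R J k +> r'"
    by (rule completion_component[OF J b(1), of k]) blast
  have "b k = ideal_pow R J k +> r"
    using Jk.a_repr_independence'[of r r'] b(2) r' by simp
  then have "(to_completion R J a \<otimes>\<^bsub>adic_completion R J\<^esub> b) k = ideal_pow R J k +> (a \<otimes> r)"
    using Jk.rcoset_mult_add[OF a rR] by (simp add: adic_completion_def to_completion_def FactRing_def)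
  then show ?thesis using Jk.zero_closed a rR by (force simp: a_r_coset_def')
qed

text \<open>The balanced map \<open>x \<otimes> b \<mapsto> b\<^sub>k x\<close> into \<open>M / (N + J\<^sup>k M)\<close> does not depend on the choice of a
  representative of \<open>b\<^sub>k \<in> R / J\<^sup>k\<close>. It vanishes for \<open>x \<in> N\<close>, and it maps \<open>y \<otimes> 1\<close> to the
  class of \<open>y\<close>.\<close>

lemma (in module) completion_contraction:
  assumes J: "ideal J R" and N: "submodule N R M" and y: "y \<in> carrier M"
    and yN: "pure_tensor R M (adic_completion R J) (to_completion R J) y \<one>\<^bsub>adic_completion R J\<^esub>
      \<in> extended_submodule R M (adic_completion R J) (to_completion R J) N"
  shows "y \<in> N <+>\<^bsub>M\<^esub> ideal_smult R M (ideal_pow R J k) (carrier M)"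
proof -
  let ?B = "adic_completion R J" and ?Jk = "ideal_pow R J k"
  let ?S = "ideal_smult R M ?Jk (carrier M)"
  let ?H = "N <+>\<^bsub>M\<^esub> ?S" and ?A = "add_monoid M"
  interpret X: scalar_extension R M ?B "to_completion R J"
    using to_completion_hom[OF J] module_axioms
    by (simp add: scalar_extension_def scalar_extension_axioms_def)
  have S: "submodule ?S R M" by (rule ideal_pow_smult_submodule[OF J carrier_is_submodule])
  have H: "submodule ?H R M" by (rule submodule_sum[OF N S])
  have NH: "N \<subseteq> ?H" and SH: "?S \<subseteq> ?H" using submodule_sum_upper[OF N S] by auto
  have sg: "subgroup ?H ?A" by (rule submodule.axioms(1)[OF H])
  have A: "comm_group ?A" by (rule M.a_comm_group)
  interpret Hn: normal ?H ?A by (rule comm_group.subgroup_imp_normal[OF A sg])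
  let ?q = "\<lambda>x. ?H #>\<^bsub>?A\<^esub> x"
  note q_eq = add_coset_eq_iff[OF H]
  \<comment> \<open>\<open>\<rho> b\<close> represents the \<open>k\<close>-th component of \<open>b\<close>; it is not additive, only its class is\<close>
  define \<rho> where "\<rho> b = (SOME r. r \<in> b k)" for b :: "nat \<Rightarrow> 'a set"
  have \<rho>: "\<rho> b \<in> b k" "\<rho> b \<in> carrier R" if b: "b \<in> carrier ?B" for b
  proof -
    obtain r where r: "r \<in> carrier R" "r \<in> b k" "\<And>s. s \<in> b k \<Longrightarrow> s \<in> carrier R \<and> s \<ominus> r \<in> ?Jk"
      by (rule completion_component[OF J b, of k]) blast
    show "\<rho> b \<in> b k" unfolding \<rho>_def by (rule someI[of _ r]) (rule r(2))
    then show "\<rho> b \<in> carrier R" using r(3) by blast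
  qed
  have repr: "?q (r \<odot>\<^bsub>M\<^esub> x) = ?q (\<rho> b \<odot>\<^bsub>M\<^esub> x)"
    if b: "b \<in> carrier ?B" and r: "r \<in> b k" and x: "x \<in> carrier M" for b r x
  proof -
    obtain t where t: "t \<in> carrier R" "\<And>s. s \<in> b k \<Longrightarrow> s \<in> carrier R \<and> s \<ominus> t \<in> ?Jk"
      by (rule completion_component[OF J b, of k]) blast
    have q: "?q (s \<odot>\<^bsub>M\<^esub> x) = ?q (t \<odot>\<^bsub>M\<^esub> x)" if "s \<in> b k" for s
    proof -
      have s: "s \<in> carrier R" "s \<ominus> t \<in> ?Jk" using t(2)[OF that] by auto
      have "s \<odot>\<^bsub>M\<^esub> x \<ominus>\<^bsub>M\<^esub> t \<odot>\<^bsub>M\<^esub> x = (s \<ominus> t) \<odot>\<^bsub>M\<^esub> x"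
        using s(1) t(1) x by (simp add: R.minus_eq M.minus_eq smult_l_distr smult_l_minus)
      also have "\<dots> \<in> ?H" using SH ideal_smult_memI[OF s(2) x] by auto
      finally show ?thesis using s(1) t(1) x by (simp add: q_eq)
    qed
    show ?thesis using q[OF r] q[OF \<rho>(1)[OF b]] by simp
  qed
  define \<beta> where "\<beta> x b = ?q (\<rho> b \<odot>\<^bsub>M\<^esub> x)" for x b
  have "\<beta> y \<one>\<^bsub>?B\<^esub> = \<one>\<^bsub>?A Mod ?H\<^esub>"
  proof (rule X.balanced_map_vanishes[OF comm_group.abelian_FactGroup[OF A sg] _ _ _ _ _ _ y _ yN])
    show "\<beta> x b \<in> carrier (?A Mod ?H)" if "x \<in> carrier M" "b \<in> carrier ?B" for x b
      using that \<rho> by (auto simp: \<beta>_def FactGroup_def RCOSETS_def)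
    have mult: "?q u \<otimes>\<^bsub>?A Mod ?H\<^esub> ?q v = ?q (u \<oplus>\<^bsub>M\<^esub> v)" if "u \<in> carrier M" "v \<in> carrier M" for u v
      using Hn.rcos_sum[of u v] that by (simp add: FactGroup_def)
    show "\<beta> (x \<oplus>\<^bsub>M\<^esub> z) b = \<beta> x b \<otimes>\<^bsub>?A Mod ?H\<^esub> \<beta> z b"
      if "x \<in> carrier M" "z \<in> carrier M" "b \<in> carrier ?B" for x z b
      using that \<rho> mult[of "\<rho> b \<odot>\<^bsub>M\<^esub> x" "\<rho> b \<odot>\<^bsub>M\<^esub> z"] by (simp add: \<beta>_def smult_r_distr)
    show "\<beta> x (b \<oplus>\<^bsub>?B\<^esub> c) = \<beta> x b \<otimes>\<^bsub>?A Mod ?H\<^esub> \<beta> x c"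
      if "x \<in> carrier M" "b \<in> carrier ?B" "c \<in> carrier ?B" for x b c
    proof -
      have "\<rho> b \<oplus> \<rho> c \<in> (b \<oplus>\<^bsub>?B\<^esub> c) k"
        using that \<rho>(1) by (intro completion_component_add) auto
      then have "\<beta> x (b \<oplus>\<^bsub>?B\<^esub> c) = ?q ((\<rho> b \<oplus> \<rho> c) \<odot>\<^bsub>M\<^esub> x)"
        unfolding \<beta>_def using repr[OF X.B.a_closed[OF that(2,3)] _ that(1)] by simp
      then show ?thesis
        using that \<rho>(2) mult[of "\<rho> b \<odot>\<^bsub>M\<^esub> x" "\<rho> c \<odot>\<^bsub>M\<^esub> x"] by (simp add: \<beta>_def smult_l_distr)
    qed
    show "\<beta> (a \<odot>\<^bsub>M\<^esub> x) b = \<beta> x (to_completion R J a \<otimes>\<^bsub>?B\<^esub> b)"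
      if "a \<in> carrier R" "x \<in> carrier M" "b \<in> carrier ?B" for a x b
    proof -
      have "a \<otimes> \<rho> b \<in> (to_completion R J a \<otimes>\<^bsub>?B\<^esub> b) k"
        using that \<rho>(1) by (intro completion_component_smult[OF J]) auto
      then have "\<beta> x (to_completion R J a \<otimes>\<^bsub>?B\<^esub> b) = ?q ((a \<otimes> \<rho> b) \<odot>\<^bsub>M\<^esub> x)"
        unfolding \<beta>_def using repr[OF X.B.m_closed[OF X.hom_closed[OF that(1)] that(3)] _ that(2)] by simp
      then show ?thesis using that \<rho>(2) by (simp add: \<beta>_def R.m_comm[of a] smult_assoc1)
    qed
    show "N \<subseteq> carrier M" by (rule submoduleE(1)[OF N])
    show "\<beta> x b = \<one>\<^bsub>?A Mod ?H\<^esub>" if "x \<in> N" "b \<in> carrier ?B" for x b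
    proof -
      have "\<rho> b \<odot>\<^bsub>M\<^esub> x \<in> ?H" using NH submoduleE(4)[OF N \<rho>(2) that(1)] that(2) by auto
      then show ?thesis
        using subgroup.rcos_const[OF sg M.a_group] by (simp add: \<beta>_def FactGroup_def)
    qed
  qed simp
  moreover have "\<one> \<in> \<one>\<^bsub>?B\<^esub> k"
  proof -
    interpret Jk: ideal ?Jk R by (rule ideal_pow_ideal[OF J])
    show ?thesis using Jk.zero_closed by (force simp: adic_completion_def FactRing_def a_r_coset_def')
  qed
  then have "\<beta> y \<one>\<^bsub>?B\<^esub> = ?q (\<one> \<odot>\<^bsub>M\<^esub> y)" unfolding \<beta>_def using repr[OF X.B.one_closed _ y] by simp
  ultimately have "?q y = ?H" using y by (simp add: FactGroup_def)
  then show ?thesis using group.rcos_self[OF M.a_group _ sg, of y] y by simp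
qed

context noetherian_local_module
begin

lemma completion_faithful:
  assumes N: "submodule N R M" and y: "y \<in> carrier M"
    and yN: "pure_tensor R M (adic_completion R \<mm>) (to_completion R \<mm>) y \<one>\<^bsub>adic_completion R \<mm>\<^esub>
      \<in> extended_submodule R M (adic_completion R \<mm>) (to_completion R \<mm>) N"
  shows "y \<in> N"
proof -
  have "y \<in> (\<Inter>k. N <+>\<^bsub>M\<^esub> ideal_smult R M (ideal_pow R \<mm> k) (carrier M))"
    using completion_contraction[OF \<mm>_ideal N y yN] by (rule INT_I)
  then show ?thesis unfolding krull_intersection[OF N] .
qed

text \<open>Over the completion, the inclusion \<open>I\<^sup>n x \<subseteq> I\<^sup>n\<^sup>+\<^sup>1 K\<close> becomes one between extended modules
  with the same exponent, since extension commutes with powers and products. Faithfulness for the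
  submodule \<open>I\<^sup>n\<^sup>+\<^sup>1 K\<close> takes it back to \<open>R\<close>.\<close>

lemma ratliff_rush_reduction_completion_iff:
  assumes I: "ideal I R" and K: "submodule K R M" and L: "submodule L R M" and KL: "K \<subseteq> L"
  defines "B \<equiv> adic_completion R \<mm>" and "\<phi> \<equiv> to_completion R \<mm>"
  shows "ratliff_rush_reduction R M I K L \<longleftrightarrow>
    ratliff_rush_reduction B (base_change R M B \<phi>) (Idl\<^bsub>B\<^esub> (\<phi> ` I))
      (extended_submodule R M B \<phi> K) (extended_submodule R M B \<phi> L)"
proof -
  let ?T = "base_change R M B \<phi>"
  interpret X: scalar_extension R M B \<phi>
    unfolding B_def \<phi>_def using to_completion_hom[OF \<mm>_ideal] module_axioms
    by (simp add: scalar_extension_def scalar_extension_axioms_def)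
  interpret f: semilinear_map R M B ?T \<phi> "\<lambda>x. pure_tensor R M B \<phi> x \<one>\<^bsub>B\<^esub>"
    by (rule X.base_change_semilinear)
  let ?f = "\<lambda>x. pure_tensor R M B \<phi> x \<one>\<^bsub>B\<^esub>"
  have faithful: "y \<in> N" if "submodule N R M" "y \<in> carrier M" "?f y \<in> f.ext_submodule N" for y N
    using completion_faithful[of N y] that unfolding extended_submodule_def B_def \<phi>_def by simp
  note Kc = submoduleE(1)[OF K] and Lc = submoduleE(1)[OF L]
  show ?thesis
    unfolding extended_submodule_def
  proof
    assume "ratliff_rush_reduction R M I K L"
    then show "ratliff_rush_reduction B ?T (f.ext_ideal I) (f.ext_submodule K) (f.ext_submodule L)"
      by (rule f.ratliff_rush_reduction_ext[OF I])
  next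
    assume red: "ratliff_rush_reduction B ?T (f.ext_ideal I) (f.ext_submodule K) (f.ext_submodule L)"
    show "ratliff_rush_reduction R M I K L"
    proof (rule ratliff_rush_reductionI[OF K L KL], rule subsetI)
      fix x assume x: "x \<in> L"
      then have xM: "x \<in> carrier M" using Lc by auto
      have "?f x \<in> ratliff_rush B ?T (f.ext_ideal I) (f.ext_submodule K)"
        using f.B.ratliff_rush_reductionD(4)[OF red] f.ext_submodule_memI[of x L, OF x] by (rule subsetD)
      then obtain n where n: "\<forall>b\<in>ideal_pow B (f.ext_ideal I) n. b \<odot>\<^bsub>?T\<^esub> ?f x
          \<in> ideal_smult B ?T (ideal_pow B (f.ext_ideal I) (Suc n)) (f.ext_submodule K)"
        by (elim f.B.ratliff_rushE)
      have "a \<odot>\<^bsub>M\<^esub> x \<in> ideal_smult R M (ideal_pow R I (Suc n)) K" if a: "a \<in> ideal_pow R I n" for a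
      proof (rule faithful[OF ideal_pow_smult_submodule[OF I K]])
        have aR: "a \<in> carrier R" using ideal_pow_carrier[OF I] a by auto
        then show "a \<odot>\<^bsub>M\<^esub> x \<in> carrier M" using xM by simp
        have "\<phi> a \<in> ideal_pow B (f.ext_ideal I) n"
          unfolding f.ext_ideal_pow[OF I, symmetric] by (rule f.ext_ideal_memI[OF a])
        then have "\<phi> a \<odot>\<^bsub>?T\<^esub> ?f x \<in> f.ext_submodule (ideal_smult R M (ideal_pow R I (Suc n)) K)"
          using bspec[OF n] unfolding f.ext_submodule_pow_smult[OF I Kc] by simp
        then show "?f (a \<odot>\<^bsub>M\<^esub> x) \<in> f.ext_submodule (ideal_smult R M (ideal_pow R I (Suc n)) K)"
          using f.f_smult[OF aR xM] by simp
      qed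
      then show "x \<in> ratliff_rush R M I K" using xM unfolding ratliff_rush_iff by blast
    qed
  qed
qed

end

section \<open>The calculus of Ratliff-Rush reductions\<close>

theorem theorem2p8:
  fixes R :: "('a, 'r) ring_scheme" and E :: "('a, 'e, 'm) module_scheme"
    and I :: "'a set" and N K L :: "'e set"
  assumes "cring R" and "\<one>\<^bsub>R\<^esub> \<noteq> \<zero>\<^bsub>R\<^esub>"
    and "module R E"
    and "ideal I R"
    and "submodule N R E" and "submodule K R E" and "submodule L R E"
  shows
    "(noetherian_ring R \<and> fin_gen_module R E \<and> N \<subseteq> K \<and> K \<subseteq> L
        \<and> ratliff_rush_reduction R E I N K \<and> ratliff_rush_reduction R E I K L
        \<longrightarrow> ratliff_rush_reduction R E I N L)
    \<and>
     (N \<subseteq> K \<longrightarrow> ratliff_rush R E I N \<subseteq> ratliff_rush R E I K)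
    \<and>
     (\<forall>J. N \<subseteq> K \<and> ratliff_rush_reduction R E I N K \<and> ideal J R
        \<longrightarrow> ratliff_rush_reduction R E I (ideal_smult R E J N) (ideal_smult R E J K))
    \<and>
     (\<forall>N\<^sub>1 N\<^sub>2 N\<^sub>3. submodule N\<^sub>1 R E \<and> submodule N\<^sub>2 R E \<and> submodule N\<^sub>3 R E
        \<and> N\<^sub>1 \<subseteq> N\<^sub>2 \<and> N\<^sub>2 \<subseteq> N\<^sub>3 \<and> ratliff_rush_reduction R E I N\<^sub>1 N\<^sub>3
        \<longrightarrow> ratliff_rush_reduction R E I N\<^sub>2 N\<^sub>3)
    \<and>
     (\<forall>N\<^sub>1 N\<^sub>2 M\<^sub>1 M\<^sub>2. submodule N\<^sub>1 R E \<and> submodule N\<^sub>2 R E \<and> submodule M\<^sub>1 R E \<and> submodule M\<^sub>2 R E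
        \<and> ratliff_rush_reduction R E I N\<^sub>1 N\<^sub>2 \<and> ratliff_rush_reduction R E I M\<^sub>1 M\<^sub>2
        \<longrightarrow> ratliff_rush_reduction R E I (N\<^sub>1 <+>\<^bsub>E\<^esub> M\<^sub>1) (N\<^sub>2 <+>\<^bsub>E\<^esub> M\<^sub>2))
    \<and>
     (\<forall>c. module_regular R E c \<and> N \<subseteq> K
        \<and> ratliff_rush_reduction R E I {c \<odot>\<^bsub>E\<^esub> x | x. x \<in> N} {c \<odot>\<^bsub>E\<^esub> x | x. x \<in> K}
        \<longrightarrow> ratliff_rush_reduction R E I N K)
    \<and>
     (\<forall>S. submonoid S R \<and> \<zero>\<^bsub>R\<^esub> \<notin> S \<and> ratliff_rush_reduction R E I N K
        \<longrightarrow> ratliff_rush_reduction (loc_ring R S) (loc_module R E S) (loc_ideal R S I)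
              (loc_submodule E S N) (loc_submodule E S K))
    \<and>
     (\<forall>\<mm>. noetherian_ring R \<and> local_ring R \<mm> \<and> fin_gen_module R E \<and> K \<subseteq> L
        \<longrightarrow> (let R' = adic_completion R \<mm>; \<phi> = to_completion R \<mm> in
             ratliff_rush_reduction R E I K L
             \<longleftrightarrow> ratliff_rush_reduction R' (base_change R E R' \<phi>) (Idl\<^bsub>R'\<^esub> (\<phi> ` I))
                   (extended_submodule R E R' \<phi> K) (extended_submodule R E R' \<phi> L)))"
proof (intro conjI)
  interpret module R E by (rule assms(3))
  note I = assms(4) and N = assms(5) and K = assms(6) and L = assms(7)
  show "noetherian_ring R \<and> fin_gen_module R E \<and> N \<subseteq> K \<and> K \<subseteq> L
      \<and> ratliff_rush_reduction R E I N K \<and> ratliff_rush_reduction R E I K L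
      \<longrightarrow> ratliff_rush_reduction R E I N L"
  proof (intro impI, elim conjE)
    assume fin: "noetherian_ring R" "fin_gen_module R E"
      and red: "ratliff_rush_reduction R E I N K" "ratliff_rush_reduction R E I K L"
    interpret noetherian_module R E by (rule noetherian_moduleI[OF fin])
    obtain P where "finite P" "K = submod_gen R E P" using submodule_fin_gen[OF K] by blast
    then show "ratliff_rush_reduction R E I N L" by (rule ratliff_rush_reduction_trans[OF I _ _ red])
  qed
  show "N \<subseteq> K \<longrightarrow> ratliff_rush R E I N \<subseteq> ratliff_rush R E I K"
    by (intro impI ratliff_rush_mono)
  show "\<forall>J. N \<subseteq> K \<and> ratliff_rush_reduction R E I N K \<and> ideal J R
      \<longrightarrow> ratliff_rush_reduction R E I (ideal_smult R E J N) (ideal_smult R E J K)"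
    using ratliff_rush_reduction_smult[OF I] by simp
  show "\<forall>N\<^sub>1 N\<^sub>2 N\<^sub>3. submodule N\<^sub>1 R E \<and> submodule N\<^sub>2 R E \<and> submodule N\<^sub>3 R E
      \<and> N\<^sub>1 \<subseteq> N\<^sub>2 \<and> N\<^sub>2 \<subseteq> N\<^sub>3 \<and> ratliff_rush_reduction R E I N\<^sub>1 N\<^sub>3
      \<longrightarrow> ratliff_rush_reduction R E I N\<^sub>2 N\<^sub>3"
    by (intro allI impI, elim conjE, rule ratliff_rush_reduction_enlarge)
  show "\<forall>N\<^sub>1 N\<^sub>2 M\<^sub>1 M\<^sub>2. submodule N\<^sub>1 R E \<and> submodule N\<^sub>2 R E \<and> submodule M\<^sub>1 R E \<and> submodule M\<^sub>2 R E
      \<and> ratliff_rush_reduction R E I N\<^sub>1 N\<^sub>2 \<and> ratliff_rush_reduction R E I M\<^sub>1 M\<^sub>2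
      \<longrightarrow> ratliff_rush_reduction R E I (N\<^sub>1 <+>\<^bsub>E\<^esub> M\<^sub>1) (N\<^sub>2 <+>\<^bsub>E\<^esub> M\<^sub>2)"
    by (intro allI impI, elim conjE, rule ratliff_rush_reduction_sum[OF I])
  show "\<forall>c. module_regular R E c \<and> N \<subseteq> K
      \<and> ratliff_rush_reduction R E I {c \<odot>\<^bsub>E\<^esub> x | x. x \<in> N} {c \<odot>\<^bsub>E\<^esub> x | x. x \<in> K}
      \<longrightarrow> ratliff_rush_reduction R E I N K"
    by (intro allI impI, elim conjE, rule ratliff_rush_reduction_cancel[OF I _ N K])
  show "\<forall>S. submonoid S R \<and> \<zero>\<^bsub>R\<^esub> \<notin> S \<and> ratliff_rush_reduction R E I N K
      \<longrightarrow> ratliff_rush_reduction (loc_ring R S) (loc_module R E S) (loc_ideal R S I)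
            (loc_submodule E S N) (loc_submodule E S K)"
  proof (intro allI impI, elim conjE)
    fix S assume "submonoid S R" and red: "ratliff_rush_reduction R E I N K"
    then interpret module_localization R E S
      by (simp add: module_localization_def module_localization_axioms_def module_axioms)
    show "ratliff_rush_reduction (loc_ring R S) (loc_module R E S) (loc_ideal R S I)
        (loc_submodule E S N) (loc_submodule E S K)"
      by (rule ratliff_rush_reduction_localization[OF I red])
  qed
  show "\<forall>\<mm>. noetherian_ring R \<and> local_ring R \<mm> \<and> fin_gen_module R E \<and> K \<subseteq> L
      \<longrightarrow> (let R' = adic_completion R \<mm>; \<phi> = to_completion R \<mm> in
           ratliff_rush_reduction R E I K L
           \<longleftrightarrow> ratliff_rush_reduction R' (base_change R E R' \<phi>) (Idl\<^bsub>R'\<^esub> (\<phi> ` I))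
                 (extended_submodule R E R' \<phi> K) (extended_submodule R E R' \<phi> L))"
  proof (intro allI impI, elim conjE, unfold Let_def)
    fix \<mm> assume a: "noetherian_ring R" "local_ring R \<mm>" "fin_gen_module R E" "K \<subseteq> L"
    interpret noetherian_local_module R E \<mm>
      using noetherian_moduleI[OF a(1,3)] a(1,2)
      by (simp add: noetherian_local_module_def noetherian_local_module_axioms_def)
    show "ratliff_rush_reduction R E I K L \<longleftrightarrow>
        ratliff_rush_reduction (adic_completion R \<mm>)
          (base_change R E (adic_completion R \<mm>) (to_completion R \<mm>))
          (Idl\<^bsub>adic_completion R \<mm>\<^esub> (to_completion R \<mm> ` I))
          (extended_submodule R E (adic_completion R \<mm>) (to_completion R \<mm>) K)
          (extended_submodule R E (adic_completion R \<mm>) (to_completion R \<mm>) L)"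
      by (rule ratliff_rush_reduction_completion_iff[OF I K L a(4)])
  qed
qed

end
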